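(* Let $F=\alpha+\beta$ be a locally projectively flat Randers metric of isotropic S-curvature. Then any conformal vector field $V$ of $F$ is homothetic (its conformal factor is constant), and $V=V^i(x)\,\partial/\partial x^i$ can be locally written (in coordinates in which the pair $(h,\rho)$ associated with $F$ has the form given in the context, with constants $\lambda,\mu$ and constant vector $e$) in one of the forms (i) ($\mu=0,\lambda=0$) $V^i=-2\tau x^i+q^i_kx^k+\gamma^i$ with $Qe=0$; (ii) ($\mu=0,\lambda\ne0$) $V^i=q^i_kx^k+\gamma^i$ with $Qe=-2\lambda\gamma$; (iii) ($\mu\neq0$) $V^i=2\mu\langle\gamma,x\rangle x^i+(1-\mu|x|^2)\gamma^i+q^i_kx^k$ with $\langle\gamma,e\rangle=0$ and $Qe=-2\lambda\gamma$; where $\tau$ is a constant number, $\gamma=(\gamma^i)$ a constant vector and $Q=(q^i_k)$ a constant skew-symmetric matrix.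
   Context: Manifolds are connected and of dimension $n\ge2$. A Randers metric is a Finsler metric $F=\alpha+\beta$ with $\alpha=\sqrt{a_{ij}(x)y^iy^j}$ a Riemannian metric and $\beta=b_i(x)y^i$ a 1-form with $b^2:=\|\beta\|_\alpha^2<1$; here $\beta$ is assumed not to vanish identically on any nonempty open set. $F$ is locally projectively flat if around each point there are coordinates in which its geodesics are straight lines (for a Randers metric: iff $\alpha$ has constant sectional curvature and $\beta$ is closed). The S-curvature is $\mathbf S=\frac{\partial G^m}{\partial y^m}-y^m\frac{\partial\ln\sigma_F}{\partial x^m}$, where $G^i$ are the spray coefficients of $F$ and $\sigma_F$ is the Busemann–Hausdorff volume density; $F$ is of isotropic S-curvature if $\mathbf S=(n+1)\tau(x)F$ for a scalar function $\tau(x)$ (unrelated to the constant $\tau$ in the claim). When $\beta$ is closed this is known to be equivalent to $b_{i;j}=2\tau(a_{ij}-b_ib_j)$, with covariant derivative of $\alpha$. Conformal vector fields: let $V$ be a vector field with flow $\varphi_t$, and $\widetilde\varphi_t(x,y)=(\varphi_t(x),\varphi_{t*}(y))$. $V$ is conformal for $F$ if $\widetilde\varphi_t^*F=e^{-2\sigma_t}F$ for functions $\sigma_t$ on $M$; the conformal factor is $c=\frac{d}{dt}\big|_{t=0}\sigma_t$. Equivalently, $X_V(F)=-2cF$, where $X_V=V^i\frac{\partial}{\partial x^i}+y^i\frac{\partial V^j}{\partial x^i}\frac{\partial}{\partial y^j}$. The associated pair is $h:=\alpha$, $\rho:=\beta/\sqrt{1-b^2}$. Then $h$ has constant sectional curvature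 $\mu$, $\rho$ is closed and conformal with respect to $h$, and in suitable local coordinates $$h=\frac{2}{1+\mu|x|^2}|y|,\qquad \rho=\frac{4}{(1+\mu|x|^2)^2}\Big\{-2(\lambda+\mu\langle e,x\rangle)\langle x,y\rangle+(1+\mu|x|^2)\langle e,y\rangle\Big\}$$ with constants $\lambda,\mu$ and a constant vector $e=(e^i)$. Here $|\cdot|$, $\langle\cdot,\cdot\rangle$ are Euclidean, and $(Qe)^i=q^i_ke^k$. *)

theory Defs
  imports "HOL-Analysis.Analysis"
begin

section \<open>Smooth maps between open subsets of normed spaces\<close>

primrec Ck_on :: "nat \<Rightarrow> 'a::real_normed_vector set \<Rightarrow> ('a \<Rightarrow> 'b::real_normed_vector) \<Rightarrow> bool" where
  "Ck_on 0 S f \<longleftrightarrow> continuous_on S f"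
| "Ck_on (Suc k) S f \<longleftrightarrow>
     (\<forall>x\<in>S. f differentiable (at x)) \<and> (\<forall>v. Ck_on k S (\<lambda>x. frechet_derivative f (at x) v))"

text \<open>Only used for open \<open>S\<close>.\<close>

definition smooth_on :: "'a::real_normed_vector set \<Rightarrow> ('a \<Rightarrow> 'b::real_normed_vector) \<Rightarrow> bool" where
  "smooth_on S f \<longleftrightarrow> (\<forall>k. Ck_on k S f)"

definition pdiff :: "'n::finite \<Rightarrow> (real^'n \<Rightarrow> 'b::real_normed_vector) \<Rightarrow> real^'n \<Rightarrow> 'b" where
  "pdiff i f x = frechet_derivative f (at x) (axis i 1)"


section \<open>Smooth structures\<close>

text \<open>
  The underlying set of a manifold is a whole type \<open>'m\<close>; Hausdorff and second countable are type
  class constraints in the theorem. A chart is a pair of its domain and its coordinate map (whose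
  values outside the domain are irrelevant); a smooth structure is a maximal smooth atlas.
\<close>

type_synonym ('m, 'n) chart = "'m set \<times> ('m \<Rightarrow> real^'n)"

definition is_chart :: "('m::topological_space, 'n::finite) chart \<Rightarrow> bool" where
  "is_chart C \<longleftrightarrow> open (fst C) \<and> open (snd C ` fst C) \<and>
     homeomorphism (fst C) (snd C ` fst C) (snd C) (inv_into (fst C) (snd C))"

abbreviation crange :: "('m, 'n::finite) chart \<Rightarrow> (real^'n) set" where
  "crange C \<equiv> snd C ` fst C"

definition transition :: "('m, 'n::finite) chart \<Rightarrow> ('m, 'n) chart \<Rightarrow> real^'n \<Rightarrow> real^'n" where
  "transition C D = snd D \<circ> inv_into (fst C) (snd C)"

definition compatible :: "('m, 'n::finite) chart \<Rightarrow> ('m, 'n) chart \<Rightarrow> bool" where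
  "compatible C D \<longleftrightarrow> smooth_on (snd C ` (fst C \<inter> fst D)) (transition C D) \<and>
     smooth_on (snd D ` (fst C \<inter> fst D)) (transition D C)"

definition smooth_structure :: "('m::topological_space, 'n::finite) chart set \<Rightarrow> bool" where
  "smooth_structure A \<longleftrightarrow>
     (\<forall>C\<in>A. is_chart C) \<and> (\<Union>C\<in>A. fst C) = UNIV \<and> (\<forall>C\<in>A. \<forall>D\<in>A. compatible C D) \<and>
     (\<forall>C. is_chart C \<and> (\<forall>D\<in>A. compatible C D) \<longrightarrow> C \<in> A)"

text \<open>
  The differential of the change of coordinates from \<open>C\<close> to \<open>D\<close>, at the point \<open>p\<close>:
  it sends the components of a tangent vector in \<open>C\<close> to its components in \<open>D\<close>.
\<close>

definition dtrans :: "('m, 'n::finite) chart \<Rightarrow> ('m, 'n) chart \<Rightarrow> 'm \<Rightarrow> real^'n \<Rightarrow> real^'n" where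
  "dtrans C D p = frechet_derivative (transition C D) (at (snd C p))"


section \<open>Tensor fields and Finsler metrics\<close>

text \<open>
  A field is given by its components in every chart, as functions of the coordinates \<open>x\<close>
  (and, for a Finsler metric, of the components \<open>y\<close> of a tangent vector), subject to the
  usual transformation law.
\<close>

definition vector_field ::
    "('m::topological_space, 'n::finite) chart set \<Rightarrow> (('m, 'n) chart \<Rightarrow> real^'n \<Rightarrow> real^'n) \<Rightarrow> bool" where
  "vector_field A V \<longleftrightarrow>
     (\<forall>C\<in>A. smooth_on (crange C) (V C)) \<and>
     (\<forall>C\<in>A. \<forall>D\<in>A. \<forall>p\<in>fst C \<inter> fst D. V D (snd D p) = dtrans C D p (V C (snd C p)))"

definition one_form ::
    "('m::topological_space, 'n::finite) chart set \<Rightarrow> (('m, 'n) chart \<Rightarrow> real^'n \<Rightarrow> real^'n) \<Rightarrow> bool" where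
  "one_form A b \<longleftrightarrow>
     (\<forall>C\<in>A. smooth_on (crange C) (b C)) \<and>
     (\<forall>C\<in>A. \<forall>D\<in>A. \<forall>p\<in>fst C \<inter> fst D. \<forall>y.
        b D (snd D p) \<bullet> dtrans C D p y = b C (snd C p) \<bullet> y)"

definition riemannian_metric ::
    "('m::topological_space, 'n::finite) chart set \<Rightarrow> (('m, 'n) chart \<Rightarrow> real^'n \<Rightarrow> real^'n^'n) \<Rightarrow> bool" where
  "riemannian_metric A a \<longleftrightarrow>
     (\<forall>C\<in>A. smooth_on (crange C) (a C)) \<and>
     (\<forall>C\<in>A. \<forall>x\<in>crange C. transpose (a C x) = a C x \<and> (\<forall>y. y \<noteq> 0 \<longrightarrow> y \<bullet> (a C x *v y) > 0)) \<and>
     (\<forall>C\<in>A. \<forall>D\<in>A. \<forall>p\<in>fst C \<inter> fst D. \<forall>y z.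
        dtrans C D p y \<bullet> (a D (snd D p) *v dtrans C D p z) = y \<bullet> (a C (snd C p) *v z))"

text \<open>The fundamental tensor \<open>g\<^sub>i\<^sub>j = 1/2 \<partial>\<^sup>2(F\<^sup>2)/\<partial>y\<^sup>i\<partial>y\<^sup>j\<close>.\<close>

definition fund :: "(real^'n \<Rightarrow> real^'n \<Rightarrow> real) \<Rightarrow> real^'n \<Rightarrow> real^'n \<Rightarrow> real^'n^'n::finite" where
  "fund F x y = (\<chi> i j. 1/2 * pdiff i (\<lambda>u. pdiff j (\<lambda>v. (F x v)\<^sup>2) u) y)"

definition finsler_metric ::
    "('m::topological_space, 'n::finite) chart set \<Rightarrow> (('m, 'n) chart \<Rightarrow> real^'n \<Rightarrow> real^'n \<Rightarrow> real) \<Rightarrow> bool" where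
  "finsler_metric A F \<longleftrightarrow>
     (\<forall>C\<in>A. smooth_on (crange C \<times> (- {0})) (\<lambda>(x, y). F C x y)) \<and>
     (\<forall>C\<in>A. \<forall>x\<in>crange C. \<forall>y. \<forall>k>0. F C x (k *\<^sub>R y) = k * F C x y) \<and>
     (\<forall>C\<in>A. \<forall>x\<in>crange C. \<forall>y. y \<noteq> 0 \<longrightarrow>
        F C x y > 0 \<and> (\<forall>v. v \<noteq> 0 \<longrightarrow> v \<bullet> (fund (F C) x y *v v) > 0)) \<and>
     (\<forall>C\<in>A. \<forall>D\<in>A. \<forall>p\<in>fst C \<inter> fst D. \<forall>y.
        F D (snd D p) (dtrans C D p y) = F C (snd C p) y)"

definition alpha_norm :: "real^'n^'n \<Rightarrow> real^'n::finite \<Rightarrow> real" where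
  "alpha_norm g y = sqrt (y \<bullet> (g *v y))"

text \<open>\<open>b\<^sup>2 = a\<^sup>i\<^sup>j b\<^sub>i b\<^sub>j\<close>, the squared norm of a covector \<open>w\<close> for the metric with matrix \<open>g\<close>.\<close>

definition conorm2 :: "real^'n^'n \<Rightarrow> real^'n::finite \<Rightarrow> real" where
  "conorm2 g w = w \<bullet> (matrix_inv g *v w)"

definition randers_metric ::
    "('m::topological_space, 'n::finite) chart set \<Rightarrow> (('m, 'n) chart \<Rightarrow> real^'n \<Rightarrow> real^'n \<Rightarrow> real) \<Rightarrow>
     (('m, 'n) chart \<Rightarrow> real^'n \<Rightarrow> real^'n^'n) \<Rightarrow> (('m, 'n) chart \<Rightarrow> real^'n \<Rightarrow> real^'n) \<Rightarrow> bool" where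
  "randers_metric A F a b \<longleftrightarrow>
     finsler_metric A F \<and> riemannian_metric A a \<and> one_form A b \<and>
     (\<forall>C\<in>A. \<forall>x\<in>crange C. conorm2 (a C x) (b C x) < 1 \<and>
        (\<forall>y. F C x y = alpha_norm (a C x) y + b C x \<bullet> y))"

definition nowhere_locally_zero ::
    "('m::topological_space, 'n::finite) chart set \<Rightarrow> (('m, 'n) chart \<Rightarrow> real^'n \<Rightarrow> real^'n) \<Rightarrow> bool" where
  "nowhere_locally_zero A b \<longleftrightarrow>
     (\<forall>U. open U \<and> U \<noteq> {} \<longrightarrow> (\<exists>p\<in>U. \<exists>C\<in>A. p \<in> fst C \<and> b C (snd C p) \<noteq> 0))"


section \<open>Spray, geodesics, S-curvature\<close>

text \<open>
  \<open>G\<^sup>i = 1/4 g\<^sup>i\<^sup>l {\<partial>\<^sup>2(F\<^sup>2)/\<partial>x\<^sup>k\<partial>y\<^sup>l y\<^sup>k - \<partial>(F\<^sup>2)/\<partial>x\<^sup>l}\<close>, the normalisation for which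
  the geodesic equation is \<open>x'' + 2 G(x, x') = 0\<close>.
\<close>

definition spray :: "(real^'n \<Rightarrow> real^'n \<Rightarrow> real) \<Rightarrow> real^'n \<Rightarrow> real^'n \<Rightarrow> real^'n::finite" where
  "spray F x y = (1/4) *\<^sub>R (matrix_inv (fund F x y) *v
     (\<chi> l. (\<Sum>k\<in>UNIV. pdiff k (\<lambda>u. pdiff l (\<lambda>v. (F u v)\<^sup>2) y) x * y $ k)
            - pdiff l (\<lambda>u. (F u y)\<^sup>2) x))"

text \<open>\<open>\<gamma>'\<close> is the velocity of \<open>\<gamma>\<close>; constant curves are excluded.\<close>

definition geodesic ::
    "(real^'n \<Rightarrow> real^'n \<Rightarrow> real) \<Rightarrow> (real^'n) set \<Rightarrow> real set \<Rightarrow> (real \<Rightarrow> real^'n) \<Rightarrow>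
     (real \<Rightarrow> real^'n::finite) \<Rightarrow> bool" where
  "geodesic F W I \<gamma> \<gamma>' \<longleftrightarrow> (\<forall>t\<in>I. \<gamma> t \<in> W \<and> \<gamma>' t \<noteq> 0 \<and>
     (\<gamma> has_vector_derivative \<gamma>' t) (at t) \<and>
     (\<gamma>' has_vector_derivative (- 2) *\<^sub>R spray F (\<gamma> t) (\<gamma>' t)) (at t))"

text \<open>
  The first conjunct says that every geodesic in the coordinate domain \<open>W\<close> lies on a straight line.
  The second one is the local existence of geodesics with given initial velocity; by the existence
  theorem for ordinary differential equations it holds for every Finsler metric.
\<close>

definition straight_geodesics :: "(real^'n \<Rightarrow> real^'n \<Rightarrow> real) \<Rightarrow> (real^'n::finite) set \<Rightarrow> bool" where
  "straight_geodesics F W \<longleftrightarrow>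
     (\<forall>l u \<gamma> \<gamma>'. geodesic F W {l<..<u} \<gamma> \<gamma>' \<longrightarrow>
        (\<exists>q v. \<forall>t\<in>{l<..<u}. \<exists>s. \<gamma> t = q + s *\<^sub>R v)) \<and>
     (\<forall>x\<in>W. \<forall>y. y \<noteq> 0 \<longrightarrow>
        (\<exists>\<epsilon>>0. \<exists>\<gamma> \<gamma>'. geodesic F W {-\<epsilon><..<\<epsilon>} \<gamma> \<gamma>' \<and> \<gamma> 0 = x \<and> \<gamma>' 0 = y))"

definition locally_projectively_flat ::
    "('m::topological_space, 'n::finite) chart set \<Rightarrow> (('m, 'n) chart \<Rightarrow> real^'n \<Rightarrow> real^'n \<Rightarrow> real) \<Rightarrow> bool" where
  "locally_projectively_flat A F \<longleftrightarrow>
     (\<forall>p. \<exists>C\<in>A. p \<in> fst C \<and> straight_geodesics (F C) (crange C))"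

text \<open>The Busemann--Hausdorff density is the volume of the Euclidean unit ball divided by that of the
  unit ball of \<open>F\<close> in the tangent space.\<close>

definition bh_density :: "(real^'n \<Rightarrow> real^'n \<Rightarrow> real) \<Rightarrow> real^'n::finite \<Rightarrow> real" where
  "bh_density F x = measure lebesgue (ball (0::real^'n) 1) / measure lebesgue {y. F x y < 1}"

definition S_curvature :: "(real^'n \<Rightarrow> real^'n \<Rightarrow> real) \<Rightarrow> real^'n \<Rightarrow> real^'n::finite \<Rightarrow> real" where
  "S_curvature F x y =
     (\<Sum>m\<in>UNIV. pdiff m (\<lambda>v. spray F x v $ m) y)
     - (\<Sum>m\<in>UNIV. y $ m * pdiff m (\<lambda>u. ln (bh_density F u)) x)"

definition isotropic_S_curvature ::
    "('m::topological_space, 'n::finite) chart set \<Rightarrow> (('m, 'n) chart \<Rightarrow> real^'n \<Rightarrow> real^'n \<Rightarrow> real) \<Rightarrow> bool" where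
  "isotropic_S_curvature A F \<longleftrightarrow>
     (\<exists>\<tau> :: 'm \<Rightarrow> real. \<forall>C\<in>A. \<forall>p\<in>fst C. \<forall>y. y \<noteq> 0 \<longrightarrow>
        S_curvature (F C) (snd C p) y = (real CARD('n) + 1) * \<tau> p * F C (snd C p) y)"


section \<open>Conformal vector fields\<close>

text \<open>
  \<open>V\<close> is conformal with conformal factor \<open>\<kappa>\<close>. Around every point, \<open>\<Phi> t\<close> is the local flow of \<open>V\<close>,
  written in a chart; its prolongation \<open>(\<Phi> t x, d(\<Phi> t) y)\<close> pulls \<open>F\<close> back to
  \<open>exp (- 2 \<sigma>\<^sub>t) F\<close>, and \<open>\<kappa>\<close> is the derivative of \<open>\<sigma>\<^sub>t\<close> at \<open>t = 0\<close>.
\<close>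

definition conformal_field ::
    "('m::topological_space, 'n::finite) chart set \<Rightarrow> (('m, 'n) chart \<Rightarrow> real^'n \<Rightarrow> real^'n \<Rightarrow> real) \<Rightarrow>
     (('m, 'n) chart \<Rightarrow> real^'n \<Rightarrow> real^'n) \<Rightarrow> ('m \<Rightarrow> real) \<Rightarrow> bool" where
  "conformal_field A F V \<kappa> \<longleftrightarrow> vector_field A V \<and>
     (\<forall>p. \<exists>C\<in>A. \<exists>U \<epsilon> \<Phi> \<sigma>.
        open U \<and> p \<in> U \<and> U \<subseteq> fst C \<and> \<epsilon> > 0 \<and>
        smooth_on ({-\<epsilon><..<\<epsilon>} \<times> snd C ` U) (\<lambda>(t, x). \<Phi> t x) \<and>
        (\<forall>x\<in>snd C ` U. \<Phi> 0 x = x) \<and>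
        (\<forall>t\<in>{-\<epsilon><..<\<epsilon>}. \<forall>x\<in>snd C ` U.
           \<Phi> t x \<in> crange C \<and>
           ((\<lambda>s. \<Phi> s x) has_vector_derivative V C (\<Phi> t x)) (at t) \<and>
           (\<forall>y. F C (\<Phi> t x) (frechet_derivative (\<Phi> t) (at x) y) = exp (- 2 * \<sigma> t x) * F C x y)) \<and>
        (\<forall>q\<in>U. ((\<lambda>t. \<sigma> t (snd C q)) has_real_derivative \<kappa> q) (at 0)))"


section \<open>The associated pair and its normal form\<close>

text \<open>
  In the chart \<open>C\<close>, the pair \<open>h = \<alpha>\<close>, \<open>\<rho> = \<beta> / sqrt (1 - b\<^sup>2)\<close> has the normal form with constants
  \<open>lam\<close>, \<open>\<mu>\<close> and constant vector \<open>e\<close>. As \<open>\<alpha>\<close> is positive definite, the first equation forces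
  \<open>1 + \<mu> \<bar>x\<bar>\<^sup>2 > 0\<close>, so there is no division by zero.
\<close>

definition pair_normal_form ::
    "(('m, 'n) chart \<Rightarrow> real^'n \<Rightarrow> real^'n^'n) \<Rightarrow> (('m, 'n) chart \<Rightarrow> real^'n \<Rightarrow> real^'n) \<Rightarrow>
     ('m, 'n::finite) chart \<Rightarrow> real \<Rightarrow> real \<Rightarrow> real^'n \<Rightarrow> bool" where
  "pair_normal_form a b C lam \<mu> e \<longleftrightarrow>
     (\<forall>x\<in>crange C. \<forall>y.
        alpha_norm (a C x) y = 2 / (1 + \<mu> * (norm x)\<^sup>2) * norm y \<and>
        (b C x \<bullet> y) / sqrt (1 - conorm2 (a C x) (b C x)) =
          4 / (1 + \<mu> * (norm x)\<^sup>2)\<^sup>2 *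
            (- 2 * (lam + \<mu> * (e \<bullet> x)) * (x \<bullet> y) + (1 + \<mu> * (norm x)\<^sup>2) * (e \<bullet> y)))"

end

theory Submission
  imports Defs
begin

text \<open>
  In coordinates in which the geodesics of \<open>F\<close> are straight lines, the parts of Hamel's equation
  that are even and odd in \<open>y\<close> say that \<open>\<alpha>\<close> is projectively flat, with some factor \<open>\<theta>\<close>, and that
  \<open>\<beta>\<close> is closed; the isotropy of the S-curvature then gives \<open>b\<^sub>i\<^sub>;\<^sub>j = 2 \<tau> (a\<^sub>i\<^sub>j - b\<^sub>i b\<^sub>j)\<close>, so
  \<open>\<rho>\<^sub>i\<^sub>;\<^sub>j = c h\<^sub>i\<^sub>j\<close>. The integrability conditions are \<open>\<partial>\<theta> - \<theta> \<theta> = - \<mu> h\<close> with \<open>\<mu>\<close> constant and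
  \<open>dc = - \<mu> \<rho>\<close>. These equations can be integrated explicitly along lines, which yields the normal
  form; \<open>\<mu>\<close> is the same in all charts since \<open>c\<close> is a function on the manifold and \<open>\<rho> \<noteq> 0\<close> on a
  dense set.

  A conformal field satisfies \<open>L\<^sub>V h = - 2 \<kappa> h\<close> as a norm and \<open>L\<^sub>V \<rho> = - 2 \<kappa> \<rho>\<close>. Evaluating the
  latter on the dual vector of \<open>\<rho>\<close> gives \<open>c \<rho>(V) = 0\<close>, so \<open>\<rho>(V) = 0\<close> unless \<open>\<lambda> = \<mu> = 0\<close>. Then
  \<open>L\<^sub>V \<rho> = d(\<rho>(V)) = 0\<close>, so \<open>\<kappa> = 0\<close> and \<open>V\<close> is a Killing field of \<open>h\<close> with \<open>\<rho>(V) = 0\<close>. If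
  \<open>\<lambda> = \<mu> = 0\<close>, then \<open>\<rho>\<close> is parallel and nonzero, which forces \<open>\<kappa>\<close> to be constant.
\<close>

abbreviation dd :: "('a::real_normed_vector \<Rightarrow> 'b::real_normed_vector) \<Rightarrow> 'a \<Rightarrow> 'a \<Rightarrow> 'b"
  where "dd f x \<equiv> frechet_derivative f (at x)"

lemma dd_eq: "(f has_derivative f') (at x) \<Longrightarrow> dd f x = f'"
  by (simp add: frechet_derivative_at[symmetric])

lemma dd_transform:
  assumes "open S" "x \<in> S" "\<And>u. u \<in> S \<Longrightarrow> f u = g u" "g differentiable (at x)"
  shows "dd f x = dd g x" "f differentiable (at x)"
proof -
  have "(g has_derivative dd g x) (at x)" using assms(4) frechet_derivative_works by blast
  then have "(f has_derivative dd g x) (at x)"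
    by (rule has_derivative_transform_within_open[OF _ assms(1,2)]) (use assms(3) in auto)
  then show "dd f x = dd g x" "f differentiable (at x)" by (auto simp: dd_eq differentiable_def)
qed

lemma pdiff_eq: "(f has_derivative f') (at x) \<Longrightarrow> pdiff i f x = f' (axis i 1)"
  by (simp add: pdiff_def dd_eq)

lemma linear_eq_sum_axis:
  fixes L :: "real^'n::finite \<Rightarrow> 'b::real_vector"
  assumes "linear L"
  shows "L y = (\<Sum>k\<in>UNIV. y $ k *\<^sub>R L (axis k 1))"
proof -
  have "L y = L (\<Sum>k\<in>UNIV. y $ k *\<^sub>R axis k 1)"
    using basis_expansion[of y] by (simp add: scalar_mult_eq_scaleR)
  then show ?thesis using assms by (simp add: linear_sum linear_scale)
qed

section \<open>Calculus of smooth maps\<close>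

lemma Ck_on_cong:
  assumes "open S" "\<And>x. x \<in> S \<Longrightarrow> f x = g x" "Ck_on k S g"
  shows "Ck_on k S f"
  using assms
proof (induction k arbitrary: f g)
  case 0
  then show ?case using continuous_on_cong[of S S f g] by simp
next
  case (Suc k)
  have *: "dd f x = dd g x" "f differentiable (at x)" if "x \<in> S" for x
    using dd_transform[of S x f g] Suc.prems that by auto
  show ?case
    using Suc.IH[of "\<lambda>x. dd f x v" "\<lambda>x. dd g x v" for v] Suc.prems * by auto
qed

lemma Ck_on_subset: "Ck_on k T f \<Longrightarrow> S \<subseteq> T \<Longrightarrow> Ck_on k S f"
  by (induction k arbitrary: f) (auto intro: continuous_on_subset)

lemma Ck_on_SucD: "Ck_on (Suc k) S f \<Longrightarrow> Ck_on k S f"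
proof (induction k arbitrary: f)
  case 0
  then show ?case
    by (auto intro!: differentiable_imp_continuous_on differentiable_at_imp_differentiable_on)
next
  case (Suc k)
  then show ?case by (metis Ck_on.simps(2))
qed

lemma Ck_on_Suc_I:
  assumes "open S" "\<And>x. x \<in> S \<Longrightarrow> (f has_derivative f' x) (at x)" "\<And>v. Ck_on k S (\<lambda>x. f' x v)"
  shows "Ck_on (Suc k) S f"
proof -
  have "Ck_on k S (\<lambda>x. dd f x v)" for v
    by (rule Ck_on_cong[OF assms(1) _ assms(3)[of v]]) (use assms(2) dd_eq in metis)
  then show ?thesis using assms(2) by (auto simp: differentiable_def)
qed

lemma Ck_on_has_derivative: "Ck_on (Suc k) S f \<Longrightarrow> x \<in> S \<Longrightarrow> (f has_derivative dd f x) (at x)"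
  using frechet_derivative_works by auto

lemma Ck_on_dd: "Ck_on (Suc k) S f \<Longrightarrow> Ck_on k S (\<lambda>x. dd f x v)"
  by simp

lemma Ck_on_const: "open S \<Longrightarrow> Ck_on k S (\<lambda>x. c)"
  by (induction k arbitrary: c) auto

lemma Ck_on_bounded_linear:
  assumes "open S" "bounded_linear L" "Ck_on k S f"
  shows "Ck_on k S (\<lambda>x. L (f x))"
  using assms(3)
proof (induction k arbitrary: f)
  case 0
  then show ?case using assms(2) by (simp add: bounded_linear.continuous_on)
next
  case (Suc k)
  show ?case
  proof (rule Ck_on_Suc_I[OF assms(1), where f' = "\<lambda>x v. L (dd f x v)"])
    show "((\<lambda>x. L (f x)) has_derivative (\<lambda>v. L (dd f x v))) (at x)" if "x \<in> S" for x
      by (rule bounded_linear.has_derivative[OF assms(2) Ck_on_has_derivative[OF Suc.prems that]])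
    show "Ck_on k S (\<lambda>x. L (dd f x v))" for v
      using Suc.IH[OF Ck_on_dd[OF Suc.prems]] .
  qed
qed

lemma Ck_on_ident: "open S \<Longrightarrow> Ck_on k S (\<lambda>x. x)"
  by (cases k) (auto intro!: Ck_on_const)

lemma Ck_on_add:
  assumes "open S" "Ck_on k S f" "Ck_on k S g"
  shows "Ck_on k S (\<lambda>x. f x + g x)"
  using assms(2,3)
proof (induction k arbitrary: f g)
  case 0
  then show ?case by (simp add: continuous_on_add)
next
  case (Suc k)
  show ?case
  proof (rule Ck_on_Suc_I[OF assms(1), where f' = "\<lambda>x v. dd f x v + dd g x v"])
    show "((\<lambda>x. f x + g x) has_derivative (\<lambda>v. dd f x v + dd g x v)) (at x)" if "x \<in> S" for x
      by (intro has_derivative_add Ck_on_has_derivative[OF Suc.prems(1) that]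
          Ck_on_has_derivative[OF Suc.prems(2) that])
    show "Ck_on k S (\<lambda>x. dd f x v + dd g x v)" for v
      by (rule Suc.IH[OF Ck_on_dd[OF Suc.prems(1)] Ck_on_dd[OF Suc.prems(2)]])
  qed
qed

lemma Ck_on_bilinear:
  assumes "open S" "bounded_bilinear B" "Ck_on k S f" "Ck_on k S g"
  shows "Ck_on k S (\<lambda>x. B (f x) (g x))"
  using assms(3,4)
proof (induction k arbitrary: f g)
  case 0
  then show ?case by (simp add: bounded_bilinear.continuous_on[OF assms(2)])
next
  case (Suc k)
  show ?case
  proof (rule Ck_on_Suc_I[OF assms(1), where f' = "\<lambda>x v. B (f x) (dd g x v) + B (dd f x v) (g x)"])
    show "((\<lambda>x. B (f x) (g x)) has_derivative (\<lambda>v. B (f x) (dd g x v) + B (dd f x v) (g x))) (at x)"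
      if "x \<in> S" for x
      by (intro bounded_bilinear.FDERIV[OF assms(2)] Ck_on_has_derivative[OF Suc.prems(1) that]
          Ck_on_has_derivative[OF Suc.prems(2) that])
    show "Ck_on k S (\<lambda>x. B (f x) (dd g x v) + B (dd f x v) (g x))" for v
      by (intro Ck_on_add[OF assms(1)] Suc.IH Ck_on_SucD[OF Suc.prems(1)] Ck_on_SucD[OF Suc.prems(2)]
          Ck_on_dd[OF Suc.prems(1)] Ck_on_dd[OF Suc.prems(2)])
  qed
qed

lemma Ck_on_sum:
  assumes "open S" "\<And>i. i \<in> I \<Longrightarrow> Ck_on k S (f i)"
  shows "Ck_on k S (\<lambda>x. \<Sum>i\<in>I. f i x)"
  using assms(2)
  by (induction I rule: infinite_finite_induct) (auto simp: Ck_on_const[OF assms(1)] intro: Ck_on_add[OF assms(1)])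

text \<open>By the chain rule the derivative of g at f x is taken in the moving direction
  \<open>dd f x v\<close>, whereas \<open>Ck_on\<close> controls fixed directions. Expanding the
  direction in a basis of the intermediate space gives a sum of products to which the induction
  hypothesis applies.\<close>

lemma Ck_on_compose:
  fixes f :: "'a::real_normed_vector \<Rightarrow> 'b::euclidean_space"
  assumes "open S" "open T" "f ` S \<subseteq> T" "Ck_on k S f" "Ck_on k T g"
  shows "Ck_on k S (\<lambda>x. g (f x))"
  using assms(4,5)
proof (induction k arbitrary: g)
  case 0
  then show ?case using continuous_on_compose2[of T g S f] assms(3) by simp
next
  case (Suc k)
  show ?case
  proof (rule Ck_on_Suc_I[OF assms(1), where f' = "\<lambda>x v. \<Sum>i\<in>Basis. (dd f x v \<bullet> i) *\<^sub>R dd g (f x) i"])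
    fix x assume x: "x \<in> S"
    then have fx: "f x \<in> T" using assms(3) by auto
    have g: "(g has_derivative dd g (f x)) (at (f x))" by (rule Ck_on_has_derivative[OF Suc.prems(2) fx])
    have eq: "dd g (f x) y = (\<Sum>i\<in>Basis. (y \<bullet> i) *\<^sub>R dd g (f x) i)" for y
    proof -
      have lin: "linear (dd g (f x))" using g has_derivative_linear by blast
      have "dd g (f x) y = dd g (f x) (\<Sum>i\<in>Basis. (y \<bullet> i) *\<^sub>R i)" by (simp add: euclidean_representation)
      then show ?thesis using lin by (simp add: linear_sum linear_scale)
    qed
    have "((\<lambda>x. g (f x)) has_derivative (\<lambda>v. dd g (f x) (dd f x v))) (at x)"
      by (rule has_derivative_compose[OF Ck_on_has_derivative[OF Suc.prems(1) x] g])
    then show "((\<lambda>x. g (f x)) has_derivative (\<lambda>v. \<Sum>i\<in>Basis. (dd f x v \<bullet> i) *\<^sub>R dd g (f x) i)) (at x)"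
      using eq[of "dd f x v" for v] by simp
  next
    fix v
    have "Ck_on k S (\<lambda>x. dd g (f x) i)" for i
      using Suc.IH[OF Ck_on_SucD[OF Suc.prems(1)] Ck_on_dd[OF Suc.prems(2)]] .
    moreover have "Ck_on k S (\<lambda>x. dd f x v \<bullet> i)" for i
      by (rule Ck_on_bounded_linear[OF assms(1) bounded_linear_inner_left Ck_on_dd[OF Suc.prems(1)]])
    ultimately show "Ck_on k S (\<lambda>x. \<Sum>i\<in>Basis. (dd f x v \<bullet> i) *\<^sub>R dd g (f x) i)"
      by (intro Ck_on_sum[OF assms(1)] Ck_on_bilinear[OF assms(1) bounded_bilinear_scaleR])
  qed
qed

section \<open>Closure properties of smooth maps\<close>

lemma smooth_on_cong: "open S \<Longrightarrow> (\<And>x. x \<in> S \<Longrightarrow> f x = g x) \<Longrightarrow> smooth_on S g \<Longrightarrow> smooth_on S f"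
  unfolding smooth_on_def using Ck_on_cong by blast

lemma smooth_on_subset: "smooth_on T f \<Longrightarrow> S \<subseteq> T \<Longrightarrow> smooth_on S f"
  unfolding smooth_on_def using Ck_on_subset by blast

lemma smooth_on_has_derivative: "smooth_on S f \<Longrightarrow> x \<in> S \<Longrightarrow> (f has_derivative dd f x) (at x)"
  unfolding smooth_on_def using Ck_on_has_derivative by blast

lemma smooth_on_linear: "smooth_on S f \<Longrightarrow> x \<in> S \<Longrightarrow> linear (dd f x)"
  using smooth_on_has_derivative has_derivative_linear by blast

lemma smooth_on_differentiable: "smooth_on S f \<Longrightarrow> x \<in> S \<Longrightarrow> f differentiable (at x)"
  using smooth_on_has_derivative differentiable_def by blast

lemma smooth_on_continuous: "smooth_on S f \<Longrightarrow> continuous_on S f"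
  unfolding smooth_on_def by (metis Ck_on.simps(1))

lemma smooth_on_dd: "smooth_on S f \<Longrightarrow> smooth_on S (\<lambda>x. dd f x v)"
  unfolding smooth_on_def using Ck_on_dd by blast

lemma smooth_on_const: "open S \<Longrightarrow> smooth_on S (\<lambda>x. c)"
  unfolding smooth_on_def using Ck_on_const by blast

lemma smooth_on_ident: "open S \<Longrightarrow> smooth_on S (\<lambda>x. x)"
  unfolding smooth_on_def using Ck_on_ident by blast

lemma smooth_on_bounded_linear:
  "open S \<Longrightarrow> bounded_linear L \<Longrightarrow> smooth_on S f \<Longrightarrow> smooth_on S (\<lambda>x. L (f x))"
  unfolding smooth_on_def using Ck_on_bounded_linear by blast

lemma smooth_on_add: "open S \<Longrightarrow> smooth_on S f \<Longrightarrow> smooth_on S g \<Longrightarrow> smooth_on S (\<lambda>x. f x + g x)"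
  unfolding smooth_on_def using Ck_on_add by blast

lemma smooth_on_minus: "open S \<Longrightarrow> smooth_on S f \<Longrightarrow> smooth_on S (\<lambda>x. - f x)"
  using smooth_on_bounded_linear[OF _ bounded_linear_minus[OF bounded_linear_ident]] .

lemma smooth_on_diff: "open S \<Longrightarrow> smooth_on S f \<Longrightarrow> smooth_on S g \<Longrightarrow> smooth_on S (\<lambda>x. f x - g x)"
  using smooth_on_add[of S f "\<lambda>x. - g x"] smooth_on_minus[of S g] by simp

lemma smooth_on_bilinear:
  "open S \<Longrightarrow> bounded_bilinear B \<Longrightarrow> smooth_on S f \<Longrightarrow> smooth_on S g \<Longrightarrow> smooth_on S (\<lambda>x. B (f x) (g x))"
  unfolding smooth_on_def using Ck_on_bilinear by blast

lemmas smooth_on_mult = smooth_on_bilinear[OF _ bounded_bilinear_mult]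
  and smooth_on_scaleR = smooth_on_bilinear[OF _ bounded_bilinear_scaleR]
  and smooth_on_inner = smooth_on_bilinear[OF _ bounded_bilinear_inner]

lemma smooth_on_sum:
  "open S \<Longrightarrow> (\<And>i. i \<in> I \<Longrightarrow> smooth_on S (f i)) \<Longrightarrow> smooth_on S (\<lambda>x. \<Sum>i\<in>I. f i x)"
  unfolding smooth_on_def using Ck_on_sum[of S I _ f] by simp

lemma smooth_on_prod:
  fixes f :: "'i \<Rightarrow> 'a::real_normed_vector \<Rightarrow> real"
  assumes "open S" "\<And>i. i \<in> I \<Longrightarrow> smooth_on S (f i)"
  shows "smooth_on S (\<lambda>x. \<Prod>i\<in>I. f i x)"
  using assms(2)
  by (induction I rule: infinite_finite_induct)
     (auto simp: smooth_on_const[OF assms(1)] intro: smooth_on_mult[OF assms(1)])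

lemma smooth_on_compose:
  fixes f :: "'a::real_normed_vector \<Rightarrow> 'b::euclidean_space"
  shows "open S \<Longrightarrow> open T \<Longrightarrow> f ` S \<subseteq> T \<Longrightarrow> smooth_on S f \<Longrightarrow> smooth_on T g \<Longrightarrow> smooth_on S (\<lambda>x. g (f x))"
  unfolding smooth_on_def using Ck_on_compose by blast

text \<open>The derivative is a multiple of the square of the function itself, so the induction on
  the order closes without a formula for higher derivatives.\<close>

lemma smooth_on_inverse_fun: "smooth_on {0<..} (inverse :: real \<Rightarrow> real)"
  "smooth_on (- {0}) (inverse :: real \<Rightarrow> real)"
proof -
  have "Ck_on k (- {0}) (inverse :: real \<Rightarrow> real)" for k
  proof (induction k)
    case 0
    then show ?case by (auto intro!: continuous_intros)
  next
    case (Suc k)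
    have o: "open (- {0::real})" by auto
    show ?case
    proof (rule Ck_on_Suc_I[OF o, where f' = "\<lambda>x v. - (inverse x * v * inverse x)"])
      show "(inverse has_derivative (\<lambda>v. - (inverse x * v * inverse x))) (at x)" if "x \<in> - {0}" for x :: real
        using that by (auto intro: has_derivative_inverse')
      have "Ck_on k (- {0}) (\<lambda>x. (- v) *\<^sub>R (inverse x * inverse x :: real))" for v
        by (intro Ck_on_bounded_linear[OF o bounded_linear_scaleR_right] Ck_on_bilinear[OF o bounded_bilinear_mult] Suc)
      then show "Ck_on k (- {0}) (\<lambda>x. - (inverse x * v * inverse x :: real))" for v
        by (simp add: algebra_simps)
    qed
  qed
  then show "smooth_on (- {0}) (inverse :: real \<Rightarrow> real)" by (auto simp: smooth_on_def)
  then show "smooth_on {0<..} (inverse :: real \<Rightarrow> real)" by (rule smooth_on_subset) auto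
qed

lemma smooth_on_sqrt_fun: "smooth_on {0<..} sqrt"
proof -
  have o: "open {0::real<..}" by auto
  have "Ck_on k {0<..} sqrt" for k
  proof (induction k)
    case 0
    then show ?case by (auto intro!: continuous_intros)
  next
    case (Suc k)
    show ?case
    proof (rule Ck_on_Suc_I[OF o, where f' = "\<lambda>x v. v *\<^sub>R (inverse (sqrt x) / 2)"])
      show "(sqrt has_derivative (\<lambda>v. v *\<^sub>R (inverse (sqrt x) / 2))) (at x)" if "x \<in> {0<..}" for x :: real
        using DERIV_real_sqrt[of x] that unfolding has_field_derivative_def
        by (auto elim!: has_derivative_eq_rhs)
      have "Ck_on k {0<..} (\<lambda>x. inverse (sqrt x))"
        by (rule Ck_on_compose[OF o, of "{0<..}"]) (use Suc smooth_on_inverse_fun(1) in \<open>auto simp: smooth_on_def\<close>)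
      then have "Ck_on k {0<..} (\<lambda>x. (v / 2) *\<^sub>R inverse (sqrt x))" for v
        by (intro Ck_on_bounded_linear[OF o bounded_linear_scaleR_right])
      then show "Ck_on k {0<..} (\<lambda>x. v *\<^sub>R (inverse (sqrt x) / 2))" for v by simp
    qed
  qed
  then show ?thesis by (auto simp: smooth_on_def)
qed

lemma smooth_on_inverse:
  fixes f :: "'a::real_normed_vector \<Rightarrow> real"
  assumes "open S" "\<And>x. x \<in> S \<Longrightarrow> f x \<noteq> 0" "smooth_on S f"
  shows "smooth_on S (\<lambda>x. inverse (f x))"
  by (rule smooth_on_compose[OF assms(1) _ _ assms(3) smooth_on_inverse_fun(2)]) (use assms(2) in auto)

lemma smooth_on_divide:
  fixes f g :: "'a::real_normed_vector \<Rightarrow> real"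
  assumes "open S" "\<And>x. x \<in> S \<Longrightarrow> g x \<noteq> 0" "smooth_on S f" "smooth_on S g"
  shows "smooth_on S (\<lambda>x. f x / g x)"
  unfolding divide_inverse by (intro smooth_on_mult[OF assms(1)] smooth_on_inverse assms)

lemma smooth_on_sqrt:
  fixes f :: "'a::real_normed_vector \<Rightarrow> real"
  assumes "open S" "\<And>x. x \<in> S \<Longrightarrow> f x > 0" "smooth_on S f"
  shows "smooth_on S (\<lambda>x. sqrt (f x))"
  by (rule smooth_on_compose[OF assms(1) _ _ assms(3) smooth_on_sqrt_fun]) (use assms(2) in auto)

lemma smooth_on_componentwise:
  fixes f :: "'a::real_normed_vector \<Rightarrow> 'b::euclidean_space"
  assumes "open S" "\<And>i. i \<in> Basis \<Longrightarrow> smooth_on S (\<lambda>x. f x \<bullet> i)"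
  shows "smooth_on S f"
proof -
  have "smooth_on S (\<lambda>x. \<Sum>i\<in>Basis. (f x \<bullet> i) *\<^sub>R i)"
    by (intro smooth_on_sum smooth_on_bounded_linear[OF _ bounded_linear_scaleR_left] assms)
  then show ?thesis by (simp add: euclidean_representation)
qed

lemma smooth_on_vec_lambda:
  fixes f :: "'a::real_normed_vector \<Rightarrow> real^'n::finite"
  assumes "open S" "\<And>i. smooth_on S (\<lambda>x. f x $ i)"
  shows "smooth_on S f"
proof (rule smooth_on_componentwise[OF assms(1)])
  fix i :: "real^'n" assume "i \<in> Basis"
  then obtain k where "i = axis k 1" by (auto simp: Basis_vec_def)
  then show "smooth_on S (\<lambda>x. f x \<bullet> i)" using assms(2)[of k] by (simp add: inner_axis)
qed

lemma smooth_on_vec_nth: "open S \<Longrightarrow> smooth_on S f \<Longrightarrow> smooth_on S (\<lambda>x. f x $ i)"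
  using smooth_on_bounded_linear[OF _ bounded_linear_vec_nth] .

lemma smooth_on_Pair:
  fixes f :: "'a::real_normed_vector \<Rightarrow> 'b::euclidean_space" and g :: "'a \<Rightarrow> 'c::euclidean_space"
  assumes "open S" "smooth_on S f" "smooth_on S g"
  shows "smooth_on S (\<lambda>x. (f x, g x))"
proof -
  have "smooth_on S (\<lambda>x. (f x, 0) + (0, g x))"
    using assms by (intro smooth_on_add smooth_on_bounded_linear[where f = f and L = "\<lambda>y. (y, 0)"]
        smooth_on_bounded_linear[where f = g and L = "\<lambda>y. (0, y)"] bounded_linear_Pair
        bounded_linear_ident bounded_linear_zero)
  then show ?thesis by simp
qed

section \<open>Determinants, inverse matrices and matrix forms\<close>

lemma smooth_on_det:
  fixes M :: "'a::real_normed_vector \<Rightarrow> real^'n^'n::finite"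
  assumes "open S" "\<And>i j. smooth_on S (\<lambda>x. M x $ i $ j)"
  shows "smooth_on S (\<lambda>x. det (M x))"
  unfolding det_def
  by (intro smooth_on_sum[OF assms(1)] smooth_on_mult[OF assms(1)] smooth_on_const smooth_on_prod assms)

lemma matrix_inv_right: "invertible (A::real^'n^'n::finite) \<Longrightarrow> A ** matrix_inv A = mat 1"
  and matrix_inv_left: "invertible (A::real^'n^'n::finite) \<Longrightarrow> matrix_inv A ** A = mat 1"
  unfolding invertible_def matrix_inv_def by (metis (mono_tags, lifting) someI_ex)+

lemma invertible_pos_def:
  fixes M :: "real^'n^'n::finite"
  assumes "\<And>y. y \<noteq> 0 \<Longrightarrow> y \<bullet> (M *v y) > 0"
  shows "invertible M"
  using assms by (force simp: invertible_left_inverse matrix_left_invertible_ker)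

lemma bounded_bilinear_matrix_vector: "bounded_bilinear (\<lambda>(M::real^'n^'m::finite) (v::real^'n::finite). M *v v)"
  unfolding bilinear_conv_bounded_bilinear[symmetric] bilinear_def
  by (auto intro!: linearI simp: matrix_vector_mult_add_rdistrib matrix_vector_right_distrib
      matrix_vector_mult_scaleR scaleR_matrix_vector_assoc[symmetric])

lemma bounded_linear_matrix_form: "bounded_linear (\<lambda>M::real^'n^'n::finite. y \<bullet> (M *v z))"
  by (intro bounded_linear_compose[OF bounded_linear_inner_right]
      bounded_bilinear.bounded_linear_left[OF bounded_bilinear_matrix_vector])

text \<open>Cramer's rule turns the solution of a linear system into quotients of determinants,
  which are polynomials in the entries.\<close>

lemma smooth_on_matrix_inv_vector:
  fixes M :: "'a::real_normed_vector \<Rightarrow> real^'n^'n::finite" and v :: "'a \<Rightarrow> real^'n"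
  assumes "open S" "smooth_on S M" "smooth_on S v" "\<And>x. x \<in> S \<Longrightarrow> invertible (M x)"
  shows "smooth_on S (\<lambda>x. matrix_inv (M x) *v v x)"
proof (rule smooth_on_cong[OF assms(1)])
  let ?N = "\<lambda>k x. (\<chi> i j. if j = k then v x $ i else M x $ i $ j) :: real^'n^'n"
  show "matrix_inv (M x) *v v x = (\<chi> k. det (?N k x) / det (M x))" if "x \<in> S" for x
  proof -
    have "M x *v (matrix_inv (M x) *v v x) = v x"
      using assms(4)[OF that] by (simp add: matrix_vector_mul_assoc matrix_inv_right matrix_vector_mul_lid)
    then show ?thesis using cramer[of "M x"] assms(4)[OF that] by (simp add: invertible_det_nz)
  qed
  have M: "smooth_on S (\<lambda>x. M x $ i $ j)" for i j
    by (intro smooth_on_vec_nth assms)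
  show "smooth_on S (\<lambda>x. \<chi> k. det (?N k x) / det (M x))"
  proof (rule smooth_on_vec_lambda[OF assms(1)])
    fix k
    have "smooth_on S (\<lambda>x. ?N k x $ i $ j)" for i j
      using smooth_on_vec_nth[OF assms(1,3), of i] M[of i j] by (cases "j = k") simp_all
    then have "smooth_on S (\<lambda>x. det (?N k x) / det (M x))"
      using assms(1,4) M by (intro smooth_on_divide smooth_on_det) (auto simp: invertible_det_nz)
    then show "smooth_on S (\<lambda>x. (\<chi> k. det (?N k x) / det (M x)) $ k)" by simp
  qed
qed

section \<open>Derivatives along lines and symmetry of second derivatives\<close>

lemma has_vector_derivative_line:
  assumes "(f has_derivative f') (at (x + t *\<^sub>R h))"
  shows "((\<lambda>t. f (x + t *\<^sub>R h)) has_vector_derivative f' h) (at t)"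
proof -
  have "((\<lambda>t. x + t *\<^sub>R h) has_vector_derivative h) (at t)"
    by (auto intro!: derivative_eq_intros simp: has_vector_derivative_def)
  from vector_derivative_diff_chain_within[OF this, of f f'] assms show ?thesis
    by (simp add: o_def has_derivative_at_withinI)
qed

lemma has_real_derivative_line:
  fixes f :: "'a::real_normed_vector \<Rightarrow> real"
  assumes "(f has_derivative f') (at (x + t *\<^sub>R h))"
  shows "((\<lambda>t. f (x + t *\<^sub>R h)) has_real_derivative f' h) (at t)"
  using has_vector_derivative_line[OF assms] by (simp add: has_real_derivative_iff_has_vector_derivative)

text \<open>The mean value theorem is used twice: in the direction h for the increment of f along t
  k, then in the direction k for the derivative of f in the direction h.\<close>

lemma second_difference:
  fixes f :: "'a::real_normed_vector \<Rightarrow> real"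
  assumes "open S" "Ck_on 2 S f" "t > 0"
    and sub: "\<And>p q. 0 \<le> p \<Longrightarrow> p \<le> t \<Longrightarrow> 0 \<le> q \<Longrightarrow> q \<le> t \<Longrightarrow> x + p *\<^sub>R h + q *\<^sub>R k \<in> S"
  shows "\<exists>p q. 0 \<le> p \<and> p \<le> t \<and> 0 \<le> q \<and> q \<le> t \<and>
    f (x + t *\<^sub>R h + t *\<^sub>R k) - f (x + t *\<^sub>R h) - f (x + t *\<^sub>R k) + f x
      = t * t * dd (\<lambda>u. dd f u h) (x + p *\<^sub>R h + q *\<^sub>R k) k"
proof -
  have C1: "Ck_on (Suc (Suc 0)) S f" using assms(2) by (simp add: numeral_2_eq_2 del: Ck_on.simps)
  then have C2: "Ck_on (Suc 0) S (\<lambda>u. dd f u h)" by (rule Ck_on_dd)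
  let ?g = "\<lambda>p. f (x + p *\<^sub>R h + t *\<^sub>R k) - f (x + p *\<^sub>R h)"
  have d1: "((\<lambda>p. f (x + p *\<^sub>R h + c *\<^sub>R k)) has_real_derivative dd f (x + p *\<^sub>R h + c *\<^sub>R k) h) (at p)"
    if "0 \<le> p" "p \<le> t" "0 \<le> c" "c \<le> t" for p c
  proof -
    have F: "(f has_derivative dd f (x + p *\<^sub>R h + c *\<^sub>R k)) (at (x + p *\<^sub>R h + c *\<^sub>R k))"
      by (rule Ck_on_has_derivative[OF C1 sub[OF that]])
    then show ?thesis using has_real_derivative_line[of f _ "x + c *\<^sub>R k" p h] by (simp add: add.commute add.left_commute)
  qed
  have "\<exists>p>0. p < t \<and> ?g t - ?g 0 = (t - 0) * (dd f (x + p *\<^sub>R h + t *\<^sub>R k) h - dd f (x + p *\<^sub>R h) h)"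
    by (rule MVT2[OF assms(3)]) (use d1[of _ t] d1[of _ 0] assms(3) in \<open>auto intro!: DERIV_diff\<close>)
  then obtain p where p: "0 < p" "p < t"
    and e1: "?g t - ?g 0 = t * (dd f (x + p *\<^sub>R h + t *\<^sub>R k) h - dd f (x + p *\<^sub>R h) h)" by auto
  have d2: "((\<lambda>q. dd f (x + p *\<^sub>R h + q *\<^sub>R k) h) has_real_derivative dd (\<lambda>u. dd f u h) (x + p *\<^sub>R h + q *\<^sub>R k) k) (at q)"
    if "0 \<le> q" "q \<le> t" for q
  proof -
    have F: "((\<lambda>u. dd f u h) has_derivative dd (\<lambda>u. dd f u h) (x + p *\<^sub>R h + q *\<^sub>R k)) (at (x + p *\<^sub>R h + q *\<^sub>R k))"
      by (rule Ck_on_has_derivative[OF C2 sub]) (use p that in auto)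
    then show ?thesis by (rule has_real_derivative_line)
  qed
  have "\<exists>q>0. q < t \<and> dd f (x + p *\<^sub>R h + t *\<^sub>R k) h - dd f (x + p *\<^sub>R h + 0 *\<^sub>R k) h
      = (t - 0) * dd (\<lambda>u. dd f u h) (x + p *\<^sub>R h + q *\<^sub>R k) k"
    by (rule MVT2[OF assms(3)]) (use d2 in auto)
  then obtain q where "0 < q" "q < t"
    "dd f (x + p *\<^sub>R h + t *\<^sub>R k) h - dd f (x + p *\<^sub>R h) h = t * dd (\<lambda>u. dd f u h) (x + p *\<^sub>R h + q *\<^sub>R k) k" by auto
  with p e1 show ?thesis by (intro exI[of _ p] exI[of _ q]) (auto simp: algebra_simps)
qed

text \<open>The second difference is symmetric in h and k. Each of its two readings is a mixed
  derivative at some point near x, and continuity of the second derivatives makes their gap at x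
  arbitrarily small.\<close>

lemma second_derivative_sym_real:
  fixes f :: "'a::real_normed_vector \<Rightarrow> real"
  assumes "open S" "Ck_on 2 S f" "x \<in> S"
  shows "dd (\<lambda>u. dd f u h) x k = dd (\<lambda>u. dd f u k) x h"
proof -
  obtain r where r: "r > 0" "ball x r \<subseteq> S" using assms(1,3) openE by blast
  have C: "continuous_on S (\<lambda>u. dd (\<lambda>u. dd f u h) u k)" for h k
    using assms(2) by (simp add: numeral_2_eq_2)
  have main: "\<bar>dd (\<lambda>u. dd f u h) x k - dd (\<lambda>u. dd f u k) x h\<bar> < 2 * e" if "e > 0" for e
  proof -
    have "continuous (at x) (\<lambda>u. dd (\<lambda>u. dd f u h) u k)" for h k
      using C continuous_on_eq_continuous_at[OF assms(1)] assms(3) by blast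
    then have "\<exists>d>0. \<forall>u. dist u x < d \<longrightarrow> dist (dd (\<lambda>u. dd f u h) u k) (dd (\<lambda>u. dd f u h) x k) < e" for h k
      using that unfolding continuous_at_eps_delta by blast
    then obtain d1 d2 where d: "d1 > 0" "d2 > 0"
      "\<And>u. dist u x < d1 \<Longrightarrow> dist (dd (\<lambda>u. dd f u h) u k) (dd (\<lambda>u. dd f u h) x k) < e"
      "\<And>u. dist u x < d2 \<Longrightarrow> dist (dd (\<lambda>u. dd f u k) u h) (dd (\<lambda>u. dd f u k) x h) < e" by metis
    define m where "m = min r (min d1 d2)"
    \<comment> \<open>The summand 1 keeps the denominator positive when h = k = 0; the factor 2
      keeps the whole parallelogram strictly within distance m of x.\<close>
    define t where "t = m / (2 * (norm h + norm k + 1))"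
    have m: "m > 0" using r d by (simp add: m_def)
    have np: "norm h + norm k + 1 > 0" by (smt (verit) norm_ge_zero)
    have t: "t > 0" using m np by (simp add: t_def)
    have near: "dist (x + p *\<^sub>R h + q *\<^sub>R k) x < m" if "0 \<le> p" "p \<le> t" "0 \<le> q" "q \<le> t" for p q
    proof -
      have "dist (x + p *\<^sub>R h + q *\<^sub>R k) x \<le> p * norm h + q * norm k"
        using that norm_triangle_ineq[of "p *\<^sub>R h" "q *\<^sub>R k"] by (simp add: dist_norm)
      also have "\<dots> \<le> t * norm h + t * norm k" using that by (intro add_mono mult_right_mono) auto
      also have "\<dots> < t * (norm h + norm k + 1)" using t by (simp add: algebra_simps)
      also have "\<dots> = m / 2" using np unfolding t_def
        by (simp only: times_divide_eq_left) (simp add: divide_eq_eq eq_divide_eq)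
      also have "\<dots> < m" using m by simp
      finally show ?thesis .
    qed
    have inS: "x + p *\<^sub>R h + q *\<^sub>R k \<in> S" if "0 \<le> p" "p \<le> t" "0 \<le> q" "q \<le> t" for p q
      using near[OF that] r by (auto simp: m_def dist_commute subset_iff)
    obtain p q where 1: "0 \<le> p" "p \<le> t" "0 \<le> q" "q \<le> t"
      "f (x + t *\<^sub>R h + t *\<^sub>R k) - f (x + t *\<^sub>R h) - f (x + t *\<^sub>R k) + f x
        = t * t * dd (\<lambda>u. dd f u h) (x + p *\<^sub>R h + q *\<^sub>R k) k"
      using second_difference[OF assms(1,2) t inS] by blast
    have inS': "x + p *\<^sub>R k + q *\<^sub>R h \<in> S" if "0 \<le> p" "p \<le> t" "0 \<le> q" "q \<le> t" for p q
      using inS[of q p] that by (simp add: algebra_simps)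
    obtain p' q' where 2: "0 \<le> p'" "p' \<le> t" "0 \<le> q'" "q' \<le> t"
      "f (x + t *\<^sub>R k + t *\<^sub>R h) - f (x + t *\<^sub>R k) - f (x + t *\<^sub>R h) + f x
        = t * t * dd (\<lambda>u. dd f u k) (x + p' *\<^sub>R k + q' *\<^sub>R h) h"
      using second_difference[OF assms(1,2) t inS'] by blast
    have "f (x + t *\<^sub>R h + t *\<^sub>R k) = f (x + t *\<^sub>R k + t *\<^sub>R h)" by (simp add: algebra_simps)
    then have "t * t * dd (\<lambda>u. dd f u h) (x + p *\<^sub>R h + q *\<^sub>R k) k = t * t * dd (\<lambda>u. dd f u k) (x + p' *\<^sub>R k + q' *\<^sub>R h) h"
      using 1(5) 2(5) by linarith
    then have eq: "dd (\<lambda>u. dd f u h) (x + p *\<^sub>R h + q *\<^sub>R k) k = dd (\<lambda>u. dd f u k) (x + p' *\<^sub>R k + q' *\<^sub>R h) h"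
      using t by simp
    have "dist (x + p' *\<^sub>R k + q' *\<^sub>R h) x < m" using near[of q' p'] 2 by (simp add: algebra_simps)
    then show ?thesis
      using d(3)[of "x + p *\<^sub>R h + q *\<^sub>R k"] d(4)[of "x + p' *\<^sub>R k + q' *\<^sub>R h"] near[OF 1(1-4)] eq
      by (auto simp: m_def dist_real_def)
  qed
  show ?thesis
  proof (rule ccontr)
    assume "\<not> ?thesis"
    then show False using main[of "\<bar>dd (\<lambda>u. dd f u h) x k - dd (\<lambda>u. dd f u k) x h\<bar> / 2"] by simp
  qed
qed

lemma second_derivative_sym:
  fixes f :: "'a::real_normed_vector \<Rightarrow> 'b::euclidean_space"
  assumes "open S" "smooth_on S f" "x \<in> S"
  shows "dd (\<lambda>u. dd f u h) x k = dd (\<lambda>u. dd f u k) x h"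
proof (rule euclidean_eqI)
  fix b :: 'b
  have bl: "bounded_linear (\<lambda>y::'b. y \<bullet> b)" by (rule bounded_linear_inner_left)
  have comp: "dd (\<lambda>u. g u \<bullet> b) u v = dd g u v \<bullet> b" if "g differentiable (at u)" for g :: "'a \<Rightarrow> 'b" and u v
    using that by (metis bounded_linear.has_derivative[OF bl] dd_eq frechet_derivative_works)
  have sm: "smooth_on S (\<lambda>u. f u \<bullet> b)" by (rule smooth_on_bounded_linear[OF assms(1) bl assms(2)])
  have *: "dd (\<lambda>u. dd f u h) x k \<bullet> b = dd (\<lambda>u. dd (\<lambda>u. f u \<bullet> b) u h) x k" for h k
  proof -
    have d: "(\<lambda>u. dd f u h) differentiable (at x)"
      using smooth_on_differentiable[OF smooth_on_dd[OF assms(2)] assms(3)] .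
    have "dd (\<lambda>u. dd (\<lambda>u. f u \<bullet> b) u h) x = dd (\<lambda>u. dd f u h \<bullet> b) x"
    proof (rule dd_transform(1)[OF assms(1,3)])
      show "dd (\<lambda>u. f u \<bullet> b) u h = dd f u h \<bullet> b" if "u \<in> S" for u
        by (rule comp[OF smooth_on_differentiable[OF assms(2) that]])
      show "(\<lambda>u. dd f u h \<bullet> b) differentiable (at x)"
        using d bounded_linear.has_derivative[OF bl] unfolding differentiable_def by blast
    qed
    then show ?thesis using comp[OF d] by simp
  qed
  show "dd (\<lambda>u. dd f u h) x k \<bullet> b = dd (\<lambda>u. dd f u k) x h \<bullet> b"
    unfolding * by (rule second_derivative_sym_real[OF assms(1) _ assms(3)]) (use sm in \<open>auto simp: smooth_on_def\<close>)
qed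

section \<open>Integrability conditions in projectively flat coordinates\<close>

lemma dd_add: "f differentiable (at x) \<Longrightarrow> g differentiable (at x) \<Longrightarrow> dd (\<lambda>u. f u + g u) x v = dd f x v + dd g x v"
  by (simp add: dd_eq[OF has_derivative_add] frechet_derivative_works)

lemma dd_scale:
  fixes f :: "'a::real_normed_vector \<Rightarrow> real"
  shows "f differentiable (at x) \<Longrightarrow> dd (\<lambda>u. r * f u) x v = r * dd f x v"
  by (simp add: dd_eq[OF has_derivative_mult_right] frechet_derivative_works)

lemma real_taylor2:
  fixes f :: "real \<Rightarrow> real"
  assumes "\<And>t. t \<in> {0..1} \<Longrightarrow> (f has_real_derivative f1 t) (at t within {0..1})"
    and "\<And>t. t \<in> {0..1} \<Longrightarrow> (f1 has_real_derivative f2 t) (at t within {0..1})"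
    and "\<And>t. t \<in> {0..1} \<Longrightarrow> (f2 has_real_derivative 0) (at t within {0..1})"
  shows "f 1 = f 0 + f1 0 + f2 0 / 2"
proof -
  have const: "h 0 = h t" if "\<And>t. t \<in> {0..1} \<Longrightarrow> (h has_real_derivative 0) (at t within {0..1})" "t \<in> {0..1}"
    for h :: "real \<Rightarrow> real" and t
    using has_field_derivative_zero_constant[of "{0..1}" h] that by force
  have f2: "f2 t = f2 0" if "t \<in> {0..1}" for t using const[OF assms(3) that] by simp
  have f1: "f1 t = f1 0 + f2 0 * t" if "t \<in> {0..1}" for t
  proof -
    have "((\<lambda>t. f1 t - f2 0 * t) has_real_derivative 0) (at t within {0..1})" if "t \<in> {0..1}" for t
      using f2[OF that] by (auto intro!: derivative_eq_intros assms(2)[OF that])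
    from const[OF this that] show ?thesis by simp
  qed
  have "((\<lambda>t. f t - f1 0 * t - f2 0 * t\<^sup>2 / 2) has_real_derivative 0) (at t within {0..1})" if "t \<in> {0..1}" for t
    using f1[OF that] by (auto intro!: derivative_eq_intros assms(1)[OF that])
  from const[OF this, of 1] show ?thesis by simp
qed

text \<open>Splitting l into a multiple of k and a part orthogonal to k expresses T k l and T l k
  through the ratio T k k / g k k. Two nonorthogonal vectors share this ratio, as T k l can be
  computed from either side; an orthogonal pair k, e is linked through k + e.\<close>

lemma bilinear_multiple_of_inner:
  fixes g T :: "'a::real_vector \<Rightarrow> 'a \<Rightarrow> real"
  assumes g: "bilinear g" "\<And>y z. g y z = g z y" "\<And>y. y \<noteq> 0 \<Longrightarrow> g y y > 0"
    and T: "bilinear T" "\<And>k l. g k l = 0 \<Longrightarrow> T k l = 0" and e: "e \<noteq> 0"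
  shows "T k l = T e e / g e e * g k l"
proof -
  have gl: "g x (y + z) = g x y + g x z" "g x (s *\<^sub>R y) = s * g x y" "g (y + z) x = g y x + g z x"
     "g (s *\<^sub>R y) x = s * g y x" for x y z s
    using g(1) by (simp_all add: bilinear_radd bilinear_rmul bilinear_ladd bilinear_lmul)
  have Tl: "T x (y + z) = T x y + T x z" "T x (s *\<^sub>R y) = s * T x y" "T (y + z) x = T y x + T z x"
     "T (s *\<^sub>R y) x = s * T y x" for x y z s
    using T(1) by (simp_all add: bilinear_radd bilinear_rmul bilinear_ladd bilinear_lmul)
  have 1: "T k l = g k l / g k k * T k k" "T l k = g k l / g k k * T k k" if "k \<noteq> 0" for k l
  proof -
    define m where "m = l + (- (g k l / g k k)) *\<^sub>R k"
    have "g k m = 0" using g(3)[OF that] unfolding m_def gl by simp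
    then have "T k m = 0" "T m k = 0" using T(2) g(2)[of m k] by auto
    then show "T k l = g k l / g k k * T k k" "T l k = g k l / g k k * T k k" unfolding m_def Tl by simp_all
  qed
  have 2: "T k k / g k k = T l l / g l l" if "k \<noteq> 0" "l \<noteq> 0" "g k l \<noteq> 0" for k l
  proof -
    have "g k l * (T k k / g k k) = g k l * (T l l / g l l)"
      using 1(1)[of k l] 1(2)[of l k] that g(2)[of l k] by simp
    then show ?thesis using that(3) mult_left_cancel by blast
  qed
  have 3: "T k k / g k k = T e e / g e e" if "k \<noteq> 0" for k
  proof (cases "g k e = 0")
    case True
    have "g k (k + e) \<noteq> 0" "g (k + e) e \<noteq> 0"
      using g(3)[OF that] g(3)[OF e] True by (simp_all add: gl)
    moreover from this have "k + e \<noteq> 0"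
      using gl(2)[of k 0 0] by auto
    ultimately show ?thesis using 2[of k "k + e"] 2[of "k + e" e] that e by simp
  qed (use 2 that e in auto)
  show ?thesis
  proof (cases "k = 0")
    case True
    then show ?thesis using gl(4)[of 0 0 l] Tl(4)[of 0 0 l] by simp
  next
    case False
    have "T k l = T k k / g k k * g k l" using 1(1)[OF False, of l] by simp
    then show ?thesis by (simp only: 3[OF False])
  qed
qed

lemma exists_not_in_span:
  fixes S :: "'a::euclidean_space set"
  assumes "finite S" "card S < DIM('a)"
  obtains m where "m \<notin> span S"
  using dim_le_card'[OF assms(1)] assms(2) by (metis dim_UNIV dim_span UNIV_eq_I leD)

text \<open>Take y = z orthogonal to h: the right side vanishes while g y y is positive. Such a y
  exists from dimension 2 on. The hypothesis on \<nu> is the shape in which the integrability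
  conditions arrive.\<close>

lemma covector_zero:
  fixes g :: "'a::euclidean_space \<Rightarrow> 'a \<Rightarrow> real"
  assumes g: "bilinear g" "\<And>y z. g y z = g z y" "\<And>y. y \<noteq> 0 \<Longrightarrow> g y y > 0"
    and nu: "linear \<nu>" "\<And>h y z. \<nu> h * g y z = \<nu> y * g h z" and dim: "DIM('a) \<ge> 2"
  shows "\<nu> h = (0::real)"
proof (cases "h = 0")
  case True
  then show ?thesis using nu(1) linear_0 by blast
next
  case False
  obtain m where m: "m \<notin> span {h}" using dim exists_not_in_span[of "{h}"] by auto
  define y where "y = m - (g h m / g h h) *\<^sub>R h"
  have "y \<noteq> 0" using m by (auto simp: y_def span_singleton)
  moreover have "g h y = 0" using g(1) g(3)[OF False] by (simp add: y_def bilinear_rsub bilinear_rmul)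
  ultimately show ?thesis using nu(2)[of h y y] g(3)[of y] by auto
qed

text \<open>
  In coordinates in which the geodesics of \<open>g\<close> are straight lines the Christoffel symbols are
  \<open>\<delta>\<^sup>i\<^sub>j \<theta>\<^sub>k + \<delta>\<^sup>i\<^sub>k \<theta>\<^sub>j\<close>, so that \<open>dg\<close> says that \<open>g\<close> is parallel, and \<open>drho\<close> that the covariant
  derivative of \<open>\<rho>\<close> is \<open>c g\<close>.
\<close>

locale proj_pair =
  fixes W :: "'a::euclidean_space set" and g :: "'a \<Rightarrow> 'a \<Rightarrow> 'a \<Rightarrow> real"
    and \<theta> \<rho> :: "'a \<Rightarrow> 'a \<Rightarrow> real" and c :: "'a \<Rightarrow> real"
  assumes W: "open W" and dim: "DIM('a) \<ge> 2"
    and bil: "x \<in> W \<Longrightarrow> bilinear (g x)"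
    and sym: "x \<in> W \<Longrightarrow> g x y z = g x z y"
    and pos: "x \<in> W \<Longrightarrow> y \<noteq> 0 \<Longrightarrow> g x y y > 0"
    and smooth_g: "smooth_on W (\<lambda>u. g u y z)"
    and lin: "x \<in> W \<Longrightarrow> linear (\<theta> x)" "x \<in> W \<Longrightarrow> linear (\<rho> x)"
    and smooth_th: "smooth_on W (\<lambda>u. \<theta> u y)" and smooth_rho: "smooth_on W (\<lambda>u. \<rho> u y)"
    and smooth_c: "smooth_on W c"
    and dg: "x \<in> W \<Longrightarrow> dd (\<lambda>u. g u y z) x h = 2 * \<theta> x h * g x y z + \<theta> x y * g x h z + \<theta> x z * g x h y"
    and drho: "x \<in> W \<Longrightarrow> dd (\<lambda>u. \<rho> u z) x h = \<theta> x h * \<rho> x z + \<theta> x z * \<rho> x h + c x * g x h z"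
begin

lemma deriv_g: "x \<in> W \<Longrightarrow> ((\<lambda>u. g u y z) has_derivative
    (\<lambda>h. 2 * \<theta> x h * g x y z + \<theta> x y * g x h z + \<theta> x z * g x h y)) (at x)"
  using smooth_on_has_derivative[OF smooth_g, of x y z] ext[of "dd (\<lambda>u. g u y z) x", OF dg] by simp

lemma deriv_rho: "x \<in> W \<Longrightarrow> ((\<lambda>u. \<rho> u z) has_derivative
    (\<lambda>h. \<theta> x h * \<rho> x z + \<theta> x z * \<rho> x h + c x * g x h z)) (at x)"
  using smooth_on_has_derivative[OF smooth_rho, of x z] ext[of "dd (\<lambda>u. \<rho> u z) x", OF drho] by simp

lemmas deriv_th = smooth_on_has_derivative[OF smooth_th]
lemmas deriv_c = smooth_on_has_derivative[OF smooth_c]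

text \<open>With the Christoffel symbols of this locale the curvature tensor is built from Kronecker
  deltas and this tensor alone. Its symmetry, which amounts to closedness of \<theta>, is a
  consequence and not known beforehand.\<close>

definition T :: "'a \<Rightarrow> 'a \<Rightarrow> 'a \<Rightarrow> real"
  where "T x i l = dd (\<lambda>u. \<theta> u i) x l - \<theta> x i * \<theta> x l"

lemma bilinear_T:
  assumes x: "x \<in> W"
  shows "bilinear (T x)"
proof -
  have d: "(\<lambda>u. \<theta> u y) differentiable (at x)" for y
    using smooth_on_differentiable[OF smooth_th x] .
  have 1: "dd (\<lambda>u. \<theta> u (y + z)) x v = dd (\<lambda>u. \<theta> u y) x v + dd (\<lambda>u. \<theta> u z) x v" for y z v
  proof -
    have "dd (\<lambda>u. \<theta> u (y + z)) x = dd (\<lambda>u. \<theta> u y + \<theta> u z) x"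
      by (rule dd_transform(1)[OF W x]) (auto simp: d linear_add[OF lin(1)] intro: differentiable_add)
    then show ?thesis by (simp add: dd_add d)
  qed
  have 2: "dd (\<lambda>u. \<theta> u (r *\<^sub>R y)) x v = r * dd (\<lambda>u. \<theta> u y) x v" for r y v
  proof -
    have "dd (\<lambda>u. \<theta> u (r *\<^sub>R y)) x = dd (\<lambda>u. r * \<theta> u y) x"
      by (rule dd_transform(1)[OF W x]) (auto simp: d linear_scale[OF lin(1)] intro: differentiable_mult)
    then show ?thesis by (simp add: dd_scale d)
  qed
  have "linear (\<lambda>l. T x i l)" for i
    unfolding T_def using lin(1)[OF x] smooth_on_linear[OF smooth_th x, of i]
    by (intro linearI) (simp_all add: linear_add linear_scale algebra_simps)
  moreover have "linear (\<lambda>i. T x i l)" for l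
    unfolding T_def using lin(1)[OF x] 1 2
    by (intro linearI) (simp_all add: linear_add linear_scale algebra_simps)
  ultimately show ?thesis by (simp add: bilinear_def)
qed

text \<open>The mixed second derivatives of g i j are equated, and \<open>dg\<close> is inserted for
  every first derivative; the terms quadratic in \<theta> that survive are those contained in
  \<open>T\<close>.\<close>

lemma integrability:
  assumes x: "x \<in> W"
  shows "2 * (T x k l - T x l k) * g x i j + T x i l * g x k j - T x i k * g x l j + T x j l * g x k i - T x j k * g x l i = 0"
proof -
  have D: "dd (\<lambda>u. dd (\<lambda>u. g u i j) u k) x l =
      2 * (dd (\<lambda>u. \<theta> u k) x l * g x i j + \<theta> x k * dd (\<lambda>u. g u i j) x l)
      + (dd (\<lambda>u. \<theta> u i) x l * g x k j + \<theta> x i * dd (\<lambda>u. g u k j) x l)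
      + (dd (\<lambda>u. \<theta> u j) x l * g x k i + \<theta> x j * dd (\<lambda>u. g u k i) x l)" (is "_ = ?R k l") for k l
  proof -
    have "((\<lambda>u. 2 * \<theta> u k * g u i j + \<theta> u i * g u k j + \<theta> u j * g u k i) has_derivative (\<lambda>l. ?R k l)) (at x)"
      by (rule derivative_eq_intros deriv_th[OF x] smooth_on_has_derivative[OF smooth_g x] refl)+
         (auto simp: fun_eq_iff algebra_simps)
    then have "((\<lambda>u. dd (\<lambda>u. g u i j) u k) has_derivative (\<lambda>l. ?R k l)) (at x)"
      by (rule has_derivative_transform_within_open[OF _ W x]) (simp add: dg)
    then show ?thesis by (simp add: dd_eq)
  qed
  have "?R k l = ?R l k"
    using second_derivative_sym[OF W smooth_g x, of i j k l] by (simp only: D)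
  then show ?thesis
    unfolding dg[OF x] T_def using sym[OF x, of k l] sym[OF x, of i j] sym[OF x, of i k] sym[OF x, of i l]
      sym[OF x, of j k] sym[OF x, of j l]
    by (simp add: algebra_simps)
qed

text \<open>A fixed nonzero vector, on which the proportionality factor \<open>curv\<close> is read
  off as a quotient.\<close>

definition e0 :: 'a where "e0 = (SOME b. b \<in> Basis)"

lemma e0_nonzero: "e0 \<noteq> 0"
  unfolding e0_def using nonempty_Basis nonzero_Basis some_in_eq by blast

definition curv :: "'a \<Rightarrow> real" where "curv x = - T x e0 e0 / g x e0 e0"

lemma T_eq:
  assumes x: "x \<in> W"
  shows "T x k l = - curv x * g x k l"
proof -
  have "T x k l = 0" if kl: "g x k l = 0" for k l
  proof (cases "k = 0 \<or> l = 0")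
    case True
    then show ?thesis using bilinear_T[OF x] by (auto simp: bilinear_lzero bilinear_rzero)
  next
    case False
    \<comment> \<open>Taking i = j = k and then i = j = l for orthogonal k, l gives two independent
      linear equations for T k l and T l k, so both vanish although \<open>T\<close> is not yet
      known to be symmetric.\<close>
    have "2 * (T x k l - T x l k) * g x k k + 2 * T x k l * g x k k = 0"
      using integrability[OF x, of k l k k] kl sym[OF x, of k l] by (simp add: mult.commute)
    moreover have "2 * (T x k l - T x l k) * g x l l - 2 * T x l k * g x l l = 0"
      using integrability[OF x, of k l l l] kl sym[OF x, of k l] by (simp add: mult.commute)
    ultimately have "(4 * T x k l - 2 * T x l k) * g x k k = 0" "(2 * T x k l - 4 * T x l k) * g x l l = 0"
      by (simp_all add: algebra_simps)
    then show ?thesis using pos[OF x, of k] pos[OF x, of l] False by auto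
  qed
  from bilinear_multiple_of_inner[OF bil[OF x] sym[OF x] pos[OF x] bilinear_T[OF x] this e0_nonzero, of k l]
  show ?thesis by (simp add: curv_def)
qed

lemma dd_th: "x \<in> W \<Longrightarrow> dd (\<lambda>u. \<theta> u y) x h = \<theta> x y * \<theta> x h - curv x * g x y h"
  using T_eq[of x y h] by (simp add: T_def)

lemma smooth_curv: "smooth_on W curv"
proof -
  have "smooth_on W (\<lambda>x. T x e0 e0)"
    unfolding T_def by (intro smooth_on_diff smooth_on_mult smooth_on_dd smooth_th W)
  then have "smooth_on W (\<lambda>x. - T x e0 e0 / g x e0 e0)"
    using pos[OF _ e0_nonzero] by (intro smooth_on_divide W smooth_g smooth_on_minus) force+
  then show ?thesis by (simp add: curv_def[abs_def])
qed

text \<open>Beltrami's theorem. Equating the mixed second derivatives of \<theta>, with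
  \<open>dd_th\<close> and \<open>dg\<close> inserted, leaves only the terms with the differential
  of \<open>curv\<close>, in the form required by \<open>covector_zero\<close>.\<close>

lemma dd_curv:
  assumes x: "x \<in> W"
  shows "dd curv x h = 0"
proof (rule covector_zero[OF bil[OF x] sym[OF x] pos[OF x] smooth_on_linear[OF smooth_curv x] _ dim])
  fix h y z
  have D: "dd (\<lambda>u. dd (\<lambda>u. \<theta> u z) u y) x h =
      dd (\<lambda>u. \<theta> u z) x h * \<theta> x y + \<theta> x z * dd (\<lambda>u. \<theta> u y) x h
        - (dd curv x h * g x z y + curv x * dd (\<lambda>u. g u z y) x h)" (is "_ = ?R y h") for y h
  proof -
    have "((\<lambda>u. \<theta> u z * \<theta> u y - curv u * g u z y) has_derivative (\<lambda>h. ?R y h)) (at x)"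
      by (rule derivative_eq_intros deriv_th[OF x] smooth_on_has_derivative[OF smooth_g x]
            smooth_on_has_derivative[OF smooth_curv x] refl)+
         (auto simp: fun_eq_iff algebra_simps)
    then have "((\<lambda>u. dd (\<lambda>u. \<theta> u z) u y) has_derivative (\<lambda>h. ?R y h)) (at x)"
      by (rule has_derivative_transform_within_open[OF _ W x]) (simp add: dd_th)
    then show ?thesis by (simp add: dd_eq)
  qed
  have "?R y h = ?R h y"
    using second_derivative_sym[OF W smooth_th x, of z y h] by (simp only: D)
  then show "dd curv x h * g x y z = dd curv x y * g x h z"
    unfolding dg[OF x] dd_th[OF x] using sym[OF x, of h y] sym[OF x, of h z] sym[OF x, of z y]
    by (simp add: algebra_simps)
qed

text \<open>This is the Ricci identity for \<rho>: equating its mixed second derivatives leaves a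
  Codazzi-type identity for the covector dc + \<mu> \<rho>, which must therefore vanish.\<close>

lemma dd_c:
  assumes x: "x \<in> W"
  shows "dd c x h = - curv x * \<rho> x h"
proof -
  have "dd c x h + curv x * \<rho> x h = 0"
  proof (rule covector_zero[OF bil[OF x] sym[OF x] pos[OF x] _ _ dim])
    show "linear (\<lambda>h. dd c x h + curv x * \<rho> x h)"
      using smooth_on_linear[OF smooth_c x] lin(2)[OF x]
      by (intro linearI) (simp_all add: linear_add linear_scale algebra_simps)
    fix h y z
    have D: "dd (\<lambda>u. dd (\<lambda>u. \<rho> u z) u y) x h =
        dd (\<lambda>u. \<theta> u y) x h * \<rho> x z + \<theta> x y * dd (\<lambda>u. \<rho> u z) x h
        + (dd (\<lambda>u. \<theta> u z) x h * \<rho> x y + \<theta> x z * dd (\<lambda>u. \<rho> u y) x h)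
        + (dd c x h * g x y z + c x * dd (\<lambda>u. g u y z) x h)" (is "_ = ?R y h") for y h
    proof -
      have "((\<lambda>u. \<theta> u y * \<rho> u z + \<theta> u z * \<rho> u y + c u * g u y z) has_derivative (\<lambda>h. ?R y h)) (at x)"
        by (rule derivative_eq_intros deriv_th[OF x] smooth_on_has_derivative[OF smooth_g x]
            smooth_on_has_derivative[OF smooth_rho x] deriv_c[OF x] refl)+
         (auto simp: fun_eq_iff algebra_simps)
      then have "((\<lambda>u. dd (\<lambda>u. \<rho> u z) u y) has_derivative (\<lambda>h. ?R y h)) (at x)"
        by (rule has_derivative_transform_within_open[OF _ W x]) (simp add: drho)
      then show ?thesis by (simp add: dd_eq)
    qed
    have "?R y h = ?R h y"
      using second_derivative_sym[OF W smooth_rho x, of z y h] by (simp only: D)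
    then show "(dd c x h + curv x * \<rho> x h) * g x y z = (dd c x y + curv x * \<rho> x y) * g x h z"
      unfolding dg[OF x] dd_th[OF x] drho[OF x] using sym[OF x, of h y] sym[OF x, of h z] sym[OF x, of z y]
      by (simp add: algebra_simps)
  qed
  then show ?thesis by simp
qed

text \<open>
  Along a line, \<open>w\<close> solves \<open>w' = - \<theta> w\<close> (in fact \<open>- ln w\<close> is a potential of \<open>\<theta>\<close>), and the
  functions \<open>w\<^sup>2\<close>, \<open>w\<^sup>4 g\<close> and \<open>w\<^sup>3 \<rho>\<close> turn out to be quadratic polynomials.
\<close>

lemma line_formulas:
  assumes seg: "\<And>t. t \<in> {0..1} \<Longrightarrow> x + t *\<^sub>R X \<in> W"
    and \<mu>: "\<And>t. t \<in> {0..1} \<Longrightarrow> curv (x + t *\<^sub>R X) = \<mu>"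
  shows "\<exists>w>0. w\<^sup>2 = (1 - \<theta> x X)\<^sup>2 + \<mu> * g x X X \<and>
    (\<forall>Y. w ^ 4 * g (x + X) Y Y =
        (1 - \<theta> x X)\<^sup>2 * g x Y Y + 2 * (1 - \<theta> x X) * \<theta> x Y * g x X Y + (\<theta> x Y)\<^sup>2 * g x X X
        + \<mu> * (g x X X * g x Y Y - (g x X Y)\<^sup>2)) \<and>
    (\<forall>Y. w ^ 3 * \<rho> (x + X) Y =
        (1 - \<theta> x X) * ((1 - \<theta> x X) * \<rho> x Y + \<theta> x Y * \<rho> x X)
        + c x * ((1 - \<theta> x X) * g x X Y + \<theta> x Y * g x X X)
        + \<mu> * (g x X X * \<rho> x Y - g x X Y * \<rho> x X))"
proof -
  let ?I = "{0..1::real}"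
  define P where "P t = \<theta> (x + t *\<^sub>R X) X" for t
  define A where "A t = g (x + t *\<^sub>R X) X X" for t
  define R where "R t = \<rho> (x + t *\<^sub>R X) X" for t
  define cc where "cc t = c (x + t *\<^sub>R X)" for t
  have th': "((\<lambda>t. \<theta> (x + t *\<^sub>R X) Y) has_real_derivative \<theta> (x + t *\<^sub>R X) Y * P t - \<mu> * g (x + t *\<^sub>R X) Y X)
      (at t within ?I)" if "t \<in> ?I" for t Y
    using has_real_derivative_line[OF deriv_th[OF seg[OF that], of Y]] dd_th[OF seg[OF that]] \<mu>[OF that]
    by (simp add: P_def has_field_derivative_at_within)
  have g': "((\<lambda>t. g (x + t *\<^sub>R X) Y Z) has_real_derivative 2 * P t * g (x + t *\<^sub>R X) Y Z
      + \<theta> (x + t *\<^sub>R X) Y * g (x + t *\<^sub>R X) X Z + \<theta> (x + t *\<^sub>R X) Z * g (x + t *\<^sub>R X) X Y)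
      (at t within ?I)" if "t \<in> ?I" for t Y Z
    using has_real_derivative_line[OF deriv_g[OF seg[OF that], of Y Z]]
    by (simp add: P_def has_field_derivative_at_within)
  have rho': "((\<lambda>t. \<rho> (x + t *\<^sub>R X) Z) has_real_derivative P t * \<rho> (x + t *\<^sub>R X) Z
      + \<theta> (x + t *\<^sub>R X) Z * R t + cc t * g (x + t *\<^sub>R X) X Z)
      (at t within ?I)" if "t \<in> ?I" for t Z
    using has_real_derivative_line[OF deriv_rho[OF seg[OF that], of Z]]
    by (simp add: P_def R_def cc_def has_field_derivative_at_within)
  have c': "(cc has_real_derivative - \<mu> * R t) (at t within ?I)" if "t \<in> ?I" for t
    using has_real_derivative_line[OF deriv_c[OF seg[OF that]]] dd_c[OF seg[OF that]] \<mu>[OF that]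
    unfolding cc_def R_def by (simp add: has_field_derivative_at_within)
  have P': "(P has_real_derivative P t * P t - \<mu> * A t) (at t within ?I)" if "t \<in> ?I" for t
    using th'[OF that, of X] by (simp add: P_def[abs_def] A_def)
  have A': "(A has_real_derivative 4 * P t * A t) (at t within ?I)" if "t \<in> ?I" for t
    using g'[OF that, of X X] by (simp add: P_def A_def[abs_def] mult.assoc)
  have R': "(R has_real_derivative 2 * P t * R t + cc t * A t) (at t within ?I)" if "t \<in> ?I" for t
    using rho'[OF that, of X] by (simp add: P_def A_def R_def[abs_def] ac_simps)
  have "continuous_on ?I P"
    by (rule DERIV_continuous_on[OF P'])
  then obtain G where G: "\<And>t. t \<in> ?I \<Longrightarrow> (G has_real_derivative P t) (at t within ?I)"
    using antiderivative_continuous[of 0 1 P] by (auto simp: has_real_derivative_iff_has_vector_derivative)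
  \<comment> \<open>Normalised by w = 1 at time 0, so that the resulting formulas involve only data
    at the starting point x.\<close>
  define w where "w t = exp (G 0 - G t)" for t
  have w': "(w has_real_derivative - P t * w t) (at t within ?I)" if "t \<in> ?I" for t
    unfolding w_def by (auto intro!: derivative_eq_intros G[OF that])
  have w: "w 0 = 1" "w 1 > 0" by (simp_all add: w_def)
  \<comment> \<open>The factors \<open>w 0\<close>, equal to 1, are kept so that the right side
    displays the first and second derivatives as functions of time, evaluated at 0. The Riccati
    equation \<open>P'\<close> and \<open>A'\<close> make the third derivative vanish.\<close>
  have 1: "(w 1)\<^sup>2 = (w 0)\<^sup>2 + (- 2 * P 0 * (w 0)\<^sup>2) + 2 * (w 0)\<^sup>2 * ((P 0)\<^sup>2 + \<mu> * A 0) / 2"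
    by (rule real_taylor2[where f = "\<lambda>t. (w t)\<^sup>2"])
       (auto intro!: derivative_eq_intros w' P' A' simp: power2_eq_square algebra_simps)
  have 2: "w 1 ^ 4 * g (x + X) Y Y =
        (1 - \<theta> x X)\<^sup>2 * g x Y Y + 2 * (1 - \<theta> x X) * \<theta> x Y * g x X Y + (\<theta> x Y)\<^sup>2 * g x X X
        + \<mu> * (g x X X * g x Y Y - (g x X Y)\<^sup>2)" for Y
  proof -
    define S where "S t = \<theta> (x + t *\<^sub>R X) Y" for t
    define B where "B t = g (x + t *\<^sub>R X) X Y" for t
    define C where "C t = g (x + t *\<^sub>R X) Y Y" for t
    have S': "(S has_real_derivative P t * S t - \<mu> * B t) (at t within ?I)" if "t \<in> ?I" for t
      using th'[OF that, of Y] sym[OF seg[OF that], of X Y] by (simp add: S_def[abs_def] B_def mult.commute)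
    have B': "(B has_real_derivative 3 * P t * B t + S t * A t) (at t within ?I)" if "t \<in> ?I" for t
      using g'[OF that, of X Y] by (simp add: P_def A_def S_def B_def[abs_def] mult.assoc)
    have C': "(C has_real_derivative 2 * P t * C t + 2 * S t * B t) (at t within ?I)" if "t \<in> ?I" for t
      using g'[OF that, of Y Y] by (simp add: P_def S_def B_def C_def[abs_def] ac_simps)
    have "w 1 ^ 4 * C 1 = w 0 ^ 4 * C 0 + w 0 ^ 4 * (2 * S 0 * B 0 - 2 * P 0 * C 0) +
       w 0 ^ 4 * 2 * ((P 0)\<^sup>2 * C 0 + (S 0)\<^sup>2 * A 0 - 2 * P 0 * S 0 * B 0 + \<mu> * (A 0 * C 0 - (B 0)\<^sup>2)) / 2"
      by (rule real_taylor2[where f = "\<lambda>t. w t ^ 4 * C t"])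
         (auto intro!: derivative_eq_intros w' P' A' S' B' C' simp: eval_nat_numeral algebra_simps)
    then show ?thesis
      unfolding w P_def A_def S_def B_def C_def by (simp add: power2_eq_square field_simps)
  qed
  have 3: "w 1 ^ 3 * \<rho> (x + X) Y =
        (1 - \<theta> x X) * ((1 - \<theta> x X) * \<rho> x Y + \<theta> x Y * \<rho> x X)
        + c x * ((1 - \<theta> x X) * g x X Y + \<theta> x Y * g x X X)
        + \<mu> * (g x X X * \<rho> x Y - g x X Y * \<rho> x X)" for Y
  proof -
    define S where "S t = \<theta> (x + t *\<^sub>R X) Y" for t
    define B where "B t = g (x + t *\<^sub>R X) X Y" for t
    define C where "C t = \<rho> (x + t *\<^sub>R X) Y" for t
    have S': "(S has_real_derivative P t * S t - \<mu> * B t) (at t within ?I)" if "t \<in> ?I" for t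
      using th'[OF that, of Y] sym[OF seg[OF that], of X Y] by (simp add: S_def[abs_def] B_def mult.commute)
    have B': "(B has_real_derivative 3 * P t * B t + S t * A t) (at t within ?I)" if "t \<in> ?I" for t
      using g'[OF that, of X Y] by (simp add: P_def A_def S_def B_def[abs_def] mult.assoc)
    have C': "(C has_real_derivative P t * C t + S t * R t + cc t * B t) (at t within ?I)" if "t \<in> ?I" for t
      using rho'[OF that, of Y] by (simp add: P_def S_def B_def C_def[abs_def] ac_simps)
    have "w 1 ^ 3 * C 1 = w 0 ^ 3 * C 0 + w 0 ^ 3 * (S 0 * R 0 + cc 0 * B 0 - 2 * P 0 * C 0) +
       w 0 ^ 3 * 2 * ((P 0)\<^sup>2 * C 0 - P 0 * S 0 * R 0 + \<mu> * (A 0 * C 0 - B 0 * R 0)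
         - cc 0 * P 0 * B 0 + cc 0 * S 0 * A 0) / 2"
      by (rule real_taylor2[where f = "\<lambda>t. w t ^ 3 * C t"])
         (auto intro!: derivative_eq_intros w' P' A' S' B' C' R' c' simp: eval_nat_numeral algebra_simps)
    then show ?thesis
      unfolding w P_def A_def S_def B_def C_def R_def cc_def by (simp add: power2_eq_square field_simps)
  qed
  show ?thesis
  proof (intro exI[of _ "w 1"] conjI allI)
    show "(w 1)\<^sup>2 = (1 - \<theta> x X)\<^sup>2 + \<mu> * g x X X"
      using 1 w(1) unfolding P_def A_def by (simp add: power2_eq_square algebra_simps)
  qed (use w(2) 2 3 in auto)
qed

end

section \<open>Randers metrics in projectively flat coordinates\<close>

text \<open>
  Hamel's equation makes the geodesic spray of \<open>\<alpha>\<close> proportional to \<open>y\<close>; the factor is additive by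
  the parallelogram law.
\<close>

lemma proj_factor:
  fixes g :: "'a::real_vector \<Rightarrow> 'a \<Rightarrow> real" and G :: "'a \<Rightarrow> 'a \<Rightarrow> 'a \<Rightarrow> real"
  assumes g: "bilinear g" "\<And>y z. g y z = g z y" "\<And>y. y \<noteq> 0 \<Longrightarrow> g y y > 0"
    and Glin: "\<And>y z. linear (\<lambda>h. G h y z)" "\<And>h z. linear (\<lambda>y. G h y z)" "\<And>h y z. G h y z = G h z y"
    and hamel: "\<And>y z. 2 * g y y * G y y z - g y z * G y y y - g y y * G z y y = 0"
  defines "\<theta> \<equiv> \<lambda>y. G y y y / (4 * g y y)"
  shows "linear \<theta>" "G h y z = 2 * \<theta> h * g y z + \<theta> y * g h z + \<theta> z * g h y"
proof -
  have gl: "g x (y + z) = g x y + g x z" "g x (s *\<^sub>R y) = s * g x y" "g (y + z) x = g y x + g z x"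
     "g (s *\<^sub>R y) x = s * g y x" "g (y - z) x = g y x - g z x" "g x (y - z) = g x y - g x z" "g 0 x = 0" "g x 0 = 0" for x y z s
    using g(1) by (simp_all add: bilinear_radd bilinear_rmul bilinear_ladd bilinear_lmul bilinear_lsub bilinear_rsub
        bilinear_lzero bilinear_rzero)
  have G1: "G (h + k) y z = G h y z + G k y z" "G (s *\<^sub>R h) y z = s * G h y z" "G 0 y z = 0" "G (h - k) y z = G h y z - G k y z" for h k y z s
    using linear_add[OF Glin(1)] linear_scale[OF Glin(1)] linear_0[OF Glin(1)] linear_diff[OF Glin(1)] by simp_all
  have G2: "G h (y + k) z = G h y z + G h k z" "G h (s *\<^sub>R y) z = s * G h y z" "G h 0 z = 0" "G h (y - k) z = G h y z - G h k z" for h k y z s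
    using linear_add[OF Glin(2)] linear_scale[OF Glin(2)] linear_0[OF Glin(2)] linear_diff[OF Glin(2)] by simp_all
  have G3: "G h z (y + k) = G h z y + G h z k" "G h z (s *\<^sub>R y) = s * G h z y" "G h z 0 = 0" "G h z (y - k) = G h z y - G h z k" for h k y z s
    unfolding Glin(3)[of h z] by (simp_all add: G2)
  have K: "G y y z - G z y y / 2 = 2 * \<theta> y * g y z" for y z
  proof (cases "y = 0")
    case True
    then show ?thesis by (simp add: G1 G2 gl)
  next
    case False
    have "2 * g y y * (G y y z - G z y y / 2) = g y z * G y y y"
      using hamel[of y z] by (simp add: algebra_simps)
    then show ?thesis using g(3)[OF False] by (simp add: \<theta>_def field_simps)
  qed
  have sc: "\<theta> (s *\<^sub>R y) = s * \<theta> y" for s y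
    by (cases "s = 0") (simp_all add: \<theta>_def G1 G2 G3 gl)
  have add: "\<theta> (u + v) = \<theta> u + \<theta> v" for u v
  proof (cases "u = 0 \<or> (\<exists>r. v = r *\<^sub>R u)")
    case True
    moreover have ?thesis if "u = 0" using sc[of 0 0] that by simp
    moreover have ?thesis if "\<exists>r. v = r *\<^sub>R u"
    proof -
      obtain r where r: "v = r *\<^sub>R u" using \<open>\<exists>r. v = r *\<^sub>R u\<close> by blast
      have "\<theta> ((1 + r) *\<^sub>R u) = \<theta> u + \<theta> (r *\<^sub>R u)" unfolding sc by (simp add: algebra_simps)
      then show ?thesis by (simp add: r algebra_simps)
    qed
    ultimately show ?thesis by blast
  next
    case indep: False
    \<comment> \<open>The left side of \<open>K\<close> is quadratic in y and obeys the
      parallelogram law; p and q are, up to a factor 2, what remains on the right side as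
      coefficients of u and v. Independence of u and v makes both vanish, and p + q = 0 is
      additivity.\<close>
    define p where "p = \<theta> (u + v) + \<theta> (u - v) - 2 * \<theta> u"
    define q where "q = \<theta> (u + v) - \<theta> (u - v) - 2 * \<theta> v"
    have "g (p *\<^sub>R u + q *\<^sub>R v) z = 0" for z
    proof -
      have "(G (u + v) (u + v) z - G z (u + v) (u + v) / 2) + (G (u - v) (u - v) z - G z (u - v) (u - v) / 2)
        = 2 * (G u u z - G z u u / 2) + 2 * (G v v z - G z v v / 2)"
        by (simp add: G1 G2 G3 field_simps)
      then show ?thesis unfolding K by (simp add: gl p_def q_def algebra_simps)
    qed
    then have z: "p *\<^sub>R u + q *\<^sub>R v = 0" using g(3) by (metis less_irrefl)
    have "q = 0"
    proof (rule ccontr)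
      assume "q \<noteq> 0"
      have "v = (1 / q) *\<^sub>R (q *\<^sub>R v)" using \<open>q \<noteq> 0\<close> by simp
      also have "q *\<^sub>R v = (- p) *\<^sub>R u" using z by (metis add.commute add_eq_0_iff2 scaleR_minus_left)
      finally show False using indep by (metis scaleR_scaleR)
    qed
    moreover have "u \<noteq> 0" using indep by simp
    ultimately have "p = 0" using z by auto
    then show ?thesis using \<open>q = 0\<close> by (simp add: p_def q_def)
  qed
  show lin: "linear \<theta>" using add sc by (intro linearI) simp_all
  \<comment> \<open>Polarising \<open>K\<close> gives twice the Christoffel symbol of the first
    kind. Adding the same identity with y and z exchanged recovers 2 G h y z.\<close>
  have K3: "G h y z + G y h z - G z h y = 2 * (\<theta> h * g y z + \<theta> y * g h z)" for h y z
  proof -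
    have "G (h + y) (h + y) z - G z (h + y) (h + y) / 2 - (G h h z - G z h h / 2) - (G y y z - G z y y / 2)
      = G h y z + G y h z - G z h y"
      using Glin(3)[of z y h] by (simp add: G1 G2 G3 field_simps)
    then show ?thesis unfolding K by (simp add: add gl algebra_simps)
  qed
  show "G h y z = 2 * \<theta> h * g y z + \<theta> y * g h z + \<theta> z * g h y"
    using K3[of h y z] K3[of h z y] Glin(3)[of h y z] Glin(3)[of y h z] Glin(3)[of z h y] g(2)
    by (simp add: algebra_simps)
qed

text \<open>The assumption \<open>straight\<close> is the pointwise form of having straight
  geodesics, supplied later by \<open>straight_geodesics_spray\<close>; \<tau> is the scalar
  function of the S-curvature read in the coordinates.\<close>

locale randers_chart =
  fixes W :: "(real^'n::finite) set" and F :: "real^'n \<Rightarrow> real^'n \<Rightarrow> real"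
    and a :: "real^'n \<Rightarrow> real^'n^'n" and b :: "real^'n \<Rightarrow> real^'n" and \<tau> :: "real^'n \<Rightarrow> real"
  assumes W: "open W" and dim: "CARD('n) \<ge> 2"
    and smooth_a: "smooth_on W a" and smooth_b: "smooth_on W b"
    and sym_a: "x \<in> W \<Longrightarrow> transpose (a x) = a x"
    and pos_a: "x \<in> W \<Longrightarrow> y \<noteq> 0 \<Longrightarrow> y \<bullet> (a x *v y) > 0"
    and F: "x \<in> W \<Longrightarrow> F x y = alpha_norm (a x) y + b x \<bullet> y"
    and F_pos: "x \<in> W \<Longrightarrow> y \<noteq> 0 \<Longrightarrow> F x y > 0"
    and fund_pos: "x \<in> W \<Longrightarrow> y \<noteq> 0 \<Longrightarrow> v \<noteq> 0 \<Longrightarrow> v \<bullet> (fund F x y *v v) > 0"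
    and b_less: "x \<in> W \<Longrightarrow> conorm2 (a x) (b x) < 1"
    and straight: "x \<in> W \<Longrightarrow> y \<noteq> 0 \<Longrightarrow> \<exists>P. spray F x y = P *\<^sub>R y"
    and isotropic: "x \<in> W \<Longrightarrow> y \<noteq> 0 \<Longrightarrow> S_curvature F x y = (real CARD('n) + 1) * \<tau> x * F x y"
begin

definition g :: "real^'n \<Rightarrow> real^'n \<Rightarrow> real^'n \<Rightarrow> real" where "g x y z = y \<bullet> (a x *v z)"
definition dg :: "real^'n \<Rightarrow> real^'n \<Rightarrow> real^'n \<Rightarrow> real^'n \<Rightarrow> real" where "dg x h y z = y \<bullet> (dd a x h *v z)"
definition db :: "real^'n \<Rightarrow> real^'n \<Rightarrow> real^'n \<Rightarrow> real" where "db x h z = dd b x h \<bullet> z"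
text \<open>The constant 4 comes from putting all three arguments equal to y in the expected formula
  for the derivative of g. At y = 0 the quotient is 0, the value that linearity demands.\<close>

definition \<theta> :: "real^'n \<Rightarrow> real^'n \<Rightarrow> real" where "\<theta> x y = dg x y y y / (4 * g x y y)"
abbreviation \<alpha> :: "real^'n \<Rightarrow> real^'n \<Rightarrow> real" where "\<alpha> x y \<equiv> alpha_norm (a x) y"

lemma bilinear_g: "bilinear (g x)"
  unfolding bilinear_def g_def by (auto intro!: linearI simp: matrix_vector_right_distrib inner_simps matrix_vector_mult_scaleR)

lemmas g_lin = bilinear_radd[OF bilinear_g] bilinear_rmul[OF bilinear_g] bilinear_ladd[OF bilinear_g]
  bilinear_lmul[OF bilinear_g]

lemma g_sym: "x \<in> W \<Longrightarrow> g x y z = g x z y"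
  unfolding g_def using sym_a[of x] by (metis dot_lmul_matrix inner_commute vector_transpose_matrix)

lemma g_pos: "x \<in> W \<Longrightarrow> y \<noteq> 0 \<Longrightarrow> g x y y > 0"
  unfolding g_def by (rule pos_a)

lemma alpha_eq: "\<alpha> x y = sqrt (g x y y)"
  by (simp add: alpha_norm_def g_def)

lemma alpha_pos: "x \<in> W \<Longrightarrow> y \<noteq> 0 \<Longrightarrow> \<alpha> x y > 0"
  unfolding alpha_eq using g_pos by simp

lemma alpha_sq: "x \<in> W \<Longrightarrow> (\<alpha> x y)\<^sup>2 = g x y y"
  unfolding alpha_eq using g_pos[of x y] by (cases "y = 0") (auto simp: g_def)

lemma alpha_minus: "\<alpha> x (- y) = \<alpha> x y"
  by (simp add: alpha_eq g_def vec.neg)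

lemma smooth_g: "smooth_on W (\<lambda>u. g u y z)"
  unfolding g_def by (rule smooth_on_bounded_linear[OF W bounded_linear_matrix_form smooth_a])

lemma deriv_g: "x \<in> W \<Longrightarrow> ((\<lambda>u. g u y z) has_derivative (\<lambda>h. dg x h y z)) (at x)"
  unfolding g_def dg_def
  by (rule bounded_linear.has_derivative[OF bounded_linear_matrix_form smooth_on_has_derivative[OF smooth_a]])

lemma deriv_b: "x \<in> W \<Longrightarrow> ((\<lambda>u. b u \<bullet> z) has_derivative (\<lambda>h. db x h z)) (at x)"
  unfolding db_def
  by (rule bounded_linear.has_derivative[OF bounded_linear_inner_left smooth_on_has_derivative[OF smooth_b]])

lemma smooth_dg: "smooth_on W (\<lambda>u. dg u h y z)"
  unfolding dg_def by (rule smooth_on_bounded_linear[OF W bounded_linear_matrix_form smooth_on_dd[OF smooth_a]])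

lemma smooth_db: "smooth_on W (\<lambda>u. db u h z)"
  unfolding db_def by (rule smooth_on_bounded_linear[OF W bounded_linear_inner_left smooth_on_dd[OF smooth_b]])

lemma linear_dg: "x \<in> W \<Longrightarrow> linear (\<lambda>h. dg x h y z)" "linear (\<lambda>y. dg x h y z)" "linear (\<lambda>z. dg x h y z)"
  using has_derivative_linear[OF deriv_g] by (auto intro!: linearI simp: dg_def inner_simps matrix_vector_right_distrib
      matrix_vector_mult_scaleR)

lemma linear_db: "x \<in> W \<Longrightarrow> linear (\<lambda>h. db x h z)" "linear (\<lambda>z. db x h z)"
  using has_derivative_linear[OF deriv_b] by (auto intro!: linearI simp: db_def inner_simps)

lemma dg_sym:
  assumes x: "x \<in> W"
  shows "dg x h y z = dg x h z y"
proof -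
  have "((\<lambda>u. g u z y) has_derivative (\<lambda>h. dg x h y z)) (at x)"
    by (rule has_derivative_transform_within_open[OF deriv_g[OF x] W x]) (rule g_sym)
  then show ?thesis using has_derivative_unique[OF deriv_g[OF x]] by metis
qed

lemma deriv_alpha_y:
  assumes x: "x \<in> W" and y: "y \<noteq> 0"
  shows "(\<alpha> x has_derivative (\<lambda>h. g x y h / \<alpha> x y)) (at y)"
proof -
  have "((\<lambda>v. v \<bullet> (a x *v v)) has_derivative (\<lambda>h. y \<bullet> (a x *v h) + h \<bullet> (a x *v y))) (at y)"
    by (intro has_derivative_inner has_derivative_ident bounded_linear.has_derivative[OF matrix_vector_mul_bounded_linear])
  then have "((\<lambda>v. g x v v) has_derivative (\<lambda>h. 2 * g x y h)) (at y)"
    unfolding g_def[symmetric] by (rule has_derivative_eq_rhs) (auto simp: g_sym[OF x, of _ y])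
  then show ?thesis
    unfolding alpha_eq[abs_def] using g_pos[OF x y] by (auto intro!: derivative_eq_intros simp: field_simps)
qed

lemma deriv_F2_y:
  assumes x: "x \<in> W" and y: "y \<noteq> 0"
  shows "((\<lambda>v. (F x v)\<^sup>2) has_derivative (\<lambda>h. 2 * F x y * (g x y h / \<alpha> x y + b x \<bullet> h))) (at y)"
  unfolding F[OF x] using alpha_pos[OF x y]
  by (auto intro!: derivative_eq_intros deriv_alpha_y[OF x y] simp: fun_eq_iff field_simps)

lemma pdiff_F2:
  assumes x: "x \<in> W" and y: "y \<noteq> 0"
  shows "pdiff l (\<lambda>v. (F x v)\<^sup>2) y = 2 * F x y * (g x y (axis l 1) / \<alpha> x y + b x \<bullet> axis l 1)"
  by (rule pdiff_eq[OF deriv_F2_y[OF x y]])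

text \<open>This is the consequence \<open>g\<^sub>i\<^sub>j y\<^sup>j = F
  \<partial>F/\<partial>y\<^sup>i\<close> of homogeneity, read off from the explicit second
  derivative. It allows the inverse fundamental tensor in the spray to be cleared.\<close>

lemma fund_y:
  assumes x: "x \<in> W" and y: "y \<noteq> 0"
  shows "(fund F x y *v y) $ i = F x y * (g x y (axis i 1) / \<alpha> x y + b x \<bullet> axis i 1)"
proof -
  let ?f = "\<lambda>h z. (g x y h / \<alpha> x y + b x \<bullet> h) * (g x y z / \<alpha> x y + b x \<bullet> z)
      + F x y * (g x h z / \<alpha> x y - g x y z * g x y h / (\<alpha> x y) ^ 3)"
  have "((\<lambda>u. 2 * F x u * (g x u z / \<alpha> x u + b x \<bullet> z)) has_derivative (\<lambda>h. 2 * ?f h z)) (at y)" for z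
  proof -
    have 1: "((\<lambda>u. g x u z) has_derivative (\<lambda>h. g x h z)) (at y)"
      unfolding g_def by (rule derivative_eq_intros refl | simp)+
    have nz: "\<alpha> x y \<noteq> 0" using alpha_pos[OF x y] by simp
    show ?thesis unfolding F[OF x]
      by (rule derivative_eq_intros deriv_alpha_y[OF x y] 1 nz refl)+
         (use nz in \<open>auto simp: fun_eq_iff field_simps power3_eq_cube\<close>)
  qed
  then have "((\<lambda>u. pdiff j (\<lambda>v. (F x v)\<^sup>2) u) has_derivative (\<lambda>h. 2 * ?f h (axis j 1))) (at y)" for j
    by (rule has_derivative_transform_within_open[OF _ open_delete[OF open_UNIV, of 0]]) (use y pdiff_F2[OF x] in auto)
  then have "pdiff i (\<lambda>u. pdiff j (\<lambda>v. (F x v)\<^sup>2) u) y = 2 * ?f (axis i 1) (axis j 1)" for j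
    by (rule pdiff_eq)
  then have "(fund F x y *v y) $ i = (\<Sum>j\<in>UNIV. y $ j *\<^sub>R ?f (axis i 1) (axis j 1))"
    by (simp add: fund_def matrix_vector_mult_def mult.commute[of _ "y $ _"] del: distrib_left_numeral)
  also have "\<dots> = ?f (axis i 1) y"
    by (rule linear_eq_sum_axis[symmetric])
       (auto intro!: linearI simp: g_lin inner_simps add_divide_distrib algebra_simps)
  also have "\<dots> = F x y * (g x y (axis i 1) / \<alpha> x y + b x \<bullet> axis i 1)"
    using alpha_pos[OF x y] alpha_sq[OF x, of y] g_sym[OF x, of _ y] unfolding F[OF x]
    by (simp add: field_simps power2_eq_square power3_eq_cube flip: alpha_sq[OF x])
  finally show ?thesis .
qed

definition dF :: "real^'n \<Rightarrow> real^'n \<Rightarrow> real^'n \<Rightarrow> real" where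
  "dF x y h = dg x h y y / (2 * \<alpha> x y) + db x h y"

lemma deriv_alpha_x:
  assumes x: "x \<in> W" and y: "y \<noteq> 0"
  shows "((\<lambda>u. \<alpha> u y) has_derivative (\<lambda>h. dg x h y y / (2 * \<alpha> x y))) (at x)"
  unfolding alpha_eq[abs_def] using g_pos[OF x y]
  by (auto intro!: derivative_eq_intros deriv_g[OF x] simp: field_simps)

lemma deriv_F_x:
  assumes x: "x \<in> W" and y: "y \<noteq> 0"
  shows "((\<lambda>u. F u y) has_derivative dF x y) (at x)"
proof -
  have "((\<lambda>u. \<alpha> u y + b u \<bullet> y) has_derivative (\<lambda>h. dF x y h)) (at x)"
    unfolding dF_def by (intro has_derivative_add deriv_alpha_x deriv_b x y)
  then show ?thesis
    by (rule has_derivative_transform_within_open[OF _ W x]) (simp add: F)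
qed

text \<open>The Euler--Lagrange equations, contracted with \<open>z\<close>.\<close>

lemma spray_eq:
  assumes x: "x \<in> W" and y: "y \<noteq> 0" and P: "spray F x y = P *\<^sub>R y"
  shows "dF x y y * (g x y z / \<alpha> x y + b x \<bullet> z)
      + F x y * (dg x y y z / \<alpha> x y - g x y z * dg x y y y / (2 * (\<alpha> x y) ^ 3) + db x y z)
      - F x y * dF x y z = 2 * P * F x y * (g x y z / \<alpha> x y + b x \<bullet> z)" (is "?L z = ?R z")
proof -
  let ?f = "\<lambda>h z. dF x y h * (g x y z / \<alpha> x y + b x \<bullet> z)
      + F x y * (dg x h y z / \<alpha> x y - g x y z * dg x h y y / (2 * (\<alpha> x y) ^ 3) + db x h z)"
  define E where "E = (\<chi> l. (\<Sum>k\<in>UNIV. pdiff k (\<lambda>u. pdiff l (\<lambda>v. (F u v)\<^sup>2) y) x * y $ k)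
            - pdiff l (\<lambda>u. (F u y)\<^sup>2) x)"
  have nz: "\<alpha> x y \<noteq> 0" using alpha_pos[OF x y] by simp
  have 1: "((\<lambda>u. pdiff l (\<lambda>v. (F u v)\<^sup>2) y) has_derivative (\<lambda>h. 2 * ?f h (axis l 1))) (at x)" for l
  proof -
    have "((\<lambda>u. 2 * F u y * (g u y (axis l 1) / \<alpha> u y + b u \<bullet> axis l 1)) has_derivative (\<lambda>h. 2 * ?f h (axis l 1))) (at x)"
      by (rule derivative_eq_intros deriv_F_x[OF x y] deriv_alpha_x[OF x y] deriv_g[OF x] deriv_b[OF x] nz refl)+
         (use nz in \<open>auto simp: fun_eq_iff field_simps power3_eq_cube\<close>)
    then show ?thesis
      by (rule has_derivative_transform_within_open[OF _ W x]) (simp add: pdiff_F2 y)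
  qed
  have 2: "((\<lambda>u. (F u y)\<^sup>2) has_derivative (\<lambda>h. 2 * F x y * dF x y h)) (at x)"
    by (auto intro!: derivative_eq_intros deriv_F_x[OF x y])
  have E: "E $ l = 2 * ?f y (axis l 1) - 2 * F x y * dF x y (axis l 1)" for l
  proof -
    have "(\<Sum>k\<in>UNIV. pdiff k (\<lambda>u. pdiff l (\<lambda>v. (F u v)\<^sup>2) y) x * y $ k)
        = (\<Sum>k\<in>UNIV. y $ k *\<^sub>R (2 * ?f (axis k 1) (axis l 1)))"
      by (simp add: pdiff_eq[OF 1] mult.commute)
    also have "\<dots> = 2 * ?f y (axis l 1)"
      by (rule linear_eq_sum_axis[OF has_derivative_linear[OF 1], symmetric])
    finally show ?thesis by (simp add: E_def pdiff_eq[OF 2])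
  qed
  have inv: "invertible (fund F x y)" by (rule invertible_pos_def[OF fund_pos[OF x y]])
  have "fund F x y *v ((1/4) *\<^sub>R (matrix_inv (fund F x y) *v E)) = fund F x y *v (P *\<^sub>R y)"
    using P by (simp add: spray_def E_def)
  then have "(1/4) *\<^sub>R E = P *\<^sub>R (fund F x y *v y)"
    using inv by (simp add: matrix_vector_mult_scaleR matrix_vector_mul_assoc matrix_inv_right)
  from arg_cong[OF this, of "\<lambda>v. v $ l" for l] have El: "E $ l = 4 * (P * (fund F x y *v y) $ l)" for l
    by simp
  have ax: "?L (axis l 1) = ?R (axis l 1)" for l
  proof -
    have "2 * ?L (axis l 1) = 2 * ?R (axis l 1)"
      using E[of l] El[of l] unfolding fund_y[OF x y] by algebra
    then show ?thesis by simp
  qed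
  have "linear (dF x y)" using has_derivative_linear[OF deriv_F_x[OF x y]] .
  then have "linear ?L"
    using linear_dg(3)[of x y y] linear_db(2)[of x y] g_lin
    by (intro linearI) (simp_all add: linear_add linear_scale inner_simps add_divide_distrib algebra_simps)
  moreover have "linear ?R"
    by (intro linearI) (simp_all add: g_lin inner_simps distrib_left add_divide_distrib algebra_simps)
  ultimately show ?thesis
    using linear_eq_sum_axis[of ?L z] linear_eq_sum_axis[of ?R z] ax by simp
qed

text \<open>Contracting the Euler-Lagrange equations with y itself collapses every term by
  homogeneity and gives the classical projective factor, half the derivative of F along y divided by
  F.\<close>

lemma spray_factor:
  assumes x: "x \<in> W" and y: "y \<noteq> 0" and P: "spray F x y = P *\<^sub>R y"
  shows "dF x y y = 2 * P * F x y"
proof -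
  have "g x y y / \<alpha> x y = \<alpha> x y" "g x y y / (2 * (\<alpha> x y) ^ 3) = 1 / (2 * \<alpha> x y)"
    using alpha_pos[OF x y] by (simp_all add: power2_eq_square power3_eq_cube flip: alpha_sq[OF x])
  then have 1: "g x y y / \<alpha> x y + b x \<bullet> y = F x y"
    "dg x y y y / \<alpha> x y - g x y y * dg x y y y / (2 * (\<alpha> x y) ^ 3) + db x y y = dF x y y"
    using alpha_pos[OF x y] by (simp_all add: F[OF x] dF_def field_simps)
  have "dF x y y * F x y = (2 * P * F x y) * F x y"
    using spray_eq[OF x y P, of y] unfolding 1 by (simp add: mult.assoc)
  then show ?thesis using F_pos[OF x y] mult_right_cancel[of "F x y"] by force
qed

lemma hamel_and_closed:
  assumes x: "x \<in> W"
  shows "2 * g x y y * dg x y y z - g x y z * dg x y y y - g x y y * dg x z y y = 0"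
    and "db x y z = db x z y"
proof -
  \<comment> \<open>This is Hamel's equation: the value of the projective factor cancels the terms
    proportional to the y-derivative of F, and F is divided out.\<close>
  have H: "dg x y y z / \<alpha> x y - g x y z * dg x y y y / (2 * (\<alpha> x y) ^ 3) + db x y z
      - dg x z y y / (2 * \<alpha> x y) - db x z y = 0" if y: "y \<noteq> 0" for y
  proof -
    obtain P where P: "spray F x y = P *\<^sub>R y" using straight[OF x y] by blast
    have "F x y * (dg x y y z / \<alpha> x y - g x y z * dg x y y y / (2 * (\<alpha> x y) ^ 3) + db x y z - dF x y z) = 0"
      using spray_eq[OF x y P, of z] unfolding spray_factor[OF x y P] by (simp add: algebra_simps)
    then show ?thesis using F_pos[OF x y] by (simp add: dF_def)
  qed
  have "2 * g x y y * dg x y y z - g x y z * dg x y y y - g x y y * dg x z y y = 0 \<and> db x y z = db x z y"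
  proof (cases "y = 0")
    case True
    then show ?thesis
      using linear_0[OF linear_db(1)[OF x]] linear_0[OF linear_db(2)] linear_0[OF linear_dg(1)[OF x]]
        linear_0[OF bilinear_g[unfolded bilinear_def, THEN conjunct1, rule_format]]
      by (simp add: g_def)
  next
    case False
    have "dg x (- y) u v = - dg x y u v" "dg x u (- y) v = - dg x u y v" "dg x u v (- y) = - dg x u v y"
      "g x (- y) v = - g x y v" "db x (- y) u = - db x y u" "db x u (- y) = - db x u y" for u v
      using linear_neg[OF linear_dg(1)[OF x]] linear_neg[OF linear_db(1)[OF x]]
      by (simp_all add: dg_def g_def db_def vec.neg)
    then have "dg x y y z / \<alpha> x y - g x y z * dg x y y y / (2 * (\<alpha> x y) ^ 3) - db x y z
      - dg x z y y / (2 * \<alpha> x y) + db x z y = 0"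
      using H[of "- y"] False by (simp add: alpha_minus)
    with H[OF False] have c: "db x y z = db x z y"
      and h: "dg x y y z / \<alpha> x y - g x y z * dg x y y y / (2 * (\<alpha> x y) ^ 3) - dg x z y y / (2 * \<alpha> x y) = 0"
      by simp_all
    have "2 * (\<alpha> x y) ^ 3 * (dg x y y z / \<alpha> x y - g x y z * dg x y y y / (2 * (\<alpha> x y) ^ 3) - dg x z y y / (2 * \<alpha> x y)) =
      2 * (\<alpha> x y)\<^sup>2 * dg x y y z - g x y z * dg x y y y - (\<alpha> x y)\<^sup>2 * dg x z y y"
      using alpha_pos[OF x False] by (simp add: field_simps power2_eq_square power3_eq_cube)
    with h c show ?thesis by (simp add: alpha_sq[OF x])
  qed
  then show "2 * g x y y * dg x y y z - g x y z * dg x y y y - g x y y * dg x z y y = 0"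
    and "db x y z = db x z y" by auto
qed

lemma theta:
  assumes x: "x \<in> W"
  shows "linear (\<theta> x)" "dg x h y z = 2 * \<theta> x h * g x y z + \<theta> x y * g x h z + \<theta> x z * g x h y"
  unfolding \<theta>_def[abs_def]
  by (rule proj_factor[of "g x" "dg x", OF bilinear_g g_sym[OF x] g_pos[OF x] linear_dg(1)[OF x]
    linear_dg(2) dg_sym[OF x] hamel_and_closed(1)[OF x]]; assumption?)+

lemma smooth_theta: "smooth_on W (\<lambda>u. \<theta> u y)"
proof (cases "y = 0")
  case True
  then show ?thesis using smooth_on_const[OF W] by (simp add: \<theta>_def g_def)
next
  case False
  then have "g x y y \<noteq> 0" if "x \<in> W" for x using g_pos[OF that] by force
  then show ?thesis unfolding \<theta>_def
    by (intro smooth_on_divide smooth_on_mult smooth_on_const smooth_g smooth_dg W) simp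
qed

section \<open>Isotropic S-curvature and the covariant derivative of the 1-form\<close>

lemma dF_radial: "x \<in> W \<Longrightarrow> y \<noteq> 0 \<Longrightarrow> dF x y y = 2 * \<theta> x y * \<alpha> x y + db x y y"
  using alpha_pos[of x y] by (simp add: dF_def theta(2) power2_eq_square flip: alpha_sq)

text \<open>
  The Busemann--Hausdorff density contributes to the S-curvature only a term that is linear in
  \<open>y\<close>; comparing the even and the odd parts in \<open>y\<close> eliminates it.
\<close>

lemma isotropic_db_diag:
  assumes x: "x \<in> W"
  shows "db x y y = 2 * (b x \<bullet> y) * \<theta> x y + 2 * \<tau> x * (g x y y - (b x \<bullet> y)\<^sup>2)"
proof (cases "y = 0")
  case True
  then show ?thesis by (simp add: db_def g_def)
next
  case y: False
  define N where "N = real CARD('n) + 1"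
  \<comment> \<open>The density term divided by n + 1. The volume density is never computed: the
    argument uses only that \<open>L\<close> is odd, which is visible from the form of the
    sum.\<close>
  define L where "L v = (\<Sum>m\<in>UNIV. v $ m * pdiff m (\<lambda>u. ln (bh_density F u)) x) / N" for v
  have N: "N > 0" by (simp add: N_def)
  have key: "2 * \<theta> x y * \<alpha> x y + db x y y = 2 * F x y * (L y + \<tau> x * F x y)" if y: "y \<noteq> 0" for y
  proof -
    define P where "P v = dF x v v / (2 * F x v)" for v
    have spray: "spray F x v = P v *\<^sub>R v" if "v \<noteq> 0" for v
    proof -
      obtain p where p: "spray F x v = p *\<^sub>R v" using straight[OF x \<open>v \<noteq> 0\<close>] by blast
      then show ?thesis using spray_factor[OF x \<open>v \<noteq> 0\<close> p] F_pos[OF x \<open>v \<noteq> 0\<close>] by (simp add: P_def)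
    qed
    have P_eq: "P v = (2 * \<theta> x v * \<alpha> x v + db x v v) / (2 * (\<alpha> x v + b x \<bullet> v))" if "v \<noteq> 0" for v
      using dF_radial[OF x that] by (simp add: P_def F[OF x])
    have o: "open (- {0 :: real^'n})" "y \<in> - {0}" using y by auto
    have "\<exists>P'. (P has_derivative P') (at y)"
    proof -
      have th: "(\<theta> x has_derivative \<theta> x) (at y)"
        by (rule bounded_linear_imp_has_derivative) (use theta(1)[OF x] linear_conv_bounded_linear in blast)
      have lb: "bounded_bilinear (db x)"
        using linear_db[of x] x by (simp add: bilinear_conv_bounded_bilinear[symmetric] bilinear_def)
      have dbd: "((\<lambda>v. db x v v) has_derivative (\<lambda>h. db x y h + db x h y)) (at y)"
        by (rule bounded_bilinear.FDERIV[OF lb has_derivative_ident has_derivative_ident])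
      have nz: "2 * (\<alpha> x y + b x \<bullet> y) \<noteq> 0" using F_pos[OF x y] by (simp add: F[OF x])
      have "(\<lambda>v. (2 * \<theta> x v * \<alpha> x v + db x v v) / (2 * (\<alpha> x v + b x \<bullet> v))) differentiable (at y)"
        using th dbd deriv_alpha_y[OF x y] nz
        by (intro differentiable_divide differentiable_add differentiable_mult differentiable_const
            differentiable_inner differentiable_ident) (auto simp: differentiable_def)
      then obtain P' where "((\<lambda>v. (2 * \<theta> x v * \<alpha> x v + db x v v) / (2 * (\<alpha> x v + b x \<bullet> v))) has_derivative P') (at y)"
        by (auto simp: differentiable_def)
      then have "(P has_derivative P') (at y)"
        by (rule has_derivative_transform_within_open[OF _ o]) (simp add: P_eq)
      then show ?thesis by blast
    qed
    then obtain P' where P': "(P has_derivative P') (at y)" by blast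
    have "P (t *\<^sub>R y) = t * P y" if "t > 0" for t
    proof -
      have "\<theta> x (t *\<^sub>R y) = t * \<theta> x y" "db x (t *\<^sub>R y) (t *\<^sub>R y) = t * (t * db x y y)"
        "\<alpha> x (t *\<^sub>R y) = t * \<alpha> x y"
        using linear_scale[OF theta(1)[OF x]] linear_scale[OF linear_db(1)[OF x]] linear_scale[OF linear_db(2)] that
        by (simp_all add: alpha_eq g_lin real_sqrt_mult)
      moreover have "(2 * (t * \<theta> x y) * (t * \<alpha> x y) + t * (t * db x y y)) / (2 * (t * \<alpha> x y + t * (b x \<bullet> y)))
          = (t * t * (2 * \<theta> x y * \<alpha> x y + db x y y)) / (t * (2 * (\<alpha> x y + b x \<bullet> y)))"
        by (simp add: algebra_simps)
      ultimately show ?thesis using that y by (simp add: P_eq)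
    qed
    moreover have "((\<lambda>t. P (0 + t *\<^sub>R y)) has_real_derivative P' y) (at 1)"
      by (rule has_real_derivative_line) (use P' in simp)
    ultimately have "((\<lambda>t. t * P y) has_real_derivative P' y) (at 1)"
      using has_field_derivative_transform_within_open[of "\<lambda>t. P (0 + t *\<^sub>R y)" "P' y" 1 "{0<..}" "\<lambda>t. t * P y"]
      by simp
    moreover have "((\<lambda>t. t * P y) has_real_derivative P y) (at 1)" by (auto intro!: derivative_eq_intros)
    ultimately have euler: "P' y = P y" using DERIV_unique by blast
    have "((\<lambda>v. spray F x v $ m) has_derivative (\<lambda>h. P y * h $ m + P' h * y $ m)) (at y)" for m
    proof -
      have "((\<lambda>v. P v * v $ m) has_derivative (\<lambda>h. P y * h $ m + P' h * y $ m)) (at y)"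
        by (intro has_derivative_mult P' bounded_linear_imp_has_derivative bounded_linear_vec_nth)
      then show ?thesis
        by (rule has_derivative_transform_within_open[OF _ o]) (simp add: spray)
    qed
    from pdiff_eq[OF this] have "pdiff m (\<lambda>v. spray F x v $ m) y = P y + y $ m *\<^sub>R P' (axis m 1)" for m
      by (simp add: mult.commute)
    then have "(\<Sum>m\<in>UNIV. pdiff m (\<lambda>v. spray F x v $ m) y) = (\<Sum>m\<in>UNIV. P y + y $ m *\<^sub>R P' (axis m 1))"
      by simp
    \<comment> \<open>The divergence of P(y) y is n P plus the derivative of P along y, and Euler's
      relation for the 1-homogeneous P turns the latter into P; hence the factor n + 1.\<close>
    also have "\<dots> = N * P y"
      using linear_eq_sum_axis[OF has_derivative_linear[OF P'], of y] euler
      by (simp add: sum.distrib N_def algebra_simps)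
    finally have "S_curvature F x y = N * P y - N * L y"
      using N by (simp add: S_curvature_def L_def)
    then have "N * (P y - L y) = N * (\<tau> x * F x y)"
      using isotropic[OF x y] by (simp add: N_def algebra_simps)
    then have "P y = L y + \<tau> x * F x y" using N by simp
    then show ?thesis using F_pos[OF x y] dF_radial[OF x y] by (simp add: P_def field_simps)
  qed
  have L: "L (- y) = - L y" by (simp add: L_def sum_negf)
  have 1: "2 * \<theta> x y * \<alpha> x y + db x y y = 2 * (\<alpha> x y + b x \<bullet> y) * (L y + \<tau> x * (\<alpha> x y + b x \<bullet> y))"
    using key[OF y] by (simp add: F[OF x])
  have 2: "- 2 * \<theta> x y * \<alpha> x y + db x y y = 2 * (\<alpha> x y - b x \<bullet> y) * (- L y + \<tau> x * (\<alpha> x y - b x \<bullet> y))"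
    using key[of "- y"] y linear_neg[OF theta(1)[OF x]] linear_neg[OF linear_db(1)[OF x]] linear_neg[OF linear_db(2)]
    by (simp add: F[OF x] L alpha_minus)
  have "\<alpha> x y * (\<theta> x y) = \<alpha> x y * (L y + 2 * \<tau> x * (b x \<bullet> y))"
    using 1 2 by (simp add: algebra_simps)
  then have "L y = \<theta> x y - 2 * \<tau> x * (b x \<bullet> y)" using alpha_pos[OF x y] by simp
  with 1 show ?thesis unfolding alpha_sq[OF x, symmetric] by algebra
qed

text \<open>Polarisation of the diagonal case; closedness of the 1-form supplies the symmetry that
  this requires. With the connection given by \<theta> it says \<open>b\<^sub>i\<^sub>;\<^sub>j = 2
  \<tau> (a\<^sub>i\<^sub>j - b\<^sub>i b\<^sub>j)\<close>.\<close>

lemma isotropic_db: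
  assumes x: "x \<in> W"
  shows "db x y z = \<theta> x y * (b x \<bullet> z) + \<theta> x z * (b x \<bullet> y) + 2 * \<tau> x * (g x y z - (b x \<bullet> y) * (b x \<bullet> z))"
  using isotropic_db_diag[OF x, of "y + z"] isotropic_db_diag[OF x, of y] isotropic_db_diag[OF x, of z]
    hamel_and_closed(2)[OF x, of y z] g_sym[OF x, of z y] linear_add[OF linear_db(1)[OF x]] linear_add[OF linear_db(2)]
    linear_add[OF theta(1)[OF x]]
  by (simp add: g_lin inner_simps power2_eq_square algebra_simps)

lemma b_less_alpha:
  assumes x: "x \<in> W" and y: "y \<noteq> 0"
  shows "(b x \<bullet> y)\<^sup>2 < g x y y"
proof -
  have "\<bar>b x \<bullet> y\<bar> < \<alpha> x y" using F_pos[OF x y] F_pos[OF x, of "- y"] y by (auto simp: F[OF x] alpha_minus)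
  then have "\<bar>b x \<bullet> y\<bar>\<^sup>2 < (\<alpha> x y)\<^sup>2" by (intro power_strict_mono) auto
  then show ?thesis by (simp add: alpha_sq[OF x])
qed

text \<open>Isotropy provides \<tau> as a mere function. Solving \<open>isotropic_db_diag\<close>
  for it at one fixed vector exhibits it as a quotient of smooth functions with positive
  denominator.\<close>

lemma smooth_tau: "smooth_on W \<tau>"
proof -
  define e :: "real^'n" where "e = axis undefined 1"
  have e: "e \<noteq> 0" by (simp add: e_def axis_eq_0_iff)
  have b: "smooth_on W (\<lambda>u. b u \<bullet> e)" by (rule smooth_on_bounded_linear[OF W bounded_linear_inner_left smooth_b])
  have "smooth_on W (\<lambda>u. (db u e e - 2 * (b u \<bullet> e) * \<theta> u e) / (2 * (g u e e - (b u \<bullet> e) * (b u \<bullet> e))))"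
    using b_less_alpha[OF _ e]
    by (intro smooth_on_divide smooth_on_diff smooth_on_mult smooth_on_const smooth_db smooth_theta smooth_g b W)
       (force simp: power2_eq_square)
  then show ?thesis
  proof (rule smooth_on_cong[OF W, rotated])
    fix u assume u: "u \<in> W"
    show "\<tau> u = (db u e e - 2 * (b u \<bullet> e) * \<theta> u e) / (2 * (g u e e - (b u \<bullet> e) * (b u \<bullet> e)))"
      using isotropic_db_diag[OF u, of e] b_less_alpha[OF u e] by (simp add: power2_eq_square field_simps)
  qed
qed

section \<open>The norm of the 1-form and the associated pair\<close>

definition b2 :: "real^'n \<Rightarrow> real" where "b2 x = conorm2 (a x) (b x)"

lemma invertible_a: "x \<in> W \<Longrightarrow> invertible (a x)"
  by (rule invertible_pos_def[OF pos_a])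

text \<open>The inverse matrix is not differentiated directly: with u the dual vector of b,
  differentiating a u = b gives the derivative of \<open>b2\<close> as 2 db(h, u) - dg(h, u, u). All
  terms with \<theta> then cancel.\<close>

lemma smooth_b2: "smooth_on W b2"
  and deriv_b2: "x \<in> W \<Longrightarrow> (b2 has_derivative (\<lambda>h. 4 * \<tau> x * (1 - b2 x) * (b x \<bullet> h))) (at x)"
proof -
  let ?u = "\<lambda>x. matrix_inv (a x) *v b x"
  have u: "smooth_on W ?u" by (rule smooth_on_matrix_inv_vector[OF W smooth_a smooth_b invertible_a])
  have b2: "b2 = (\<lambda>x. b x \<bullet> ?u x)" by (simp add: b2_def[abs_def] conorm2_def)
  show "smooth_on W b2" unfolding b2 by (rule smooth_on_inner[OF W smooth_b u])
  assume x: "x \<in> W"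
  have au: "a v *v ?u v = b v" if "v \<in> W" for v
    using invertible_a[OF that] by (simp add: matrix_vector_mul_assoc matrix_inv_right)
  have D1: "(b2 has_derivative (\<lambda>h. b x \<bullet> dd ?u x h + db x h (?u x))) (at x)"
    unfolding b2 db_def
    by (intro has_derivative_inner smooth_on_has_derivative[OF smooth_b x] smooth_on_has_derivative[OF u x])
  have "((\<lambda>v. b2 v) has_derivative (\<lambda>h. db x h (?u x) + db x h (?u x) - dg x h (?u x) (?u x))) (at x)"
  proof (rule has_derivative_eq_rhs[OF D1], rule ext)
    fix h
    have "((\<lambda>v. a v *v ?u v) has_derivative (\<lambda>h. a x *v dd ?u x h + dd a x h *v ?u x)) (at x)"
      by (intro bounded_bilinear.FDERIV[OF bounded_bilinear_matrix_vector] smooth_on_has_derivative[OF smooth_a x] smooth_on_has_derivative[OF u x])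
    then have "(b has_derivative (\<lambda>h. a x *v dd ?u x h + dd a x h *v ?u x)) (at x)"
      by (rule has_derivative_transform_within_open[OF _ W x]) (simp add: au)
    then have "dd b x h = a x *v dd ?u x h + dd a x h *v ?u x" by (simp add: dd_eq)
    then have "db x h (?u x) = g x (?u x) (dd ?u x h) + dg x h (?u x) (?u x)"
      by (simp add: db_def g_def dg_def inner_simps inner_commute)
    moreover have "g x (?u x) (dd ?u x h) = b x \<bullet> dd ?u x h"
      unfolding g_sym[OF x, of "?u x"] by (simp add: g_def au[OF x] inner_commute)
    ultimately show "b x \<bullet> dd ?u x h + db x h (?u x) = db x h (?u x) + db x h (?u x) - dg x h (?u x) (?u x)"
      by simp
  qed
  then show "(b2 has_derivative (\<lambda>h. 4 * \<tau> x * (1 - b2 x) * (b x \<bullet> h))) (at x)"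
  proof (rule has_derivative_eq_rhs, intro ext)
    fix h
    have 1: "g x h (?u x) = b x \<bullet> h" "g x (?u x) (?u x) = b2 x" "b x \<bullet> ?u x = b2 x"
      by (simp_all add: g_def au[OF x] b2 inner_commute)
    show "db x h (?u x) + db x h (?u x) - dg x h (?u x) (?u x) = 4 * \<tau> x * (1 - b2 x) * (b x \<bullet> h)"
      unfolding isotropic_db[OF x] theta(2)[OF x] 1 by (simp add: algebra_simps)
  qed
qed

text \<open>The division removes the term \<open>b\<^sub>i b\<^sub>j\<close> from the covariant
  derivative: since d(b^2) = 4 \<tau> (1 - b^2) \<beta>, differentiating the root contributes
  exactly the opposite of that term, and \<open>c x * g x h z\<close> remains.\<close>

definition \<rho> :: "real^'n \<Rightarrow> real^'n \<Rightarrow> real" where "\<rho> x y = (b x \<bullet> y) / sqrt (1 - conorm2 (a x) (b x))"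
definition c :: "real^'n \<Rightarrow> real" where "c x = 2 * \<tau> x / sqrt (1 - conorm2 (a x) (b x))"

lemma smooth_root: "smooth_on W (\<lambda>x. sqrt (1 - b2 x))"
  using b_less by (intro smooth_on_sqrt smooth_on_diff smooth_on_const smooth_b2 W) (auto simp: b2_def)

sublocale pp: proj_pair W g \<theta> \<rho> c
proof (rule proj_pair.intro)
  have root: "sqrt (1 - b2 x) \<noteq> 0" if "x \<in> W" for x using b_less[OF that] by (simp add: b2_def)
  show "open W" by (rule W)
  show "2 \<le> DIM(real^'n)" using dim by simp
  fix x y z
  show "smooth_on W (\<lambda>u. g u y z)" "smooth_on W (\<lambda>u. \<theta> u y)" by (fact smooth_g smooth_theta)+
  show "smooth_on W (\<lambda>u. \<rho> u y)" unfolding \<rho>_def b2_def[symmetric]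
    by (intro smooth_on_divide root smooth_root W smooth_on_bounded_linear[OF _ bounded_linear_inner_left smooth_b])
  show "smooth_on W c" unfolding c_def[abs_def] b2_def[symmetric]
    by (intro smooth_on_divide root smooth_root W smooth_on_mult smooth_tau smooth_on_const)
  assume x: "x \<in> W"
  show "bilinear (g x)" by (rule bilinear_g)
  show "g x y z = g x z y" by (rule g_sym[OF x])
  show "g x y y > 0" if "y \<noteq> 0" by (rule g_pos[OF x that])
  show "linear (\<theta> x)" by (rule theta(1)[OF x])
  show "linear (\<rho> x)" unfolding \<rho>_def by (intro linearI) (simp_all add: inner_simps add_divide_distrib)
  fix h
  show "dd (\<lambda>u. g u y z) x h = 2 * \<theta> x h * g x y z + \<theta> x y * g x h z + \<theta> x z * g x h y"
    using dd_eq[OF deriv_g[OF x]] theta(2)[OF x] by simp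
  define s where "s = sqrt (1 - b2 x)"
  have s: "s \<noteq> 0" "s * s = 1 - b2 x" "1 - b2 x > 0"
    using root[OF x] b_less[OF x] by (simp_all add: s_def b2_def)
  have "((\<lambda>u. b u \<bullet> z / sqrt (1 - b2 u)) has_derivative
      (\<lambda>h. db x h z / s + 2 * \<tau> x * (b x \<bullet> h) * (b x \<bullet> z) / s)) (at x)"
  proof -
    have "((\<lambda>u. sqrt (1 - b2 u)) has_derivative (\<lambda>h. - (4 * \<tau> x * (1 - b2 x) * (b x \<bullet> h)) * (inverse s / 2))) (at x)"
      using s(3) unfolding s_def by (auto intro!: derivative_eq_intros deriv_b2[OF x])
    then have r: "((\<lambda>u. sqrt (1 - b2 u)) has_derivative (\<lambda>h. - (2 * \<tau> x * (b x \<bullet> h)) * s)) (at x)"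
      by (rule has_derivative_eq_rhs) (use s(1) in \<open>auto simp: fun_eq_iff s(2)[symmetric]\<close>)
    show ?thesis
      by (rule derivative_eq_intros deriv_b[OF x] r root[OF x] refl)+
         (use s(1) in \<open>auto simp: fun_eq_iff s_def[symmetric] field_simps\<close>)
  qed
  then have "dd (\<lambda>u. \<rho> u z) x h = db x h z / s + 2 * \<tau> x * (b x \<bullet> h) * (b x \<bullet> z) / s"
    unfolding \<rho>_def b2_def[symmetric] by (simp add: dd_eq)
  then show "dd (\<lambda>u. \<rho> u z) x h = \<theta> x h * \<rho> x z + \<theta> x z * \<rho> x h + c x * g x h z"
    unfolding isotropic_db[OF x] \<rho>_def c_def b2_def[symmetric] s_def[symmetric]
    using s(1) by (simp add: field_simps)
qed

end

section \<open>Normal form of the associated pair\<close>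

text \<open>Gram-Schmidt for g. Indexing by subsets of the standard basis lets the full family be
  matched with that basis in \<open>inner_product_isometry\<close>.\<close>

lemma orthonormal_family:
  fixes g :: "'a::euclidean_space \<Rightarrow> 'a \<Rightarrow> real"
  assumes g: "bilinear g" "\<And>y z. g y z = g z y" "\<And>y. y \<noteq> 0 \<Longrightarrow> g y y > 0"
    and S: "finite S" "S \<subseteq> Basis"
  shows "\<exists>f :: 'a \<Rightarrow> 'a. \<forall>i\<in>S. \<forall>j\<in>S. g (f i) (f j) = (if i = j then 1 else 0)"
  using S
proof (induction S rule: finite_induct)
  case empty
  then show ?case by simp
next
  case (insert b S)
  then obtain f :: "'a \<Rightarrow> 'a" where f: "\<And>i j. i \<in> S \<Longrightarrow> j \<in> S \<Longrightarrow> g (f i) (f j) = (if i = j then 1 else 0)"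
    by auto
  have "card S < DIM('a)"
    using insert.hyps insert.prems psubset_card_mono[of Basis S] by auto
  then obtain v where v: "v \<notin> span (f ` S)"
    using exists_not_in_span[of "f ` S"] card_image_le[of S f] insert.hyps(1) by auto
  define m where "m = v - (\<Sum>i\<in>S. g v (f i) *\<^sub>R f i)"
  have "(\<Sum>i\<in>S. g v (f i) *\<^sub>R f i) \<in> span (f ` S)" by (intro span_sum span_scale span_base) auto
  then have m0: "m \<noteq> 0" using v by (auto simp: m_def)
  have lin: "linear (\<lambda>x. g x y)" for y using g(1) by (simp add: bilinear_def)
  have orth: "g m (f j) = 0" if "j \<in> S" for j
  proof -
    have "g m (f j) = g v (f j) - (\<Sum>i\<in>S. g v (f i) * g (f i) (f j))"
      unfolding m_def by (simp add: linear_diff[OF lin] linear_sum[OF lin] linear_scale[OF lin])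
    also have "(\<Sum>i\<in>S. g v (f i) * g (f i) (f j)) = (\<Sum>i\<in>S. if i = j then g v (f i) else 0)"
      using f that by (intro sum.cong) auto
    finally show ?thesis using insert.hyps(1) that by simp
  qed
  define h where "h = f(b := (1 / sqrt (g m m)) *\<^sub>R m)"
  have "g (h b) (h b) = 1"
    using g(3)[OF m0] by (simp add: h_def bilinear_lmul[OF g(1)] bilinear_rmul[OF g(1)] flip: real_sqrt_mult)
  moreover have "g (h b) (h j) = 0" "g (h j) (h b) = 0" if "j \<in> S" for j
    using orth[OF that] insert.hyps(2) that g(2)[of "f j" m]
    by (auto simp: h_def bilinear_lmul[OF g(1)] bilinear_rmul[OF g(1)])
  moreover have "g (h i) (h j) = (if i = j then 1 else 0)" if "i \<in> S" "j \<in> S" for i j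
    using f[OF that] insert.hyps(2) that by (auto simp: h_def)
  ultimately have "\<forall>i\<in>insert b S. \<forall>j\<in>insert b S. g (h i) (h j) = (if i = j then 1 else 0)"
    using insert.hyps(2) by auto
  then show ?case by blast
qed

lemma inner_product_isometry:
  fixes g :: "'a::euclidean_space \<Rightarrow> 'a \<Rightarrow> real"
  assumes g: "bilinear g" "\<And>y z. g y z = g z y" "\<And>y. y \<noteq> 0 \<Longrightarrow> g y y > 0"
  obtains E L :: "'a \<Rightarrow> 'a" where "linear E" "linear L" "\<And>y z. g y z = E y \<bullet> E z" "\<And>y. E (L y) = y" "\<And>y. L (E y) = y"
proof -
  obtain f :: "'a \<Rightarrow> 'a" where f: "\<And>i j. i \<in> Basis \<Longrightarrow> j \<in> Basis \<Longrightarrow> g (f i) (f j) = (if i = j then 1 else 0)"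
    using orthonormal_family[OF g finite_Basis subset_refl] by blast
  define L where "L y = (\<Sum>i\<in>Basis. (y \<bullet> i) *\<^sub>R f i)" for y
  have L: "linear L" unfolding L_def
    by (intro linearI) (simp_all add: inner_simps scaleR_left_distrib sum.distrib scaleR_sum_right)
  have gL: "g (L y) (L z) = y \<bullet> z" for y z
  proof -
    have l: "linear (\<lambda>x. g x y)" "linear (\<lambda>x. g y x)" for y using g(1) by (auto simp: bilinear_def)
    have "g (L y) (L z) = (\<Sum>i\<in>Basis. (y \<bullet> i) * (\<Sum>j\<in>Basis. (z \<bullet> j) * g (f i) (f j)))"
      unfolding L_def
      by (simp only: linear_sum[OF l(1)] linear_scale[OF l(1)]) (simp add: linear_sum[OF l(2)] linear_scale[OF l(2)])
    also have "\<dots> = (\<Sum>i\<in>Basis. (y \<bullet> i) * (\<Sum>j\<in>Basis. if i = j then z \<bullet> j else 0))"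
      using f by (intro sum.cong refl arg_cong2[where f = times]) auto
    also have "\<dots> = (\<Sum>i\<in>Basis. (y \<bullet> i) * (z \<bullet> i))" by (intro sum.cong) auto
    finally show ?thesis by (simp add: euclidean_inner[of y z])
  qed
  have "inj L"
    unfolding linear_injective_0[OF L] using gL bilinear_lzero[OF g(1)] by (metis inner_eq_zero_iff)
  then obtain E where E: "linear E" "\<And>y. E (L y) = y" "\<And>y. L (E y) = y"
    using linear_injective_isomorphism[OF L] by blast
  have "g y z = E y \<bullet> E z" for y z using gL[of "E y" "E z"] E(3) by simp
  then show thesis using that E L by blast
qed

context proj_pair
begin

lemma curv_constant:
  assumes "x0 \<in> W"
  obtains r where "r > 0" "ball x0 r \<subseteq> W" "\<And>x. x \<in> ball x0 r \<Longrightarrow> curv x = curv x0"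
proof -
  obtain r where r: "r > 0" "ball x0 r \<subseteq> W" using W assms openE by blast
  have "curv x = curv x0" if x: "x \<in> ball x0 r" for x
  proof (rule has_derivative_zero_unique[of "ball x0 r"])
    show "(curv has_derivative (\<lambda>h. 0)) (at u within ball x0 r)" if "u \<in> ball x0 r" for u
      using smooth_on_has_derivative[OF smooth_curv, of u] dd_curv[of u] r that
      by (auto simp: has_derivative_at_withinI ext[of "dd curv u" "\<lambda>h. 0"] subset_iff)
  qed (use x r in auto)
  then show thesis using that r by blast
qed

text \<open>
  In the notation of the proof, \<open>U / el\<close> are coordinates in which \<open>g\<close> is the projective (Klein)
  model of the space of curvature \<open>\<mu>\<close>; passing to the conformal model gives \<open>zf\<close>.
\<close>

lemma normal_coordinates:
  assumes x0: "x0 \<in> W"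
  obtains S and zf gf :: "'a \<Rightarrow> 'a" and r lam :: real and e :: 'a where
    "open S" "x0 \<in> S" "S \<subseteq> W" "r > 0" "smooth_on S zf" "smooth_on (ball 0 r) gf"
    "\<And>x. x \<in> S \<Longrightarrow> zf x \<in> ball 0 r \<and> gf (zf x) = x"
    "\<And>z. z \<in> ball 0 r \<Longrightarrow> gf z \<in> S \<and> zf (gf z) = z"
    "\<And>x. x \<in> S \<Longrightarrow> curv x = curv x0 \<and> 1 + curv x0 * (norm (zf x))\<^sup>2 > 0"
    "\<And>x Y. x \<in> S \<Longrightarrow> g x Y Y = 4 * (norm (dd zf x Y))\<^sup>2 / (1 + curv x0 * (norm (zf x))\<^sup>2)\<^sup>2"
    "\<And>x Y. x \<in> S \<Longrightarrow> \<rho> x Y = 4 / (1 + curv x0 * (norm (zf x))\<^sup>2)\<^sup>2 *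
       (- 2 * (lam + curv x0 * (e \<bullet> zf x)) * (zf x \<bullet> dd zf x Y)
        + (1 + curv x0 * (norm (zf x))\<^sup>2) * (e \<bullet> dd zf x Y))"
proof -
  define \<mu> where "\<mu> = curv x0"
  obtain r0 where r0: "r0 > 0" "ball x0 r0 \<subseteq> W" "\<And>x. x \<in> ball x0 r0 \<Longrightarrow> curv x = \<mu>"
    using curv_constant[OF x0] unfolding \<mu>_def by metis
  obtain E L :: "'a \<Rightarrow> 'a" where EL: "linear E" "linear L" "\<And>y z. g x0 y z = E y \<bullet> E z" "\<And>y. E (L y) = y" "\<And>y. L (E y) = y"
    using inner_product_isometry[OF bil[OF x0] sym[OF x0] pos[OF x0]] by metis
  have th: "linear (\<theta> x0)" using lin(1)[OF x0] .
  \<comment> \<open>\<open>el\<close>, \<open>q\<close> and \<open>w\<close> are the quantities 1 -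
    \<theta> x X, w^2 and w of \<open>line_formulas\<close> for the segment from \<open>x0\<close>
    to x, and \<open>U\<close> is the displacement in an orthonormal frame at
    \<open>x0\<close>.\<close>
  define el where "el x = 1 - \<theta> x0 (x - x0)" for x
  define U where "U x = E (x - x0)" for x
  define q where "q x = (el x)\<^sup>2 + \<mu> * (U x \<bullet> U x)" for x
  define w where "w x = sqrt (q x)" for x
  \<comment> \<open>From the Klein model to the conformal one: u = U / el goes to u / (1 + sqrt (1 +
    \<mu> |u|^2)), and the fraction is expanded by el.\<close>
  define zf where "zf x = (1 / (w x + el x)) *\<^sub>R U x" for x
  \<comment> \<open>Put s = w + el and z = zf x. Then U = s z, el = 1 - s \<theta>(L z) and 1 -
    \<mu> |z|^2 = 2 el / s; eliminating el yields 2 / s = d z, hence the inverse map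
    \<open>gf\<close>.\<close>
  define d where "d z = 1 - \<mu> * (z \<bullet> z) + 2 * \<theta> x0 (L z)" for z
  define gf where "gf z = x0 + (2 / d z) *\<^sub>R L z" for z
  define S0 where "S0 = {x \<in> ball x0 r0. el x > 0 \<and> q x > 0}"
  \<comment> \<open>In terms of x the three inequalities say that el, w and w + el are
    positive.\<close>
  define Z0 where "Z0 = {z. 1 - \<mu> * (z \<bullet> z) > 0 \<and> 1 + \<mu> * (z \<bullet> z) > 0 \<and> d z > 0}"
  have bl: "bounded_linear E" "bounded_linear L" "bounded_linear (\<theta> x0)"
    using EL th linear_conv_bounded_linear by blast+
  have sm_diff: "smooth_on UNIV (\<lambda>x. x - x0)"
    by (intro smooth_on_diff smooth_on_ident smooth_on_const open_UNIV)
  have sm_U: "smooth_on UNIV U" unfolding U_def by (rule smooth_on_bounded_linear[OF open_UNIV bl(1) sm_diff])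
  have sm_l: "smooth_on UNIV el" unfolding el_def
    by (intro smooth_on_diff smooth_on_const open_UNIV smooth_on_bounded_linear[OF open_UNIV bl(3) sm_diff])
  have sm_q: "smooth_on UNIV q" unfolding q_def power2_eq_square
    by (intro smooth_on_add smooth_on_mult smooth_on_inner smooth_on_const sm_U sm_l open_UNIV)
  have sm_L: "smooth_on UNIV L" by (rule smooth_on_bounded_linear[OF open_UNIV bl(2) smooth_on_ident[OF open_UNIV]])
  have sm_d: "smooth_on UNIV d" unfolding d_def
    by (intro smooth_on_add smooth_on_diff smooth_on_mult smooth_on_inner smooth_on_const smooth_on_ident open_UNIV
        smooth_on_bounded_linear[OF open_UNIV bl(3) sm_L])
  have oS0: "open S0"
  proof -
    have "S0 = ball x0 r0 \<inter> {x. el x > 0} \<inter> {x. q x > 0}" by (auto simp: S0_def)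
    then show ?thesis
      by (auto intro!: open_Int open_Collect_less continuous_intros smooth_on_continuous[OF sm_l]
          smooth_on_continuous[OF sm_q])
  qed
  have oZ0: "open Z0" unfolding Z0_def
    by (intro open_Collect_conj open_Collect_less continuous_intros smooth_on_continuous[OF sm_d])
  have sm_w: "smooth_on S0 w" unfolding w_def
    by (rule smooth_on_sqrt[OF oS0 _ smooth_on_subset[OF sm_q subset_UNIV]]) (simp add: S0_def)
  have s_pos: "w x + el x > 0" "w x > 0" "(w x)\<^sup>2 = q x" if "x \<in> S0" for x
    using that by (auto simp: S0_def w_def add_pos_pos)
  have sm_s: "smooth_on S0 (\<lambda>x. w x + el x)"
    by (intro smooth_on_add oS0 sm_w smooth_on_subset[OF sm_l subset_UNIV])
  have sm_zf: "smooth_on S0 zf" unfolding zf_def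
    using s_pos(1) by (intro smooth_on_scaleR smooth_on_divide smooth_on_const oS0 sm_s smooth_on_subset[OF sm_U subset_UNIV]) force
  have sm_gf: "smooth_on Z0 gf" unfolding gf_def
    by (intro smooth_on_add smooth_on_scaleR smooth_on_divide smooth_on_const oZ0 smooth_on_subset[OF sm_d subset_UNIV]
        smooth_on_subset[OF sm_L subset_UNIV]) (auto simp: Z0_def)
  have mu_u: "\<mu> * (U x \<bullet> U x) = (w x - el x) * (w x + el x)" if "x \<in> S0" for x
    using s_pos(3)[OF that] by (simp add: q_def power2_eq_square algebra_simps)
  have z_norm: "\<mu> * (zf x \<bullet> zf x) = (w x - el x) / (w x + el x)" if "x \<in> S0" for x
  proof -
    have "\<mu> * (zf x \<bullet> zf x) = \<mu> * (U x \<bullet> U x) / ((w x + el x) * (w x + el x))"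
      by (simp add: zf_def)
    then show ?thesis using mu_u[OF that] s_pos(1)[OF that] by simp
  qed
  have inv1: "zf (gf z) = z" "el (gf z) > 0" "q (gf z) > 0" if z: "z \<in> Z0" for z
  proof -
    have dz: "d z > 0" "1 + \<mu> * (z \<bullet> z) > 0" "1 - \<mu> * (z \<bullet> z) > 0" using z by (auto simp: Z0_def)
    have Uz: "U (gf z) = (2 / d z) *\<^sub>R z"
      by (simp add: U_def gf_def linear_scale[OF EL(1)] EL(4))
    have lz: "el (gf z) = (1 - \<mu> * (z \<bullet> z)) / d z"
      using dz(1) by (simp add: el_def gf_def linear_scale[OF th] field_simps) (simp add: d_def)
    have "q (gf z) = ((1 + \<mu> * (z \<bullet> z)) / d z)\<^sup>2"
      unfolding q_def Uz lz using dz(1) by (simp add: power2_eq_square field_simps)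
    moreover from this have wz: "w (gf z) = (1 + \<mu> * (z \<bullet> z)) / d z"
      using dz unfolding w_def by simp
    ultimately show "q (gf z) > 0" "el (gf z) > 0" using dz lz by simp_all
    have "w (gf z) + el (gf z) = 2 / d z" unfolding wz lz using dz(1) by (simp add: field_simps)
    then show "zf (gf z) = z" using dz(1) by (simp add: zf_def Uz)
  qed
  have inv2: "gf (zf x) = x" "zf x \<in> Z0" if x: "x \<in> S0" for x
  proof -
    let ?s = "w x + el x"
    have s: "?s > 0" "el x > 0" "w x > 0" using s_pos[OF x] x by (auto simp: S0_def)
    have Lz: "L (zf x) = (1 / ?s) *\<^sub>R (x - x0)"
      by (simp add: zf_def U_def linear_scale[OF EL(2)] EL(5))
    have one: "?s / ?s = 1" using s(1) by simp
    have dz: "d (zf x) = 2 / ?s"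
    proof -
      have "d (zf x) = (?s - (w x - el x) + 2 * \<theta> x0 (x - x0)) / ?s"
        unfolding d_def z_norm[OF x] Lz linear_scale[OF th]
        by (simp only: add_divide_distrib[of "?s - (w x - el x)"] diff_divide_distrib[of ?s] one) simp
      then show ?thesis by (simp add: el_def)
    qed
    show "gf (zf x) = x" unfolding gf_def dz Lz using s(1) by simp
    have "1 - (w x - el x) / ?s = 2 * el x / ?s" "1 + (w x - el x) / ?s = 2 * w x / ?s"
      using s(1) by (simp_all add: field_simps)
    then show "zf x \<in> Z0" unfolding Z0_def using z_norm[OF x] dz s by simp
  qed
  have x0S: "x0 \<in> S0" using r0(1) by (simp add: S0_def el_def q_def U_def linear_0[OF th] linear_0[OF EL(1)])
  have z0: "0 \<in> Z0" by (simp add: Z0_def d_def linear_0[OF th] linear_0[OF EL(2)])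
  have "open {z \<in> Z0. gf z \<in> ball x0 r0}"
  proof -
    have "{z \<in> Z0. gf z \<in> ball x0 r0} = gf -` ball x0 r0 \<inter> Z0" by auto
    then show ?thesis
      using continuous_on_open_vimage[OF oZ0, of gf] smooth_on_continuous[OF sm_gf] open_ball by metis
  qed
  moreover have gf0: "gf 0 = x0" by (simp add: gf_def linear_0[OF EL(2)])
  then have "0 \<in> {z \<in> Z0. gf z \<in> ball x0 r0}" using z0 r0(1) by simp
  \<comment> \<open>Taking a ball as coordinate range will make the domain of the new chart
    connected.\<close>
  ultimately obtain r where r: "r > 0" "ball 0 r \<subseteq> {z \<in> Z0. gf z \<in> ball x0 r0}" using openE by blast
  define S where "S = {x \<in> S0. zf x \<in> ball 0 r}"
  have "S = zf -` ball 0 r \<inter> S0" by (auto simp: S_def)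
  then have oS: "open S"
    using continuous_on_open_vimage[OF oS0, of zf] smooth_on_continuous[OF sm_zf] open_ball by metis
  have gfS: "gf z \<in> S \<and> zf (gf z) = z" if "z \<in> ball 0 r" for z
    using inv1[of z] that r(2) by (auto simp: S_def S0_def)
  \<comment> \<open>At \<open>x0\<close> one has zf = 0, w = el = 1 and dd zf = E / 2, so the normal
    form reduces to 2 (e \<bullet> E Y), which fixes e. The factor c belonging to the normal form is
    -2 lam at the origin, which fixes lam.\<close>
  define lam where "lam = - c x0 / 2"
  obtain e where e: "\<And>Y. \<rho> x0 Y = 2 * (e \<bullet> E Y)"
  proof -
    have l: "linear (\<lambda>y. \<rho> x0 (L y))" using linear_compose[OF EL(2) lin(2)[OF x0]] by (simp add: o_def)
    define e where "e = (\<Sum>b\<in>Basis. (\<rho> x0 (L b) / 2) *\<^sub>R b)"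
    have "\<rho> x0 (L y) = 2 * (e \<bullet> y)" for y
    proof -
      have "\<rho> x0 (L y) = \<rho> x0 (L (\<Sum>b\<in>Basis. (y \<bullet> b) *\<^sub>R b))" by (simp add: euclidean_representation)
      also have "\<dots> = (\<Sum>b\<in>Basis. (y \<bullet> b) * \<rho> x0 (L b))" by (simp add: linear_sum[OF l] linear_scale[OF l])
      finally show ?thesis by (simp add: e_def inner_sum_left sum_distrib_left inner_commute[of y] mult.commute)
    qed
    from this[of "E Y" for Y] show thesis using that[of e] EL(5) by simp
  qed
  have forms: "curv x = \<mu> \<and> 1 + \<mu> * (norm (zf x))\<^sup>2 > 0 \<and>
    g x Y Y = 4 * (norm (dd zf x Y))\<^sup>2 / (1 + \<mu> * (norm (zf x))\<^sup>2)\<^sup>2 \<and>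
    \<rho> x Y = 4 / (1 + \<mu> * (norm (zf x))\<^sup>2)\<^sup>2 *
       (- 2 * (lam + \<mu> * (e \<bullet> zf x)) * (zf x \<bullet> dd zf x Y)
        + (1 + \<mu> * (norm (zf x))\<^sup>2) * (e \<bullet> dd zf x Y))" if x: "x \<in> S" for x Y
  proof -
    have xS: "x \<in> S0" and xb: "x \<in> ball x0 r0" using x by (auto simp: S_def S0_def)
    define X where "X = x - x0"
    define s where "s = w x + el x"
    define t where "t = \<theta> x0 Y"
    define V where "V = E Y"
    define m where "m = U x \<bullet> V"
    define p where "p = \<mu> * m / s"
    have s: "s > 0" "w x > 0" using s_pos[OF xS] by (auto simp: s_def)
    have ps: "p * s = \<mu> * m" using s by (simp add: p_def)
    have seg: "x0 + u *\<^sub>R X \<in> ball x0 r0" if "u \<in> {0..1}" for u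
    proof -
      have "norm (u *\<^sub>R X) \<le> norm X" using that by (simp add: mult_left_le_one_le)
      then show ?thesis using xb by (simp add: X_def dist_norm norm_minus_commute)
    qed
    obtain w' where w': "w' > 0" "w'\<^sup>2 = q x"
      and fg: "\<And>Y. w' ^ 4 * g x Y Y = (el x)\<^sup>2 * g x0 Y Y + 2 * el x * \<theta> x0 Y * g x0 X Y + (\<theta> x0 Y)\<^sup>2 * g x0 X X
        + \<mu> * (g x0 X X * g x0 Y Y - (g x0 X Y)\<^sup>2)"
      and fr: "\<And>Y. w' ^ 3 * \<rho> x Y = el x * (el x * \<rho> x0 Y + \<theta> x0 Y * \<rho> x0 X)
        + c x0 * (el x * g x0 X Y + \<theta> x0 Y * g x0 X X) + \<mu> * (g x0 X X * \<rho> x0 Y - g x0 X Y * \<rho> x0 X)"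
      using line_formulas[of x0 X \<mu>] seg r0(2,3) by (auto simp: X_def el_def q_def U_def EL(3) subset_iff)
    have "w' = w x" using w' by (metis w_def real_sqrt_abs abs_of_pos)
    note fg = fg[unfolded this] and fr = fr[unfolded this]
    have pu: "p * (U x \<bullet> U x) = m * (w x - el x)"
    proof -
      have "s * (p * (U x \<bullet> U x)) = s * (m * (w x - el x))"
        using mu_u[OF xS] ps unfolding s_def by algebra
      then show ?thesis using s(1) by simp
    qed
    have wl: "\<mu> * (U x \<bullet> U x) = (w x - el x) * s" using mu_u[OF xS] by (simp add: s_def)
    have N: "1 + \<mu> * (norm (zf x))\<^sup>2 = 2 * w x / s"
      using z_norm[OF xS] s(1) by (simp add: power2_norm_eq_inner s_def field_simps)
    \<comment> \<open>This is the logarithmic derivative of s = w + el in the direction Y, the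
      coefficient of U when U / s is differentiated.\<close>
    define k where "k = (p - t) / w x"
    have kw: "k * w x = p - t" using s by (simp add: k_def)
    have D: "dd zf x Y = (1 / s) *\<^sub>R (V - k *\<^sub>R U x)"
    proof -
      have U': "(U has_derivative E) (at x)" unfolding U_def
        by (rule bounded_linear.has_derivative[OF bl(1), THEN has_derivative_eq_rhs]) (auto intro!: derivative_eq_intros)
      have l': "(el has_derivative (\<lambda>Y. - \<theta> x0 Y)) (at x)" unfolding el_def
        by (auto intro!: derivative_eq_intros bounded_linear.has_derivative[OF bl(3)])
      have q': "(q has_derivative (\<lambda>Y. 2 * (\<mu> * (U x \<bullet> E Y) - el x * \<theta> x0 Y))) (at x)" unfolding q_def
        by (auto intro!: derivative_eq_intros U' l' simp: inner_commute algebra_simps)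
      have qp: "q x > 0" using xS by (simp add: S0_def)
      have "(w has_derivative (\<lambda>Y. (\<mu> * (U x \<bullet> E Y) - el x * \<theta> x0 Y) / w x)) (at x)" unfolding w_def
        using qp by (auto intro!: derivative_eq_intros q' simp: field_simps)
      then have "(zf has_derivative (\<lambda>Y. (1 / s) *\<^sub>R E Y
         - (1 / s * ((\<mu> * (U x \<bullet> E Y) - el x * \<theta> x0 Y) / w x - \<theta> x0 Y) * (1 / s)) *\<^sub>R U x)) (at x)" unfolding zf_def
        using s(1) by (auto intro!: derivative_eq_intros U' l' simp: s_def fun_eq_iff divide_inverse)
      then have "dd zf x Y = (1 / s) *\<^sub>R V - (1 / s * ((\<mu> * m - el x * t) / w x - t) * (1 / s)) *\<^sub>R U x"
        by (simp add: dd_eq V_def m_def t_def)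
      moreover have "1 / s * ((\<mu> * m - el x * t) / w x - t) * (1 / s) = k / s"
      proof -
        have "(\<mu> * m - el x * t) / w x - t = k * s"
          unfolding ps[symmetric] k_def using s(2) by (simp add: s_def field_simps)
        then show ?thesis using s(1) by simp
      qed
      ultimately show ?thesis by (simp add: algebra_simps)
    qed
    have "(w x) ^ 4 * g x Y Y = (w x)\<^sup>2 * ((V - k *\<^sub>R U x) \<bullet> (V - k *\<^sub>R U x))"
    proof -
      have "(w x)\<^sup>2 * ((V - k *\<^sub>R U x) \<bullet> (V - k *\<^sub>R U x))
        = (w x)\<^sup>2 * (V \<bullet> V) - 2 * w x * m * (k * w x) + (k * w x) * (k * w x) * (U x \<bullet> U x)"
        by (simp add: inner_simps m_def inner_commute power2_eq_square algebra_simps)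
      also have "\<dots> = (el x)\<^sup>2 * (V \<bullet> V) + 2 * el x * t * m + t\<^sup>2 * (U x \<bullet> U x)
        + \<mu> * ((U x \<bullet> U x) * (V \<bullet> V) - m\<^sup>2)"
        using pu ps wl unfolding kw s_def by algebra
      finally show ?thesis using fg[of Y] by (simp add: EL(3) V_def U_def X_def t_def m_def)
    qed
    then have "g x Y Y = ((V - k *\<^sub>R U x) \<bullet> (V - k *\<^sub>R U x)) / (w x)\<^sup>2"
      using s(2) by (simp add: field_simps eval_nat_numeral)
    also have "\<dots> = 4 * (norm (dd zf x Y))\<^sup>2 / (1 + \<mu> * (norm (zf x))\<^sup>2)\<^sup>2"
    proof -
      have "(norm (dd zf x Y))\<^sup>2 = ((V - k *\<^sub>R U x) \<bullet> (V - k *\<^sub>R U x)) / (s * s)"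
        unfolding D power2_norm_eq_inner inner_scaleR_left inner_scaleR_right by simp
      then show ?thesis unfolding N using s by (simp add: field_simps power2_eq_square)
    qed
    finally have 1: "g x Y Y = 4 * (norm (dd zf x Y))\<^sup>2 / (1 + \<mu> * (norm (zf x))\<^sup>2)\<^sup>2" .
    have "(w x) ^ 3 * \<rho> x Y = w x * (- 2 * (lam * s + \<mu> * (e \<bullet> U x)) / s * (m - k * (U x \<bullet> U x)) + 2 * w x * (e \<bullet> V - k * (e \<bullet> U x)))"
    proof -
      define K where "K = \<mu> / s"
      have K: "K * m = p" "K * (U x \<bullet> U x) = w x - el x" "K * s = \<mu>"
        using wl s(1) by (simp_all add: K_def p_def)
      have "w x * (- 2 * (lam * s + \<mu> * (e \<bullet> U x)) / s * (m - k * (U x \<bullet> U x)) + 2 * w x * (e \<bullet> V - k * (e \<bullet> U x)))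
        = - 2 * (lam + K * (e \<bullet> U x)) * (w x * m - (k * w x) * (U x \<bullet> U x)) + 2 * w x * (w x * (e \<bullet> V) - (k * w x) * (e \<bullet> U x))"
        using s(1) by (simp add: K_def field_simps)
      also have "\<dots> = el x * (el x * (2 * (e \<bullet> V)) + t * (2 * (e \<bullet> U x))) + (- 2 * lam) * (el x * m + t * (U x \<bullet> U x))
          + \<mu> * ((U x \<bullet> U x) * (2 * (e \<bullet> V)) - m * (2 * (e \<bullet> U x)))"
        using pu ps wl K unfolding kw s_def by algebra
      finally show ?thesis using fr[of Y] by (simp add: EL(3) e V_def U_def X_def t_def m_def lam_def)
    qed
    moreover have "r = A / (w x)\<^sup>2" if "(w x) ^ 3 * r = w x * A" for r A
    proof -
      have "w x * ((w x)\<^sup>2 * r) = w x * A" using that by (simp add: power2_eq_square power3_eq_cube mult.assoc)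
      then show ?thesis using s(2) by (simp add: eq_divide_eq mult.commute)
    qed
    ultimately have "\<rho> x Y = (- 2 * (lam * s + \<mu> * (e \<bullet> U x)) / s * (m - k * (U x \<bullet> U x)) + 2 * w x * (e \<bullet> V - k * (e \<bullet> U x))) / (w x)\<^sup>2"
      by blast
    also have "\<dots> = 4 / (1 + \<mu> * (norm (zf x))\<^sup>2)\<^sup>2 *
       (- 2 * (lam + \<mu> * (e \<bullet> zf x)) * (zf x \<bullet> dd zf x Y)
        + (1 + \<mu> * (norm (zf x))\<^sup>2) * (e \<bullet> dd zf x Y))"
    proof -
      have zi: "e \<bullet> zf x = (e \<bullet> U x) / s" "zf x \<bullet> dd zf x Y = (m - k * (U x \<bullet> U x)) / (s * s)"
        "e \<bullet> dd zf x Y = (e \<bullet> V - k * (e \<bullet> U x)) / s"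
        unfolding D by (simp_all add: zf_def s_def inner_simps m_def diff_divide_distrib)
      show ?thesis unfolding zi N using s by (simp add: field_simps power2_eq_square)
    qed
    finally show ?thesis using 1 N s r0(3)[OF xb] by simp
  qed
  show thesis
  proof (rule that[of S r zf gf lam e])
    show "smooth_on (ball 0 r) gf" using smooth_on_subset[OF sm_gf] r(2) by blast
    show "smooth_on S zf" by (rule smooth_on_subset[OF sm_zf]) (auto simp: S_def)
    show "S \<subseteq> W" using r0(2) by (auto simp: S_def S0_def)
    show "x0 \<in> S" using gfS[of 0] r(1) gf0 by simp
  qed (use oS r(1) gfS inv2 forms in \<open>auto simp: S_def \<mu>_def[symmetric]\<close>)
qed

end

section \<open>Charts\<close>

text \<open>The position on the line is not given as a differentiable function of time. Testing with
  vectors u orthogonal to the line avoids this: u \<bullet> \<gamma> is constant, so velocity and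
  acceleration are both parallel to the line, and the velocity is nonzero.\<close>

lemma straight_geodesics_spray:
  assumes st: "straight_geodesics F W" and x: "x \<in> W" and y: "y \<noteq> 0"
  shows "\<exists>P. spray F x y = P *\<^sub>R y"
proof -
  obtain \<epsilon> \<gamma> \<gamma>' where \<epsilon>: "\<epsilon> > 0" and geo: "geodesic F W {-\<epsilon><..<\<epsilon>} \<gamma> \<gamma>'" and 0: "\<gamma> 0 = x" "\<gamma>' 0 = y"
    using st x y unfolding straight_geodesics_def by metis
  obtain q v where line: "\<And>t. t \<in> {-\<epsilon><..<\<epsilon>} \<Longrightarrow> \<exists>s. \<gamma> t = q + s *\<^sub>R v"
    using st geo unfolding straight_geodesics_def by blast
  let ?I = "{-\<epsilon><..<\<epsilon>}"
  have I: "open ?I" "0 \<in> ?I" using \<epsilon> by auto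
  have const: "v' = 0" if "\<And>t. t \<in> ?I \<Longrightarrow> f t = k" "t \<in> ?I" "(f has_real_derivative v') (at t)" for f k v' t
  proof -
    have "((\<lambda>_. k) has_real_derivative v') (at t)"
      by (rule has_field_derivative_transform_within_open[OF that(3) I(1) that(2) that(1)])
    then show ?thesis using DERIV_unique DERIV_const by blast
  qed
  have inner': "((\<lambda>t. u \<bullet> f t) has_real_derivative u \<bullet> f') (at t)" if "(f has_vector_derivative f') (at t)"
    for u :: "real^'a" and f f' t
    using bounded_linear.has_vector_derivative[OF bounded_linear_inner_right that]
    by (simp add: has_real_derivative_iff_has_vector_derivative)
  have orth: "u \<bullet> y = 0 \<and> u \<bullet> spray F x y = 0" if u: "u \<bullet> v = 0" for u
  proof -
    have 1: "u \<bullet> \<gamma> t = u \<bullet> q" if "t \<in> ?I" for t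
      using line[OF that] u by (auto simp: inner_simps)
    have 2: "u \<bullet> \<gamma>' t = 0" if t: "t \<in> ?I" for t
    proof (rule const[OF 1 t])
      show "((\<lambda>t. u \<bullet> \<gamma> t) has_real_derivative u \<bullet> \<gamma>' t) (at t)"
        using geo t unfolding geodesic_def by (intro inner') auto
    qed
    have "u \<bullet> ((- 2) *\<^sub>R spray F (\<gamma> 0) (\<gamma>' 0)) = 0"
    proof (rule const[OF 2 I(2)])
      show "((\<lambda>t. u \<bullet> \<gamma>' t) has_real_derivative u \<bullet> ((- 2) *\<^sub>R spray F (\<gamma> 0) (\<gamma>' 0))) (at 0)"
        using geo I(2) unfolding geodesic_def by (intro inner') auto
    qed
    then show ?thesis using 2[OF I(2)] 0 by simp
  qed
  have par: "z = ((z \<bullet> v) / (v \<bullet> v)) *\<^sub>R v" if "\<And>u. u \<bullet> v = 0 \<Longrightarrow> u \<bullet> z = 0" for z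
  proof -
    define u where "u = z - ((z \<bullet> v) / (v \<bullet> v)) *\<^sub>R v"
    have uv: "u \<bullet> v = 0" by (cases "v = 0") (simp_all add: u_def inner_simps)
    then have "u \<bullet> u = 0" using that[OF uv] by (simp add: u_def inner_simps)
    then show ?thesis by (simp add: u_def)
  qed
  obtain ky ks where k: "y = ky *\<^sub>R v" "spray F x y = ks *\<^sub>R v"
    using par[of y] par[of "spray F x y"] orth by blast
  then have "spray F x y = (ks / ky) *\<^sub>R y" using y by auto
  then show ?thesis ..
qed

lemma chart_inv:
  assumes "is_chart C" "p \<in> fst C"
  shows "inv_into (fst C) (snd C) (snd C p) = p"
  using assms unfolding is_chart_def homeomorphism_def by auto

lemma chart_inv_mem:
  assumes "x \<in> crange C"
  shows "inv_into (fst C) (snd C) x \<in> fst C" "snd C (inv_into (fst C) (snd C) x) = x"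
  using assms by (auto intro: inv_into_into f_inv_into_f)

lemma chart_open_image:
  assumes "is_chart C" "open U" "U \<subseteq> fst C"
  shows "open (snd C ` U)"
proof -
  have hom: "homeomorphism (fst C) (crange C) (snd C) (inv_into (fst C) (snd C))" and o: "open (crange C)"
    using assms(1) by (auto simp: is_chart_def)
  have "openin (top_of_set (fst C)) U" using assms(2,3) by (simp add: open_subset)
  then have "openin (top_of_set (crange C)) (snd C ` U)" by (rule homeomorphism_imp_open_map[OF hom])
  then show ?thesis using o by (simp add: openin_open_eq)
qed

section \<open>Coordinate changes and reparametrized charts\<close>

locale smooth_mfd =
  fixes A :: "('m::{t2_space, second_countable_topology}, 'n::finite) chart set"
  assumes smooth_structure: "smooth_structure A"
begin

lemma is_chart: "C \<in> A \<Longrightarrow> is_chart C"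
  and compat: "C \<in> A \<Longrightarrow> D \<in> A \<Longrightarrow> compatible C D"
  and maximal: "is_chart C \<Longrightarrow> (\<And>D. D \<in> A \<Longrightarrow> compatible C D) \<Longrightarrow> C \<in> A"
  using smooth_structure unfolding smooth_structure_def by blast+

lemma open_crange: "C \<in> A \<Longrightarrow> open (crange C)"
  and open_dom: "C \<in> A \<Longrightarrow> open (fst C)"
  using is_chart unfolding is_chart_def by auto

lemma open_overlap: "C \<in> A \<Longrightarrow> D \<in> A \<Longrightarrow> open (snd C ` (fst C \<inter> fst D))"
  by (rule chart_open_image[OF is_chart]) (auto intro: open_dom)

lemma inv_chart: "C \<in> A \<Longrightarrow> p \<in> fst C \<Longrightarrow> inv_into (fst C) (snd C) (snd C p) = p"
  using chart_inv is_chart by blast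

lemma transition_apply: "C \<in> A \<Longrightarrow> p \<in> fst C \<Longrightarrow> transition C D (snd C p) = snd D p"
  by (simp add: transition_def inv_chart)

lemma smooth_transition: "C \<in> A \<Longrightarrow> D \<in> A \<Longrightarrow> smooth_on (snd C ` (fst C \<inter> fst D)) (transition C D)"
  using compat unfolding compatible_def by blast

lemma deriv_transition:
  assumes "C \<in> A" "D \<in> A" "p \<in> fst C" "p \<in> fst D"
  shows "(transition C D has_derivative dtrans C D p) (at (snd C p))"
  unfolding dtrans_def by (rule smooth_on_has_derivative[OF smooth_transition[OF assms(1,2)]]) (use assms in auto)

lemma dtrans_inverse:
  assumes C: "C \<in> A" and D: "D \<in> A" and p: "p \<in> fst C" "p \<in> fst D"
  shows "dtrans D C p (dtrans C D p y) = y"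
proof -
  have "((\<lambda>x. transition D C (transition C D x)) has_derivative (\<lambda>y. dtrans D C p (dtrans C D p y))) (at (snd C p))"
    by (rule has_derivative_compose[OF deriv_transition[OF C D p]])
       (use deriv_transition[OF D C p(2,1)] transition_apply[OF C p(1)] in simp)
  then have "((\<lambda>x. x) has_derivative (\<lambda>y. dtrans D C p (dtrans C D p y))) (at (snd C p))"
    by (rule has_derivative_transform_within_open[OF _ open_overlap[OF C D]])
       (use p C D in \<open>auto simp: transition_apply\<close>)
  then have "(\<lambda>y. dtrans D C p (dtrans C D p y)) = (\<lambda>y. y)"
    using has_derivative_unique[OF _ has_derivative_ident] by blast
  then show ?thesis by (rule fun_cong)
qed

text \<open>Composing a chart with a diffeomorphism of part of its range stays in the atlas by
  maximality: coordinate changes between D and any other chart factor through those of C.\<close>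

lemma reparametrized_chart:
  fixes zf gf :: "real^'n \<Rightarrow> real^'n"
  assumes C: "C \<in> A" and S: "open S" "S \<subseteq> crange C" and Z: "open Z"
    and sm: "smooth_on S zf" "smooth_on Z gf"
    and zf: "\<And>x. x \<in> S \<Longrightarrow> zf x \<in> Z \<and> gf (zf x) = x" and gf: "\<And>z. z \<in> Z \<Longrightarrow> gf z \<in> S \<and> zf (gf z) = z"
  defines "D \<equiv> ({p \<in> fst C. snd C p \<in> S}, zf \<circ> snd C)"
  shows "D \<in> A" "crange D = Z" "\<And>p. p \<in> fst D \<Longrightarrow> dtrans D C p = dd gf (snd D p)"
    "connected Z \<Longrightarrow> connected (fst D)"
proof -
  let ?i = "inv_into (fst C) (snd C)"
  have hom: "homeomorphism (fst C) (crange C) (snd C) ?i" using is_chart[OF C] by (simp add: is_chart_def)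
  have contC: "continuous_on (fst C) (snd C)" "continuous_on (crange C) ?i" using hom by (auto simp: homeomorphism_def)
  have fD: "p \<in> fst D \<longleftrightarrow> p \<in> fst C \<and> snd C p \<in> S" for p by (simp add: D_def)
  have sD: "snd D p = zf (snd C p)" for p by (simp add: D_def)
  have "fst D = snd C -` S \<inter> fst C" by (auto simp: D_def)
  then have oD: "open (fst D)"
    using continuous_on_open_vimage[OF open_dom[OF C], of "snd C"] contC(1) S(1) by simp
  have iS: "?i x \<in> fst C" "snd C (?i x) = x" if "x \<in> S" for x
    using chart_inv_mem[of x C] S(2) that by auto
  show crD: "crange D = Z"
  proof (intro equalityI subsetI)
    fix z assume "z \<in> Z"
    then have "z = snd D (?i (gf z))" "?i (gf z) \<in> fst D" using gf iS by (auto simp: fD sD)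
    then show "z \<in> crange D" by blast
  qed (use zf in \<open>auto simp: fD sD\<close>)
  have injD: "inj_on (snd D) (fst D)"
    by (rule inj_onI) (metis fD sD zf inv_chart[OF C])
  have inv: "inv_into (fst D) (snd D) z = ?i (gf z)" if "z \<in> Z" for z
  proof -
    have "snd D (?i (gf z)) = z" "?i (gf z) \<in> fst D" using gf[OF that] iS by (auto simp: fD sD)
    then show ?thesis using inv_into_f_f[OF injD] by metis
  qed
  have chD: "is_chart D"
    unfolding is_chart_def crD
  proof (intro conjI oD Z)
    show "homeomorphism (fst D) Z (snd D) (inv_into (fst D) (snd D))"
      unfolding homeomorphism_def
    proof (intro conjI ballI)
      show "inv_into (fst D) (snd D) (snd D p) = p" if "p \<in> fst D" for p by (rule inv_into_f_f[OF injD that])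
      show "snd D ` fst D = Z" by (rule crD)
      show "snd D (inv_into (fst D) (snd D) z) = z" if "z \<in> Z" for z
        using that crD by (metis f_inv_into_f)
      show "inv_into (fst D) (snd D) ` Z = fst D"
        using inv_into_image_cancel[OF injD subset_refl] crD by metis
      show "continuous_on (fst D) (snd D)"
        unfolding D_def snd_conv fst_conv
        by (rule continuous_on_compose) (auto intro: continuous_on_subset[OF contC(1)] continuous_on_subset[OF smooth_on_continuous[OF sm(1)]])
      have "continuous_on Z (?i \<circ> gf)"
        by (rule continuous_on_compose[OF smooth_on_continuous[OF sm(2)] continuous_on_subset[OF contC(2)]])
           (use gf S(2) in auto)
      then show "continuous_on Z (inv_into (fst D) (snd D))"
        by (rule continuous_on_cong[THEN iffD1, rotated -1]) (simp_all add: inv)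
    qed
  qed
  show "connected (fst D)" if "connected Z"
  proof -
    have "continuous_on Z (inv_into (fst D) (snd D))" "inv_into (fst D) (snd D) ` Z = fst D"
      using chD unfolding is_chart_def homeomorphism_def crD by auto
    then show ?thesis using connected_continuous_image that by metis
  qed
  show DA: "D \<in> A"
  proof (rule maximal[OF chD])
    fix E assume E: "E \<in> A"
    have oDE: "open (snd D ` (fst D \<inter> fst E))"
      by (rule chart_open_image[OF chD]) (use oD open_dom[OF E] in auto)
    have oED: "open (snd E ` (fst E \<inter> fst D))"
      by (rule chart_open_image[OF is_chart[OF E]]) (use oD open_dom[OF E] in auto)
    show "compatible D E" unfolding compatible_def
    proof
      have "smooth_on (snd D ` (fst D \<inter> fst E)) (\<lambda>z. transition C E (gf z))"
      proof (rule smooth_on_compose[OF oDE open_overlap[OF C E] _ _ smooth_transition[OF C E]])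
        show "smooth_on (snd D ` (fst D \<inter> fst E)) gf"
          by (rule smooth_on_subset[OF sm(2)]) (use crD in auto)
        show "gf ` snd D ` (fst D \<inter> fst E) \<subseteq> snd C ` (fst C \<inter> fst E)"
          using zf by (auto simp: fD sD)
      qed
      then show "smooth_on (snd D ` (fst D \<inter> fst E)) (transition D E)"
      proof (rule smooth_on_cong[OF oDE, rotated])
        fix z assume "z \<in> snd D ` (fst D \<inter> fst E)"
        then have "z \<in> Z" using crD by auto
        then show "transition D E z = transition C E (gf z)" by (simp add: transition_def inv)
      qed
      have "smooth_on (snd E ` (fst E \<inter> fst D)) (\<lambda>z. zf (transition E C z))"
      proof (rule smooth_on_compose[OF oED S(1) _ _ sm(1)])
        show "smooth_on (snd E ` (fst E \<inter> fst D)) (transition E C)"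
          by (rule smooth_on_subset[OF smooth_transition[OF E C]]) (auto simp: fD)
        show "transition E C ` snd E ` (fst E \<inter> fst D) \<subseteq> S"
          by (auto simp: fD transition_apply[OF E])
      qed
      then show "smooth_on (snd E ` (fst D \<inter> fst E)) (transition E D)"
        by (simp add: transition_def[abs_def] D_def o_def Int_commute)
    qed
  qed
  fix p assume p: "p \<in> fst D"
  then have z: "snd D p \<in> Z" using crD by auto
  have "dd (transition D C) (snd D p) = dd gf (snd D p)"
  proof (rule dd_transform(1)[OF Z z])
    show "transition D C z = gf z" if "z \<in> Z" for z
      using gf[OF that] iS that by (simp add: transition_def inv)
    show "gf differentiable at (snd D p)" by (rule smooth_on_differentiable[OF sm(2) z])
  qed
  then show "dtrans D C p = dd gf (snd D p)" by (simp add: dtrans_def)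
qed

end

lemma locally_constant:
  fixes f :: "'m::topological_space \<Rightarrow> 'b"
  assumes "connected (UNIV :: 'm set)" "\<And>p. \<exists>U. open U \<and> p \<in> U \<and> (\<forall>q\<in>U. f q = f p)"
  shows "f p = f q"
proof (rule connected_local_const[OF assms(1)])
  show "\<forall>a\<in>UNIV. \<forall>\<^sub>F b in at a within UNIV. f a = f b"
    unfolding eventually_at_topological using assms(2) by metis
qed simp_all

text \<open>The map f carries the vector dual to m for M to the vector dual to n for N, and the
  squared conorm is a covector evaluated on its dual vector; f' supplies surjectivity of f.\<close>

lemma conorm2_invariant:
  fixes M N :: "real^'n^'n::finite"
  assumes M: "\<And>y. y \<noteq> 0 \<Longrightarrow> y \<bullet> (M *v y) > 0" and N: "\<And>y. y \<noteq> 0 \<Longrightarrow> y \<bullet> (N *v y) > 0"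
    and TS: "\<And>y. f (f' y) = y" and MN: "\<And>y z. f y \<bullet> (N *v f z) = y \<bullet> (M *v z)" "\<And>y. n \<bullet> f y = m \<bullet> y"
  shows "conorm2 N n = conorm2 M m"
proof -
  define u where "u = matrix_inv M *v m"
  have Mu: "M *v u = m" unfolding u_def using invertible_pos_def[OF M] by (simp add: matrix_vector_mul_assoc matrix_inv_right)
  have "y \<bullet> (N *v f u) = y \<bullet> n" for y
    using MN(1)[of "f' y" u] MN(2)[of "f' y"] by (simp add: TS Mu inner_commute)
  then have "N *v f u = n" using vector_eq_ldot by blast
  then have "matrix_inv N *v n = f u"
    using matrix_inv_left[OF invertible_pos_def[OF N]] by (metis matrix_vector_mul_assoc matrix_vector_mul_lid)
  then show ?thesis using MN(2)[of u] by (simp add: conorm2_def u_def)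
qed

section \<open>Existence of the normal form\<close>

locale randers_mfd = smooth_mfd A
  for A :: "('m::{t2_space, second_countable_topology}, 'n::finite) chart set" +
  fixes F :: "('m, 'n) chart \<Rightarrow> real^'n \<Rightarrow> real^'n \<Rightarrow> real"
    and a :: "('m, 'n) chart \<Rightarrow> real^'n \<Rightarrow> real^'n^'n"
    and b :: "('m, 'n) chart \<Rightarrow> real^'n \<Rightarrow> real^'n"
  assumes randers: "randers_metric A F a b" and nonzero: "nowhere_locally_zero A b"
begin

lemma finsler: "finsler_metric A F" and riem: "riemannian_metric A a" and form: "one_form A b"
  and randers_F: "C \<in> A \<Longrightarrow> x \<in> crange C \<Longrightarrow> F C x y = alpha_norm (a C x) y + b C x \<bullet> y"
  and conorm_less: "C \<in> A \<Longrightarrow> x \<in> crange C \<Longrightarrow> conorm2 (a C x) (b C x) < 1"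
  using randers unfolding randers_metric_def by blast+

lemma smooth_a: "C \<in> A \<Longrightarrow> smooth_on (crange C) (a C)"
  and sym_a: "C \<in> A \<Longrightarrow> x \<in> crange C \<Longrightarrow> transpose (a C x) = a C x"
  and pos_a: "C \<in> A \<Longrightarrow> x \<in> crange C \<Longrightarrow> y \<noteq> 0 \<Longrightarrow> y \<bullet> (a C x *v y) > 0"
  and trans_a: "C \<in> A \<Longrightarrow> D \<in> A \<Longrightarrow> p \<in> fst C \<Longrightarrow> p \<in> fst D \<Longrightarrow>
    dtrans C D p y \<bullet> (a D (snd D p) *v dtrans C D p z) = y \<bullet> (a C (snd C p) *v z)"
  using riem unfolding riemannian_metric_def by blast+

lemma smooth_b: "C \<in> A \<Longrightarrow> smooth_on (crange C) (b C)"
  and trans_b: "C \<in> A \<Longrightarrow> D \<in> A \<Longrightarrow> p \<in> fst C \<Longrightarrow> p \<in> fst D \<Longrightarrow>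
    b D (snd D p) \<bullet> dtrans C D p y = b C (snd C p) \<bullet> y"
  using form unfolding one_form_def by blast+

lemma trans_F: "C \<in> A \<Longrightarrow> D \<in> A \<Longrightarrow> p \<in> fst C \<Longrightarrow> p \<in> fst D \<Longrightarrow>
    F D (snd D p) (dtrans C D p y) = F C (snd C p) y"
  using finsler unfolding finsler_metric_def by blast

lemma conorm_invariant:
  assumes "C \<in> A" "D \<in> A" "p \<in> fst C" "p \<in> fst D"
  shows "conorm2 (a D (snd D p)) (b D (snd D p)) = conorm2 (a C (snd C p)) (b C (snd C p))"
  by (rule conorm2_invariant[of _ _ "dtrans C D p" "dtrans D C p"])
     (use assms in \<open>auto intro: pos_a dtrans_inverse trans_a trans_b\<close>)

text \<open>The hypothesis provides a nonzero value in some chart D. Evaluating the form in C on the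
  transported vector with components b in D gives |b|^2, so the value in C is nonzero too.\<close>

lemma b_nonzero_dense:
  assumes "open U" "U \<noteq> {}" "C \<in> A" "U \<subseteq> fst C"
  shows "\<exists>p\<in>U. b C (snd C p) \<noteq> 0"
proof -
  obtain p D where p: "p \<in> U" and D: "D \<in> A" "p \<in> fst D" "b D (snd D p) \<noteq> 0"
    using nonzero assms(1,2) unfolding nowhere_locally_zero_def by blast
  have pC: "p \<in> fst C" using p assms(4) by blast
  have "b C (snd C p) \<bullet> dtrans D C p (b D (snd D p)) = b D (snd D p) \<bullet> b D (snd D p)"
    by (rule trans_b[OF D(1) assms(3) D(2) pC])
  then have "b C (snd C p) \<noteq> 0" using D(3) by force
  then show ?thesis using p by blast
qed

lemma randers_chartI:
  assumes C: "C \<in> A" and st: "straight_geodesics (F C) (crange C)" and n: "CARD('n) \<ge> 2"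
    and iso: "\<And>p y. p \<in> fst C \<Longrightarrow> y \<noteq> 0 \<Longrightarrow> S_curvature (F C) (snd C p) y = (real CARD('n) + 1) * \<tau> p * F C (snd C p) y"
  shows "randers_chart (crange C) (F C) (a C) (b C) (\<lambda>x. \<tau> (inv_into (fst C) (snd C) x))"
proof (rule randers_chart.intro)
  fix x y v assume x: "x \<in> crange C"
  show "\<exists>P. spray (F C) x y = P *\<^sub>R y" if "y \<noteq> 0" by (rule straight_geodesics_spray[OF st x that])
  show "S_curvature (F C) x y = (real CARD('n) + 1) * \<tau> (inv_into (fst C) (snd C) x) * F C x y" if "y \<noteq> 0"
    using iso[of "inv_into (fst C) (snd C) x" y] chart_inv_mem[OF x] that by simp
  show "F C x y > 0" if "y \<noteq> 0"
    using finsler C x that unfolding finsler_metric_def by blast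
  show "v \<bullet> (fund (F C) x y *v v) > 0" if "y \<noteq> 0" "v \<noteq> 0"
    using finsler C x that unfolding finsler_metric_def by blast
qed (use C n in \<open>auto intro: open_crange smooth_a smooth_b sym_a pos_a randers_F conorm_less\<close>)

definition rho :: "('m, 'n) chart \<Rightarrow> real^'n \<Rightarrow> real^'n \<Rightarrow> real"
  where "rho C x y = (b C x \<bullet> y) / sqrt (1 - conorm2 (a C x) (b C x))"

lemma trans_rho:
  assumes "C \<in> A" "D \<in> A" "p \<in> fst C" "p \<in> fst D"
  shows "rho D (snd D p) (dtrans C D p y) = rho C (snd C p) y"
  unfolding rho_def trans_b[OF assms] conorm_invariant[OF assms] ..

text \<open>The factor c of the covariant derivative of \<rho> in coordinates. It represents a
  function on the manifold, because \<tau> does and b^2 is invariant.\<close>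

definition cfun :: "('m \<Rightarrow> real) \<Rightarrow> ('m, 'n) chart \<Rightarrow> real^'n \<Rightarrow> real"
  where "cfun \<tau> C x = 2 * \<tau> (inv_into (fst C) (snd C) x) / sqrt (1 - conorm2 (a C x) (b C x))"

text \<open>The last conjunct records dc = -\<mu> \<rho>, written in the coordinates of C; through
  it the curvature constants of overlapping charts are compared.\<close>

lemma local_normal_form:
  assumes C: "C \<in> A" and st: "straight_geodesics (F C) (crange C)" and n: "CARD('n) \<ge> 2"
    and iso: "\<And>p y. p \<in> fst C \<Longrightarrow> y \<noteq> 0 \<Longrightarrow> S_curvature (F C) (snd C p) y = (real CARD('n) + 1) * \<tau> p * F C (snd C p) y"
    and p: "p \<in> fst C"
  shows "\<exists>D\<in>A. \<exists>lam \<mu> e. p \<in> fst D \<and> fst D \<subseteq> fst C \<and> connected (fst D) \<and> pair_normal_form a b D lam \<mu> e \<and>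
    (\<forall>q\<in>fst D. (cfun \<tau> C has_derivative (\<lambda>h. - \<mu> * rho C (snd C q) h)) (at (snd C q)))"
proof -
  interpret R: randers_chart "crange C" "F C" "a C" "b C" "\<lambda>x. \<tau> (inv_into (fst C) (snd C) x)"
    by (rule randers_chartI[OF C st n iso])
  define \<mu> where "\<mu> = R.pp.curv (snd C p)"
  have x0: "snd C p \<in> crange C" using p by blast
  obtain S and zf gf :: "real^'n \<Rightarrow> real^'n" and r lam :: real and e :: "real^'n" where N:
    "open S" "snd C p \<in> S" "S \<subseteq> crange C" "r > 0" "smooth_on S zf" "smooth_on (ball 0 r) gf"
    "\<And>x. x \<in> S \<Longrightarrow> zf x \<in> ball 0 r \<and> gf (zf x) = x"
    "\<And>z. z \<in> ball 0 r \<Longrightarrow> gf z \<in> S \<and> zf (gf z) = z"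
    "\<And>x. x \<in> S \<Longrightarrow> R.pp.curv x = \<mu> \<and> 1 + \<mu> * (norm (zf x))\<^sup>2 > 0"
    "\<And>x Y. x \<in> S \<Longrightarrow> R.g x Y Y = 4 * (norm (dd zf x Y))\<^sup>2 / (1 + \<mu> * (norm (zf x))\<^sup>2)\<^sup>2"
    "\<And>x Y. x \<in> S \<Longrightarrow> R.\<rho> x Y = 4 / (1 + \<mu> * (norm (zf x))\<^sup>2)\<^sup>2 *
       (- 2 * (lam + \<mu> * (e \<bullet> zf x)) * (zf x \<bullet> dd zf x Y)
        + (1 + \<mu> * (norm (zf x))\<^sup>2) * (e \<bullet> dd zf x Y))"
    by (rule R.pp.normal_coordinates[OF x0, folded \<mu>_def]) (rule that; assumption)
  define D where "D = ({p \<in> fst C. snd C p \<in> S}, zf \<circ> snd C)"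
  note rep = reparametrized_chart[OF C N(1,3) open_ball N(5,6)]
  have D: "D \<in> A" "connected (fst D)"
    unfolding D_def by (rule rep(1)[OF N(7) N(8)] rep(4)[OF N(7) N(8)]; simp)+
  have dD: "dtrans D C q = dd gf (snd D q)" if "q \<in> fst D" for q
    using that unfolding D_def by - (rule rep(3)[OF N(7) N(8)])
  have fD: "q \<in> fst C" "snd C q \<in> S" if "q \<in> fst D" for q using that by (auto simp: D_def)
  have "pair_normal_form a b D lam \<mu> e"
    unfolding pair_normal_form_def
  proof (intro ballI allI)
    fix z y assume "z \<in> crange D"
    then obtain q where q: "q \<in> fst D" and z: "z = snd D q" by blast
    define Y where "Y = dtrans D C q y"
    have zx: "zf (snd C q) = z" "gf z = snd C q" "z \<in> ball 0 r"
      using N(7)[OF fD(2)[OF q]] z by (auto simp: D_def)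
    have yY: "dd zf (snd C q) Y = y"
    proof -
      have g: "(gf has_derivative dtrans D C q) (at z)"
        using smooth_on_has_derivative[OF N(6) zx(3)] dD[OF q] z by simp
      have f: "(zf has_derivative dd zf (snd C q)) (at (gf z))"
        using smooth_on_has_derivative[OF N(5) fD(2)[OF q]] zx(2) by simp
      have "((\<lambda>z. zf (gf z)) has_derivative (\<lambda>y. dd zf (snd C q) (dtrans D C q y))) (at z)"
        by (rule has_derivative_compose[OF g f])
      then have "((\<lambda>z. z) has_derivative (\<lambda>y. dd zf (snd C q) (dtrans D C q y))) (at z)"
        by (rule has_derivative_transform_within_open[OF _ open_ball zx(3)]) (use N(8) in auto)
      then show ?thesis unfolding Y_def using has_derivative_unique[OF _ has_derivative_ident] by metis
    qed
    have s: "1 + \<mu> * (norm z)\<^sup>2 > 0" using N(9)[OF fD(2)[OF q]] zx(1) by simp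
    have "y \<bullet> (a D z *v y) = R.g (snd C q) Y Y"
      using trans_a[OF D(1) C q fD(1)[OF q], of y y] by (simp add: Y_def R.g_def z)
    also have "\<dots> = (2 / (1 + \<mu> * (norm z)\<^sup>2) * norm y)\<^sup>2"
      unfolding N(10)[OF fD(2)[OF q]] yY zx(1) by (simp add: power_mult_distrib power_divide)
    finally have "alpha_norm (a D z) y = 2 / (1 + \<mu> * (norm z)\<^sup>2) * norm y"
      unfolding alpha_norm_def using s by (simp del: times_divide_eq_left)
    moreover have "(b D z \<bullet> y) / sqrt (1 - conorm2 (a D z) (b D z)) = R.\<rho> (snd C q) Y"
      using trans_rho[OF D(1) C q fD(1)[OF q], of y] by (simp add: rho_def R.\<rho>_def Y_def z)
    ultimately show "alpha_norm (a D z) y = 2 / (1 + \<mu> * (norm z)\<^sup>2) * norm y \<and>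
        (b D z \<bullet> y) / sqrt (1 - conorm2 (a D z) (b D z)) =
          4 / (1 + \<mu> * (norm z)\<^sup>2)\<^sup>2 *
            (- 2 * (lam + \<mu> * (e \<bullet> z)) * (z \<bullet> y) + (1 + \<mu> * (norm z)\<^sup>2) * (e \<bullet> y))"
      unfolding N(11)[OF fD(2)[OF q]] yY zx(1) by simp
  qed
  moreover have "(cfun \<tau> C has_derivative (\<lambda>h. - \<mu> * rho C (snd C q) h)) (at (snd C q))" if q: "q \<in> fst D" for q
  proof -
    have x: "snd C q \<in> crange C" using fD(1)[OF q] by blast
    have "cfun \<tau> C = R.c" by (simp add: cfun_def[abs_def] R.c_def[abs_def])
    moreover have "dd R.c (snd C q) = (\<lambda>h. - \<mu> * rho C (snd C q) h)"
      using R.pp.dd_c[OF x] N(9)[OF fD(2)[OF q]] by (auto simp: rho_def R.\<rho>_def)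
    ultimately show ?thesis using R.pp.deriv_c[OF x] by simp
  qed
  moreover have "p \<in> fst D" using p N(2) by (simp add: D_def)
  moreover have "fst D \<subseteq> fst C" by (auto simp: D_def)
  ultimately show ?thesis using D by blast
qed

text \<open>Neither c nor \<rho> depends on the chart, so -\<mu> \<rho> and -\<nu> \<rho> are the
  same covector; evaluating on the components of b shows that \<rho> is nonzero there.\<close>

lemma curvature_unique:
  assumes C: "C \<in> A" "q \<in> fst C" "(cfun \<tau> C has_derivative (\<lambda>h. - \<mu> * rho C (snd C q) h)) (at (snd C q))"
    and D: "D \<in> A" "q \<in> fst D" "(cfun \<tau> D has_derivative (\<lambda>h. - \<nu> * rho D (snd D q) h)) (at (snd D q))"
    and nz: "b C (snd C q) \<noteq> 0"
  shows "\<mu> = \<nu>"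
proof -
  have "((\<lambda>x. cfun \<tau> D (transition C D x)) has_derivative (\<lambda>h. - \<nu> * rho D (snd D q) (dtrans C D q h))) (at (snd C q))"
    by (rule has_derivative_compose[OF deriv_transition[OF C(1) D(1) C(2) D(2)]])
       (use D(3) transition_apply[OF C(1,2)] in simp)
  then have "(cfun \<tau> C has_derivative (\<lambda>h. - \<nu> * rho C (snd C q) h)) (at (snd C q))"
    unfolding trans_rho[OF C(1) D(1) C(2) D(2)]
  proof (rule has_derivative_transform_within_open[OF _ open_overlap[OF C(1) D(1)]])
    show "snd C q \<in> snd C ` (fst C \<inter> fst D)" using C(2) D(2) by blast
    fix x assume "x \<in> snd C ` (fst C \<inter> fst D)"
    then obtain p where p: "p \<in> fst C" "p \<in> fst D" "x = snd C p" by blast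
    then show "cfun \<tau> D (transition C D x) = cfun \<tau> C x"
      using conorm_invariant[OF C(1) D(1) p(1,2)] C(1) D(1) by (simp add: cfun_def transition_apply inv_chart)
  qed
  from has_derivative_unique[OF C(3) this]
  have "\<mu> * rho C (snd C q) (b C (snd C q)) = \<nu> * rho C (snd C q) (b C (snd C q))"
    by (metis minus_mult_left neg_equal_iff_equal)
  moreover have "rho C (snd C q) (b C (snd C q)) \<noteq> 0"
    using nz conorm_less[OF C(1), of "snd C q"] C(2) by (simp add: rho_def)
  ultimately show ?thesis by simp
qed

lemma normal_form_exists:
  assumes conn: "connected (UNIV :: 'm set)" and n: "CARD('n) \<ge> 2"
    and flat: "locally_projectively_flat A F" and iso: "isotropic_S_curvature A F"
  shows "\<exists>\<mu>. \<forall>p. \<exists>C\<in>A. p \<in> fst C \<and> connected (fst C) \<and> (\<exists>lam e. pair_normal_form a b C lam \<mu> e)"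
proof -
  obtain \<tau> :: "'m \<Rightarrow> real" where \<tau>: "\<And>C p y. C \<in> A \<Longrightarrow> p \<in> fst C \<Longrightarrow> y \<noteq> 0 \<Longrightarrow>
        S_curvature (F C) (snd C p) y = (real CARD('n) + 1) * \<tau> p * F C (snd C p) y"
    using iso unfolding isotropic_S_curvature_def by blast
  have "\<exists>C D lam \<mu> e. C \<in> A \<and> D \<in> A \<and> p \<in> fst D \<and> fst D \<subseteq> fst C \<and> connected (fst D) \<and> pair_normal_form a b D lam \<mu> e \<and>
    (\<forall>q\<in>fst D. (cfun \<tau> C has_derivative (\<lambda>h. - \<mu> * rho C (snd C q) h)) (at (snd C q)))" for p
  proof -
    obtain C where C: "C \<in> A" "p \<in> fst C" "straight_geodesics (F C) (crange C)"
      using flat unfolding locally_projectively_flat_def by blast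
    show ?thesis
      using local_normal_form[of C \<tau> p, OF C(1,3) n \<tau>[OF C(1)] C(2)] C(1) by blast
  qed
  then obtain C D lam \<mu> e where *: "\<And>p. C p \<in> A" "\<And>p. D p \<in> A" "\<And>p. p \<in> fst (D p)" "\<And>p. fst (D p) \<subseteq> fst (C p)"
    "\<And>p. connected (fst (D p))" "\<And>p. pair_normal_form a b (D p) (lam p) (\<mu> p) (e p)"
    "\<And>p q. q \<in> fst (D p) \<Longrightarrow> (cfun \<tau> (C p) has_derivative (\<lambda>h. - \<mu> p * rho (C p) (snd (C p) q) h)) (at (snd (C p) q))"
    by metis
  have loc: "\<mu> q = \<mu> p" if q: "q \<in> fst (D p)" for p q
  proof -
    have "open (fst (D p) \<inter> fst (D q))" using *(2) open_dom by blast
    moreover have "fst (D p) \<inter> fst (D q) \<noteq> {}" using q *(3) by blast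
    moreover have "fst (D p) \<inter> fst (D q) \<subseteq> fst (C q)" using *(4) by blast
    \<comment> \<open>The 1-form may vanish at q, so the constants are compared at another point of
      the overlap.\<close>
    ultimately obtain r where r: "r \<in> fst (D p)" "r \<in> fst (D q)" "b (C q) (snd (C q) r) \<noteq> 0"
      using b_nonzero_dense[of "fst (D p) \<inter> fst (D q)" "C q"] *(1) by blast
    show ?thesis
      by (rule curvature_unique[OF *(1) _ *(7)[OF r(2)] *(1) _ *(7)[OF r(1)] r(3)]) (use r *(4) in blast)+
  qed
  have const: "\<mu> p = \<mu> q" for p q
  proof (rule locally_constant[OF conn])
    show "\<exists>U. open U \<and> p \<in> U \<and> (\<forall>q\<in>U. \<mu> q = \<mu> p)" for p
    proof (intro exI conjI ballI)
      show "open (fst (D p))" "p \<in> fst (D p)" by (rule open_dom[OF *(2)] *(3))+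
      show "\<mu> q = \<mu> p" if "q \<in> fst (D p)" for q by (rule loc[OF that])
    qed
  qed
  show ?thesis
  proof (rule exI[of _ "\<mu> undefined"], intro allI)
    fix p
    show "\<exists>C\<in>A. p \<in> fst C \<and> connected (fst C) \<and> (\<exists>lam e. pair_normal_form a b C lam (\<mu> undefined) e)"
      using *(2)[of p] *(3)[of p] *(5)[of p] *(6)[of p] const[of undefined p] by auto
  qed
qed

end

section \<open>Conformal fields in normal coordinates\<close>

text \<open>Differentiating the polarised conformal equation and combining three permutations of the
  arguments isolates the second derivative, as for Christoffel symbols.\<close>

lemma conformal_second_derivative:
  fixes X :: "'a::euclidean_space \<Rightarrow> 'a"
  assumes S: "open S" "x \<in> S" and sm: "smooth_on S X" "smooth_on S \<phi>"
    and conf: "\<And>x y. x \<in> S \<Longrightarrow> y \<bullet> dd X x y = \<phi> x * (y \<bullet> y)"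
  shows "z \<bullet> dd (\<lambda>u. dd X u y) x w = dd \<phi> x w * (y \<bullet> z) + dd \<phi> x y * (z \<bullet> w) - dd \<phi> x z * (y \<bullet> w)"
proof -
  have pol: "z \<bullet> dd X u y + y \<bullet> dd X u z = 2 * \<phi> u * (y \<bullet> z)" if u: "u \<in> S" for u y z
    using conf[OF u, of "y + z"] conf[OF u, of y] conf[OF u, of z] linear_add[OF smooth_on_linear[OF sm(1) u]]
    by (simp add: inner_simps inner_commute algebra_simps)
  have E: "z \<bullet> dd (\<lambda>u. dd X u y) x w + y \<bullet> dd (\<lambda>u. dd X u z) x w = 2 * dd \<phi> x w * (y \<bullet> z)" for y z w
  proof -
    have D: "((\<lambda>u. dd X u v) has_derivative dd (\<lambda>u. dd X u v) x) (at x)" for v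
      by (rule smooth_on_has_derivative[OF smooth_on_dd[OF sm(1)] S(2)])
    have 1: "((\<lambda>u. z \<bullet> dd X u y + y \<bullet> dd X u z) has_derivative
        (\<lambda>w. z \<bullet> dd (\<lambda>u. dd X u y) x w + y \<bullet> dd (\<lambda>u. dd X u z) x w)) (at x)"
      by (intro has_derivative_add bounded_linear.has_derivative[OF bounded_linear_inner_right D])
    have 2: "((\<lambda>u. z \<bullet> dd X u y + y \<bullet> dd X u z) has_derivative (\<lambda>w. 2 * dd \<phi> x w * (y \<bullet> z))) (at x)"
    proof (rule has_derivative_transform_within_open[OF _ S])
      show "((\<lambda>u. 2 * \<phi> u * (y \<bullet> z)) has_derivative (\<lambda>w. 2 * dd \<phi> x w * (y \<bullet> z))) (at x)"
        by (auto intro!: derivative_eq_intros smooth_on_has_derivative[OF sm(2) S(2)])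
    qed (simp add: pol)
    from fun_cong[OF has_derivative_unique[OF 1 2], of w] show ?thesis .
  qed
  have s: "dd (\<lambda>u. dd X u v) x w = dd (\<lambda>u. dd X u w) x v" for v w
    by (rule second_derivative_sym[OF S(1) sm(1) S(2)])
  show ?thesis
    using E[of z y w] E[of z w y] E[of w y z] s[of y w] s[of z w] s[of z y]
    by (simp add: inner_commute algebra_simps)
qed

lemma smooth_constant:
  assumes "open S" "connected S" "smooth_on S f" "\<And>x v. x \<in> S \<Longrightarrow> dd f x v = 0" "x \<in> S" "y \<in> S"
  shows "f x = f y"
proof (rule has_derivative_zero_unique_connected[OF assms(1,2) _ assms(5,6)])
  show "(f has_derivative (\<lambda>h. 0)) (at x)" if "x \<in> S" for x
    using smooth_on_has_derivative[OF assms(3) that] ext[of "dd f x" "\<lambda>_. 0"] assms(4)[OF that] by simp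
qed

lemma dd_zero_of_const:
  assumes "open S" "x \<in> S" "\<And>u. u \<in> S \<Longrightarrow> f u = k"
  shows "dd f x v = 0"
  using dd_transform(1)[OF assms(1,2), of f "\<lambda>_. k"] assms(3) by simp

lemma derivative_zero_of_const:
  assumes "open S" "x \<in> S" "(f has_derivative f') (at x)" "\<And>u. u \<in> S \<Longrightarrow> f u = k"
  shows "f' v = 0"
  using dd_zero_of_const[OF assms(1,2), of f k v] assms(4) dd_eq[OF assms(3)] by simp

lemma skew_matrix:
  fixes B :: "real^'n \<Rightarrow> real^'n::finite"
  assumes "linear B" "\<And>y. y \<bullet> B y = 0"
  obtains Q :: "real^'n^'n" where "transpose Q = - Q" "\<And>y. B y = Q *v y"
proof -
  have Q: "B y = matrix B *v y" for y using assms(1) by (simp add: matrix_works)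
  have sk: "y \<bullet> B z + z \<bullet> B y = 0" for y z
    using assms(2)[of "y + z"] assms(2)[of y] assms(2)[of z] linear_add[OF assms(1)] by (simp add: inner_simps)
  have M: "matrix B $ j $ i = - matrix B $ i $ j" for i j
    using sk[of "axis i 1" "axis j 1"] by (simp add: matrix_def inner_axis' eq_neg_iff_add_eq_0 add.commute)
  have "transpose (matrix B) $ i $ j = (- matrix B) $ i $ j" for i j
    using M[of j i] by (simp add: transpose_def)
  then have "transpose (matrix B) = - matrix B" unfolding vec_eq_iff by blast
  then show thesis using that Q by blast
qed

lemma homothetic_affine:
  fixes X :: "real^'n \<Rightarrow> real^'n::finite"
  assumes S: "open S" "connected S" "S \<noteq> {}" and sm: "smooth_on S X"
    and conf: "\<And>x y. x \<in> S \<Longrightarrow> y \<bullet> dd X x y = \<phi> * (y \<bullet> y)"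
  obtains Q :: "real^'n^'n" and \<gamma> where "transpose Q = - Q" "\<And>x. x \<in> S \<Longrightarrow> X x = \<phi> *\<^sub>R x + Q *v x + \<gamma>"
proof -
  obtain x0 where x0: "x0 \<in> S" using S(3) by blast
  define B where "B y = dd X x0 y - \<phi> *\<^sub>R y" for y
  have linX: "linear (dd X x0)" by (rule smooth_on_linear[OF sm x0])
  then have "linear B" unfolding B_def by (intro linearI) (simp_all add: linear_add linear_scale algebra_simps)
  moreover have "y \<bullet> B y = 0" for y using conf[OF x0, of y] by (simp add: B_def inner_simps)
  ultimately obtain Q :: "real^'n^'n" where Q: "transpose Q = - Q" "\<And>y. B y = Q *v y" using skew_matrix by blast
  \<comment> \<open>The second derivative is paired with itself; as the factor is constant, the
    formula gives squared norm 0.\<close>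
  have "dd (\<lambda>u. dd X u y) x w = 0" if "x \<in> S" for x y w
    using conformal_second_derivative[OF S(1) that sm smooth_on_const[OF S(1)] conf, of "dd (\<lambda>u. dd X u y) x w" y w]
    by simp
  then have dX: "dd X x y = dd X x0 y" if "x \<in> S" for x y
    using smooth_constant[OF S(1,2) smooth_on_dd[OF sm] _ that x0] by blast
  have bl: "bounded_linear (dd X x0)" using linX linear_conv_bounded_linear by blast
  have smW: "smooth_on S (\<lambda>x. X x - dd X x0 x)"
    by (intro smooth_on_diff S sm smooth_on_bounded_linear[OF S(1) bl smooth_on_ident])
  have "dd (\<lambda>x. X x - dd X x0 x) x v = 0" if "x \<in> S" for x v
  proof -
    have "((\<lambda>x. X x - dd X x0 x) has_derivative (\<lambda>v. dd X x v - dd X x0 v)) (at x)"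
      by (intro has_derivative_diff smooth_on_has_derivative[OF sm that] bounded_linear_imp_has_derivative bl)
    then show ?thesis by (simp add: dd_eq dX[OF that])
  qed
  then have W: "X x - dd X x0 x = X x0 - dd X x0 x0" if "x \<in> S" for x
    using smooth_constant[OF S(1,2) smW _ that x0] by blast
  have "X x = \<phi> *\<^sub>R x + Q *v x + (X x0 - dd X x0 x0)" if "x \<in> S" for x
    using W[OF that] Q(2)[of x] by (simp add: B_def algebra_simps)
  then show thesis using that Q(1) by blast
qed

lemma skew_inner:
  fixes Q :: "real^'n^'n::finite"
  assumes "transpose Q = - Q"
  shows "y \<bullet> (Q *v z) = - ((Q *v y) \<bullet> z)" "y \<bullet> (Q *v y) = 0"
proof -
  have m: "(- Q) *v y = - (Q *v y)" for y by (simp add: vec_eq_iff matrix_vector_mult_def sum_negf)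
  show 1: "y \<bullet> (Q *v z) = - ((Q *v y) \<bullet> z)" for y z
  proof -
    have "y \<bullet> (Q *v z) = (transpose Q *v y) \<bullet> z" by (simp add: dot_lmul_matrix[symmetric])
    then show ?thesis by (simp add: assms m)
  qed
  show "y \<bullet> (Q *v y) = 0" using 1[of y y] by (simp add: inner_commute)
qed

text \<open>S may miss the origin, so coefficients are not read off there: the second derivative
  gives r \<mu> = 0, the first then v = 0, and the value itself r = 0.\<close>

lemma quadratic_zero_on_open:
  fixes v :: "real^'n::finite"
  assumes S: "open S" "S \<noteq> {}" and z: "\<And>x. x \<in> S \<Longrightarrow> r * (1 - \<mu> * (x \<bullet> x)) - v \<bullet> x = 0"
  shows "v = 0" "r = 0"
proof -
  obtain x0 where x0: "x0 \<in> S" using S(2) by blast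
  have 1: "- 2 * r * \<mu> * (x \<bullet> h) - v \<bullet> h = 0" if x: "x \<in> S" for x h :: "real^'n"
  proof -
    have "((\<lambda>x. r * (1 - \<mu> * (x \<bullet> x)) - v \<bullet> x) has_derivative (\<lambda>h. - 2 * r * \<mu> * (x \<bullet> h) - v \<bullet> h)) (at x)"
      by (auto intro!: derivative_eq_intros simp: inner_commute algebra_simps)
    from derivative_zero_of_const[OF S(1) x this z] show ?thesis .
  qed
  have 2: "- 2 * r * \<mu> * (h \<bullet> k) = 0" for h k :: "real^'n"
  proof -
    have "((\<lambda>x. - 2 * r * \<mu> * (x \<bullet> h) - v \<bullet> h) has_derivative (\<lambda>k. - 2 * r * \<mu> * (k \<bullet> h))) (at x0)"
      by (auto intro!: derivative_eq_intros)
    from derivative_zero_of_const[OF S(1) x0 this 1, of k] show ?thesis by (simp add: inner_commute)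
  qed
  have "r * \<mu> = 0" using 2[of "axis undefined 1" "axis undefined 1"] by (simp add: inner_axis_axis)
  then have vh: "v \<bullet> h = 0" for h using 1[OF x0, of h] by auto
  then show "v = 0" using inner_eq_zero_iff by blast
  have "r * (1 - \<mu> * (x0 \<bullet> x0)) = r - (r * \<mu>) * (x0 \<bullet> x0)" by (simp add: algebra_simps)
  also have "\<dots> = r" unfolding \<open>r * \<mu> = 0\<close> by simp
  finally show "r = 0" using z[OF x0] vh[of x0] by (metis diff_zero)
qed

lemma deriv_conformal_factor:
  fixes q :: "'a::real_inner \<Rightarrow> real"
  assumes "(q has_derivative (\<lambda>h. 2 * \<mu> * (x \<bullet> h))) (at x)" "q x \<noteq> 0"
  shows "((\<lambda>x. 4 / (q x)\<^sup>2) has_derivative (\<lambda>h. - 16 * \<mu> * (x \<bullet> h) / (q x) ^ 3)) (at x)"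
proof -
  have "((\<lambda>y::real. 4 / y\<^sup>2) has_real_derivative - 8 / (q x) ^ 3) (at (q x))"
    using assms(2) by (auto intro!: derivative_eq_intros simp: field_simps eval_nat_numeral)
  from has_derivative_compose[OF assms(1) this[unfolded has_field_derivative_def]]
  show ?thesis by (rule has_derivative_eq_rhs) (simp add: fun_eq_iff)
qed

text \<open>\<open>R\<close> is the normal form of \<open>\<rho>\<close>, and \<open>k\<close> is the conformal factor.\<close>

locale normal_field =
  fixes S :: "(real^'n::finite) set" and X :: "real^'n \<Rightarrow> real^'n" and k :: "real^'n \<Rightarrow> real"
    and lam \<mu> :: real and e :: "real^'n" and R :: "real^'n \<Rightarrow> real^'n"
  assumes S: "open S" "connected S" "S \<noteq> {}" and dim: "CARD('n) \<ge> 2" and smooth_X: "smooth_on S X"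
    and q_pos: "x \<in> S \<Longrightarrow> 1 + \<mu> * (x \<bullet> x) > 0"
    and R: "\<And>x. R x = (4 / (1 + \<mu> * (x \<bullet> x))\<^sup>2) *\<^sub>R (- (2 * (lam + \<mu> * (e \<bullet> x))) *\<^sub>R x + (1 + \<mu> * (x \<bullet> x)) *\<^sub>R e)"
    and conf: "x \<in> S \<Longrightarrow> y \<bullet> dd X x y = (- 2 * k x + 2 * \<mu> * (x \<bullet> X x) / (1 + \<mu> * (x \<bullet> x))) * (y \<bullet> y)"
    and lie: "x \<in> S \<Longrightarrow> dd R x (X x) \<bullet> y + R x \<bullet> dd X x y = - 2 * k x * (R x \<bullet> y)"
    and dense: "\<And>U. open U \<Longrightarrow> U \<noteq> {} \<Longrightarrow> U \<subseteq> S \<Longrightarrow> \<exists>x\<in>U. R x \<noteq> 0"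
begin

definition q :: "real^'n \<Rightarrow> real" where "q x = 1 + \<mu> * (x \<bullet> x)"
text \<open>The factor in \<open>\<rho>\<^sub>i\<^sub>;\<^sub>j = c h\<^sub>i\<^sub>j\<close>,
  computed from the normal form.\<close>

definition c :: "real^'n \<Rightarrow> real" where "c x = 2 * lam - 4 * (lam + \<mu> * (e \<bullet> x)) / q x"

lemma deriv_q: "(q has_derivative (\<lambda>h. 2 * \<mu> * (x \<bullet> h))) (at x)"
  unfolding q_def by (auto intro!: derivative_eq_intros simp: inner_commute algebra_simps)

lemma smooth_q: "smooth_on S q"
  unfolding q_def by (intro smooth_on_add smooth_on_mult smooth_on_inner smooth_on_const smooth_on_ident S)

lemma qp: "x \<in> S \<Longrightarrow> q x > 0" using q_pos by (simp add: q_def)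

lemma deriv_c:
  assumes x: "x \<in> S"
  shows "(c has_derivative (\<lambda>h. - \<mu> * (R x \<bullet> h))) (at x)"
proof -
  have n: "q x \<noteq> 0" using qp[OF x] by simp
  show ?thesis unfolding c_def
    by (rule derivative_eq_intros deriv_q n refl)+
       (use n in \<open>simp add: fun_eq_iff R q_def[symmetric] inner_simps field_simps power2_eq_square\<close>)
qed

text \<open>The first term is c h(h, y), with metric factor 4 / q^2; the remaining terms are \<rho>
  applied to the Christoffel symbols of this conformally flat metric. The symmetry in h and y is
  closedness of \<rho>.\<close>

lemma deriv_R:
  assumes x: "x \<in> S"
  shows "dd R x h \<bullet> y = c x * (4 / (q x)\<^sup>2) * (h \<bullet> y)
    - (2 * \<mu> / q x) * ((x \<bullet> h) * (R x \<bullet> y) + (x \<bullet> y) * (R x \<bullet> h) - (h \<bullet> y) * (x \<bullet> R x))"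
    and smooth_R: "R differentiable (at x)"
proof -
  have n: "q x \<noteq> 0" using qp[OF x] by simp
  have R': "R = (\<lambda>x. (4 / (q x)\<^sup>2) *\<^sub>R (- (2 * (lam + \<mu> * (e \<bullet> x))) *\<^sub>R x + q x *\<^sub>R e))"
    by (simp add: fun_eq_iff R q_def)
  define D where "D h = (4 / (q x)\<^sup>2) *\<^sub>R (- (2 * (\<mu> * (e \<bullet> h))) *\<^sub>R x - (2 * (lam + \<mu> * (e \<bullet> x))) *\<^sub>R h + (2 * \<mu> * (x \<bullet> h)) *\<^sub>R e)
     + (- 16 * \<mu> * (x \<bullet> h) / (q x) ^ 3) *\<^sub>R (- (2 * (lam + \<mu> * (e \<bullet> x))) *\<^sub>R x + q x *\<^sub>R e)" for h
  note s = deriv_conformal_factor[OF deriv_q n]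
  have v: "((\<lambda>x. - (2 * (lam + \<mu> * (e \<bullet> x))) *\<^sub>R x + q x *\<^sub>R e) has_derivative
     (\<lambda>h. - (2 * (\<mu> * (e \<bullet> h))) *\<^sub>R x - (2 * (lam + \<mu> * (e \<bullet> x))) *\<^sub>R h + (2 * \<mu> * (x \<bullet> h)) *\<^sub>R e)) (at x)"
    by (rule derivative_eq_intros deriv_q refl)+ (simp add: fun_eq_iff algebra_simps)
  have D: "(R has_derivative D) (at x)"
    unfolding R' D_def by (rule has_derivative_scaleR[OF s v])
  then show "R differentiable (at x)" by (auto simp: differentiable_def)
  have q3: "4 / (q x)\<^sup>2 = 4 * q x / (q x) ^ 3" "c x * (4 / (q x)\<^sup>2) = 4 * (2 * lam * q x - 4 * (lam + \<mu> * (e \<bullet> x))) / (q x) ^ 3"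
    "2 * \<mu> / q x * (r * (4 / (q x)\<^sup>2)) = 8 * \<mu> * r / (q x) ^ 3" for r
    using n by (simp_all add: c_def field_simps eval_nat_numeral)
  define k0 where "k0 = lam + \<mu> * (e \<bullet> x)"
  have "D h \<bullet> y * (q x) ^ 3 = 4 * q x * (- 2 * \<mu> * (e \<bullet> h) * (x \<bullet> y) - 2 * k0 * (h \<bullet> y) + 2 * \<mu> * (x \<bullet> h) * (e \<bullet> y))
      - 16 * \<mu> * (x \<bullet> h) * (- 2 * k0 * (x \<bullet> y) + q x * (e \<bullet> y))"
    unfolding D_def k0_def[symmetric] using n by (simp add: inner_simps field_simps eval_nat_numeral)
  also have "\<dots> = 4 * (2 * lam * q x - 4 * k0) * (h \<bullet> y)
    - 8 * \<mu> * ((x \<bullet> h) * (- 2 * k0 * (x \<bullet> y) + q x * (e \<bullet> y)) + (x \<bullet> y) * (- 2 * k0 * (x \<bullet> h) + q x * (e \<bullet> h))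
      - (h \<bullet> y) * (- 2 * k0 * (x \<bullet> x) + q x * (e \<bullet> x)))"
  proof -
    have "\<mu> * (x \<bullet> x) = q x - 1" "\<mu> * (e \<bullet> x) = k0 - lam" by (simp_all add: q_def k0_def)
    then show ?thesis by algebra
  qed
  also have "\<dots> = (c x * (4 / (q x)\<^sup>2) * (h \<bullet> y)
    - (2 * \<mu> / q x) * ((x \<bullet> h) * (R x \<bullet> y) + (x \<bullet> y) * (R x \<bullet> h) - (h \<bullet> y) * (x \<bullet> R x))) * (q x) ^ 3"
    unfolding R' c_def k0_def[symmetric] using n
    by (simp add: inner_simps inner_commute[of x e] field_simps eval_nat_numeral)
  finally show "dd R x h \<bullet> y = c x * (4 / (q x)\<^sup>2) * (h \<bullet> y)
    - (2 * \<mu> / q x) * ((x \<bullet> h) * (R x \<bullet> y) + (x \<bullet> y) * (R x \<bullet> h) - (h \<bullet> y) * (x \<bullet> R x))"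
    using n by (simp add: dd_eq[OF D])
qed

text \<open>If \<rho>(V) were nonzero at a point, c would vanish on a neighbourhood; dc = -\<mu>
  \<rho> evaluated on V then gives \<mu> = 0, after which c is the constant -2 lam and lam = 0 as
  well.\<close>

lemma R_X_zero:
  assumes nd: "\<mu> \<noteq> 0 \<or> lam \<noteq> 0" and x: "x \<in> S"
  shows "R x \<bullet> X x = 0"
proof (rule ccontr)
  assume nz: "R x \<bullet> X x \<noteq> 0"
  \<comment> \<open>On the vector R u, \<open>lie\<close> and \<open>conf\<close> contribute the
    same multiple of k, and the Christoffel terms of \<open>deriv_R\<close> match the remaining term
    of \<open>conf\<close>.\<close>
  have cRX: "c u * (R u \<bullet> X u) = 0" if u: "u \<in> S" for u
  proof -
    have n: "q u \<noteq> 0" using qp[OF u] by simp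
    have "dd R u (X u) \<bullet> R u = - 2 * \<mu> * (u \<bullet> X u) / q u * (R u \<bullet> R u)"
      using lie[OF u, of "R u"] conf[OF u, of "R u"] by (simp add: q_def algebra_simps)
    moreover have "dd R u (X u) \<bullet> R u = c u * (4 / (q u)\<^sup>2) * (X u \<bullet> R u) - 2 * \<mu> * (u \<bullet> X u) / q u * (R u \<bullet> R u)"
      unfolding deriv_R[OF u] by (simp add: inner_commute algebra_simps)
    ultimately show ?thesis using n by (simp add: inner_commute)
  qed
  have cont: "continuous_on S (\<lambda>u. R u \<bullet> X u)"
    using smooth_R by (intro continuous_on_inner smooth_on_continuous[OF smooth_X] differentiable_imp_continuous_on
        differentiable_at_imp_differentiable_on)
  define U where "U = (\<lambda>u. R u \<bullet> X u) -` (- {0}) \<inter> S"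
  have U: "open U" "x \<in> U" "U \<subseteq> S"
    using continuous_on_open_vimage[OF S(1), of "\<lambda>u. R u \<bullet> X u"] cont nz x by (auto simp: U_def)
  have c0: "c u = 0" if "u \<in> U" for u using cRX[of u] that by (auto simp: U_def)
  have "\<mu> * (R x \<bullet> X x) = 0"
    using derivative_zero_of_const[OF U(1,2) deriv_c[OF x] c0, of "X x"] by simp
  then have "\<mu> = 0" using nz by simp
  moreover from this have "c x = - 2 * lam" unfolding c_def q_def by simp
  ultimately show False using c0[OF U(2)] nd by simp
qed

text \<open>The Euclidean conformal factor, read off from one diagonal entry of dX. In this form it
  is smooth, while \<open>k\<close> starts out as an arbitrary function.\<close>

definition \<phi> :: "real^'n \<Rightarrow> real" where "\<phi> x = axis undefined 1 \<bullet> dd X x (axis undefined 1)"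

lemma phi: "x \<in> S \<Longrightarrow> \<phi> x = - 2 * k x + 2 * \<mu> * (x \<bullet> X x) / q x"
  unfolding \<phi>_def by (simp add: conf q_def inner_axis_axis)

lemma conf_phi: "x \<in> S \<Longrightarrow> y \<bullet> dd X x y = \<phi> x * (y \<bullet> y)"
  by (simp add: phi conf q_def)

lemma smooth_phi: "smooth_on S \<phi>"
  unfolding \<phi>_def by (intro smooth_on_inner smooth_on_const smooth_on_dd smooth_X S)

lemma second_X: "x \<in> S \<Longrightarrow> z \<bullet> dd (\<lambda>u. dd X u y) x w = dd \<phi> x w * (y \<bullet> z) + dd \<phi> x y * (z \<bullet> w) - dd \<phi> x z * (y \<bullet> w)"
  by (rule conformal_second_derivative[OF S(1) _ smooth_X smooth_phi conf_phi])

lemma k_zero: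
  assumes nd: "\<mu> \<noteq> 0 \<or> lam \<noteq> 0" and x: "x \<in> S"
  shows "k x = 0"
proof (rule ccontr)
  assume nz: "k x \<noteq> 0"
  have kR: "k u * (R u \<bullet> R u) = 0" if u: "u \<in> S" for u
  proof -
    have "((\<lambda>u. R u \<bullet> X u) has_derivative (\<lambda>h. R u \<bullet> dd X u h + dd R u h \<bullet> X u)) (at u)"
      using smooth_R[OF u] by (intro has_derivative_inner smooth_on_has_derivative[OF smooth_X u])
        (simp add: frechet_derivative_works)
    from derivative_zero_of_const[OF S(1) u this R_X_zero[OF nd]]
    have "R u \<bullet> dd X u (R u) + dd R u (R u) \<bullet> X u = 0" .
    moreover have "dd R u (R u) \<bullet> X u = dd R u (X u) \<bullet> R u"
      unfolding deriv_R[OF u] by (simp add: inner_commute algebra_simps)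
    ultimately have "- 2 * k u * (R u \<bullet> R u) = 0" using lie[OF u, of "R u"] by linarith
    then show ?thesis by simp
  qed
  \<comment> \<open>On S this is 2 k, expressed through smooth functions, so the set where k is
    nonzero is open and must contain a point with R nonzero.\<close>
  define f where "f u = 2 * \<mu> * (u \<bullet> X u) / q u - \<phi> u" for u
  have f: "f u = 2 * k u" if "u \<in> S" for u using phi[OF that] by (simp add: f_def)
  have "smooth_on S f" unfolding f_def
    by (intro smooth_on_diff smooth_on_divide smooth_on_mult smooth_on_inner smooth_on_const smooth_on_ident
        smooth_X smooth_phi smooth_q S) (use qp in force)
  then have cont: "continuous_on S f" by (rule smooth_on_continuous)
  define U where "U = f -` (- {0}) \<inter> S"
  have U: "open U" "x \<in> U" "U \<subseteq> S"
    using continuous_on_open_vimage[OF S(1), of f] cont nz x f by (auto simp: U_def)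
  then obtain u where u: "u \<in> U" "R u \<noteq> 0" using dense[of U] by blast
  then have "u \<in> S" "k u \<noteq> 0" using f by (auto simp: U_def)
  then show False using kR[of u] u(2) by simp
qed

text \<open>Differentiating e \<bullet> dX y = \<phi> (e \<bullet> y) and comparing with
  \<open>second_X\<close> gives d\<phi>(y) (e \<bullet> w) = d\<phi>(e) (y \<bullet> w). A nonzero y
  = w orthogonal to e yields d\<phi>(e) = 0, and w = e then yields d\<phi> = 0.\<close>

lemma phi_const:
  assumes 0: "\<mu> = 0" "lam = 0"
  shows "e \<noteq> 0" "x \<in> S \<Longrightarrow> y \<in> S \<Longrightarrow> \<phi> x = \<phi> y"
    "x \<in> S \<Longrightarrow> e \<bullet> dd X x y = \<phi> x * (e \<bullet> y)"
proof -
  have R4: "R x = 4 *\<^sub>R e" for x by (simp add: R 0)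
  show e: "e \<noteq> 0" using dense[OF S(1,3)] R4 by auto
  show B: "e \<bullet> dd X x y = \<phi> x * (e \<bullet> y)" if x: "x \<in> S" for x y
  proof -
    have "dd R x (X x) = 0" by (simp add: R4[abs_def])
    then show ?thesis using lie[OF x, of y] phi[OF x] by (simp add: R4 0)
  qed
  have "dd \<phi> x h = 0" if x: "x \<in> S" for x h
  proof -
    have 1: "e \<bullet> dd (\<lambda>u. dd X u y) x w = dd \<phi> x w * (e \<bullet> y)" for y w
    proof -
      have 1: "((\<lambda>u. e \<bullet> dd X u y) has_derivative (\<lambda>w. e \<bullet> dd (\<lambda>u. dd X u y) x w)) (at x)"
        by (intro bounded_linear.has_derivative[OF bounded_linear_inner_right] smooth_on_has_derivative[OF smooth_on_dd[OF smooth_X] x])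
      have 2: "((\<lambda>u. e \<bullet> dd X u y) has_derivative (\<lambda>w. dd \<phi> x w * (e \<bullet> y))) (at x)"
      proof (rule has_derivative_transform_within_open[OF _ S(1) x])
        show "((\<lambda>u. \<phi> u * (e \<bullet> y)) has_derivative (\<lambda>w. dd \<phi> x w * (e \<bullet> y))) (at x)"
          by (intro has_derivative_mult_left smooth_on_has_derivative[OF smooth_phi x])
      qed (simp add: B)
      from fun_cong[OF has_derivative_unique[OF 1 2], of w] show ?thesis .
    qed
    have 2: "dd \<phi> x y * (e \<bullet> w) = dd \<phi> x e * (y \<bullet> w)" for y w
      using 1[of y w] second_X[OF x, of e y w] by (simp add: inner_commute)
    have "dd \<phi> x h * (e \<bullet> e) = 0 * (e \<bullet> e)"
    proof -
      obtain m where m: "m \<notin> span {e}" using dim exists_not_in_span[of "{e}"] by auto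
      define y where "y = m - ((m \<bullet> e) / (e \<bullet> e)) *\<^sub>R e"
      have "y \<noteq> 0" using m by (auto simp: y_def span_singleton)
      moreover have "e \<bullet> y = 0" using e by (simp add: y_def inner_simps inner_commute)
      ultimately have "dd \<phi> x e = 0" using 2[of y y] by simp
      then show ?thesis using 2[of h e] by simp
    qed
    then show ?thesis using e by simp
  qed
  then show "\<phi> x = \<phi> y" if "x \<in> S" "y \<in> S" using smooth_constant[OF S(1,2) smooth_phi _ that] by blast
qed

section \<open>Explicit forms of the field in the three cases\<close>

lemma form_flat_parallel:
  assumes 0: "\<mu> = 0" "lam = 0"
  shows "\<exists>\<tau> \<gamma> Q. transpose Q = - Q \<and> Q *v e = 0 \<and> (\<forall>x\<in>S. X x = (- 2 * \<tau>) *\<^sub>R x + Q *v x + \<gamma>) \<and> (\<forall>x\<in>S. k x = \<tau>)"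
proof -
  obtain x0 where x0: "x0 \<in> S" using S(3) by blast
  define t where "t = \<phi> x0"
  have t: "\<phi> x = t" if "x \<in> S" for x using phi_const(2)[OF 0 that x0] by (simp add: t_def)
  obtain Q :: "real^'n^'n" and \<gamma> where Q: "transpose Q = - Q" "\<And>x. x \<in> S \<Longrightarrow> X x = t *\<^sub>R x + Q *v x + \<gamma>"
    using homothetic_affine[OF S smooth_X] conf_phi t by metis
  have "dd X x0 = dd (\<lambda>x. t *\<^sub>R x + Q *v x + \<gamma>) x0"
    by (rule dd_transform(1)[OF S(1) x0]) (auto simp: Q(2) differentiable_def intro!: exI derivative_eq_intros bounded_linear_imp_has_derivative)
  also have "\<dots> = (\<lambda>h. t *\<^sub>R h + Q *v h)"
    by (rule dd_eq) (auto intro!: derivative_eq_intros bounded_linear_imp_has_derivative)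
  finally have "e \<bullet> (t *\<^sub>R y + Q *v y) = t * (e \<bullet> y)" for y
    using phi_const(3)[OF 0 x0, of y] t[OF x0] by simp
  then have "(Q *v e) \<bullet> y = 0" for y using skew_inner(1)[OF Q(1), of e y] by (simp add: inner_simps)
  then have "Q *v e = 0" using inner_eq_zero_iff by blast
  moreover have "k x = - t / 2" if "x \<in> S" for x using phi[OF that] t[OF that] 0 by simp
  ultimately show ?thesis using Q by (intro exI[of _ "- t / 2"] exI[of _ \<gamma>] exI[of _ Q]) simp
qed

lemma form_flat:
  assumes 0: "\<mu> = 0" "lam \<noteq> 0"
  shows "\<exists>\<gamma> Q. transpose Q = - Q \<and> Q *v e = (- 2 * lam) *\<^sub>R \<gamma> \<and> (\<forall>x\<in>S. X x = Q *v x + \<gamma>)"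
proof -
  have "\<phi> x = 0" if "x \<in> S" for x using phi[OF that] k_zero[OF _ that] 0 by simp
  then obtain Q :: "real^'n^'n" and \<gamma> where Q: "transpose Q = - Q" "\<And>x. x \<in> S \<Longrightarrow> X x = 0 *\<^sub>R x + Q *v x + \<gamma>"
    using homothetic_affine[OF S smooth_X, of 0] conf_phi by (metis mult_zero_left)
  \<comment> \<open>R is 4 (e - 2 lam x) here, and skewness of Q removes the quadratic part of R
    \<bullet> X.\<close>
  have "(\<gamma> \<bullet> e) * (1 - 0 * (x \<bullet> x)) - ((2 * lam) *\<^sub>R \<gamma> + Q *v e) \<bullet> x = 0" if x: "x \<in> S" for x
    using R_X_zero[OF _ x] 0 Q(2)[OF x] skew_inner(1)[OF Q(1), of e x] skew_inner(2)[OF Q(1), of x]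
    by (simp add: R inner_simps inner_commute[of x \<gamma>] inner_commute[of e \<gamma>] algebra_simps)
  from quadratic_zero_on_open(1)[OF S(1,3) this] have "Q *v e = (- 2 * lam) *\<^sub>R \<gamma>"
    by (simp add: add_eq_0_iff)
  then show ?thesis using Q by (intro exI[of _ \<gamma>] exI[of _ Q]) simp
qed

text \<open>As k = 0, the Killing equation reads q \<phi> = 2 \<mu> (x \<bullet> X). Differentiating
  it twice and inserting \<open>second_X\<close> shows that the Hessian of \<phi> is \<psi> times
  the Euclidean metric; symmetry of third derivatives makes \<psi> constant, and differentiating q
  \<psi> = 2 \<mu> (\<phi> - d\<phi>(x)) forces \<psi> = 0. The same equation then says \<phi> =
  d\<phi>(x), so \<phi> has no constant term.\<close>

lemma phi_linear:
  assumes \<mu>: "\<mu> \<noteq> 0"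
  obtains G where "\<And>x. x \<in> S \<Longrightarrow> \<phi> x = G \<bullet> x"
proof -
  obtain x0 where x0: "x0 \<in> S" using S(3) by blast
  define \<psi> where "\<psi> x = 2 * \<mu> * (\<phi> x - dd \<phi> x x) / q x" for x
  have lin: "linear (dd \<phi> x)" if "x \<in> S" for x by (rule smooth_on_linear[OF smooth_phi that])
  have Dphi: "(\<phi> has_derivative dd \<phi> x) (at x)" if "x \<in> S" for x by (rule smooth_on_has_derivative[OF smooth_phi that])
  have DX: "(X has_derivative dd X x) (at x)" if "x \<in> S" for x by (rule smooth_on_has_derivative[OF smooth_X that])
  have qphi: "q x * \<phi> x = 2 * \<mu> * (x \<bullet> X x)" if "x \<in> S" for x
    using phi[OF that] k_zero[OF _ that] \<mu> qp[OF that] by simp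
  have d1: "2 * \<mu> * (x \<bullet> h) * \<phi> x + q x * dd \<phi> x h = 2 * \<mu> * (h \<bullet> X x + x \<bullet> dd X x h)" if x: "x \<in> S" for x h
  proof -
    have "((\<lambda>x. q x * \<phi> x - 2 * \<mu> * (x \<bullet> X x)) has_derivative
        (\<lambda>h. 2 * \<mu> * (x \<bullet> h) * \<phi> x + q x * dd \<phi> x h - 2 * \<mu> * (h \<bullet> X x + x \<bullet> dd X x h))) (at x)"
      by (rule derivative_eq_intros deriv_q Dphi[OF x] DX[OF x] refl)+ (simp add: fun_eq_iff algebra_simps)
    from derivative_zero_of_const[OF S(1) x this, of 0 h] show ?thesis using qphi by simp
  qed
  have d2: "dd (\<lambda>u. dd \<phi> u h) x w = \<psi> x * (h \<bullet> w)" if x: "x \<in> S" for x h w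
  proof -
    let ?f = "\<lambda>x. 2 * \<mu> * (x \<bullet> h) * \<phi> x + q x * dd \<phi> x h - 2 * \<mu> * (h \<bullet> X x + x \<bullet> dd X x h)"
    have "(?f has_derivative (\<lambda>w. 2 * \<mu> * (w \<bullet> h) * \<phi> x + 2 * \<mu> * (x \<bullet> h) * dd \<phi> x w
        + 2 * \<mu> * (x \<bullet> w) * dd \<phi> x h + q x * dd (\<lambda>u. dd \<phi> u h) x w
        - 2 * \<mu> * (h \<bullet> dd X x w + w \<bullet> dd X x h + x \<bullet> dd (\<lambda>u. dd X u h) x w))) (at x)"
      by (rule derivative_eq_intros deriv_q Dphi[OF x] DX[OF x] smooth_on_has_derivative[OF smooth_on_dd[OF smooth_phi] x]
            smooth_on_has_derivative[OF smooth_on_dd[OF smooth_X] x] refl)+ (simp add: fun_eq_iff algebra_simps)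
    from derivative_zero_of_const[OF S(1) x this, of 0 w] have e: "2 * \<mu> * (w \<bullet> h) * \<phi> x + 2 * \<mu> * (x \<bullet> h) * dd \<phi> x w
        + 2 * \<mu> * (x \<bullet> w) * dd \<phi> x h + q x * dd (\<lambda>u. dd \<phi> u h) x w
        - 2 * \<mu> * (h \<bullet> dd X x w + w \<bullet> dd X x h + x \<bullet> dd (\<lambda>u. dd X u h) x w) = 0"
      using d1 by simp
    have pol: "h \<bullet> dd X x w + w \<bullet> dd X x h = 2 * \<phi> x * (h \<bullet> w)"
      using conf_phi[OF x, of "h + w"] conf_phi[OF x, of h] conf_phi[OF x, of w] linear_add[OF smooth_on_linear[OF smooth_X x]]
      by (simp add: inner_simps inner_commute algebra_simps)
    have "q x * dd (\<lambda>u. dd \<phi> u h) x w = 2 * \<mu> * (\<phi> x - dd \<phi> x x) * (h \<bullet> w)"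
      using e second_X[OF x, of x h w] pol by (simp add: inner_commute algebra_simps)
    then show ?thesis using qp[OF x] by (simp add: \<psi>_def field_simps)
  qed
  have smooth_dphix: "smooth_on S (\<lambda>x. dd \<phi> x x)"
  proof (rule smooth_on_cong[OF S(1)])
    show "dd \<phi> x x = (\<Sum>i\<in>UNIV. x $ i *\<^sub>R dd \<phi> x (axis i 1))" if "x \<in> S" for x
      by (rule linear_eq_sum_axis[OF lin[OF that]])
    show "smooth_on S (\<lambda>x. \<Sum>i\<in>UNIV. x $ i *\<^sub>R dd \<phi> x (axis i 1))"
      by (intro smooth_on_sum smooth_on_scaleR smooth_on_vec_nth smooth_on_ident smooth_on_dd smooth_phi S)
  qed
  have smooth_psi: "smooth_on S \<psi>" unfolding \<psi>_def
    by (intro smooth_on_divide smooth_on_mult smooth_on_diff smooth_on_const smooth_dphix smooth_phi smooth_q S)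
       (use qp in force)
  have psi': "dd \<psi> x h = 0" if x: "x \<in> S" for x h
  proof (rule covector_zero[where g = "(\<bullet>)" and \<nu> = "dd \<psi> x"])
    show "bilinear ((\<bullet>) :: real^'n \<Rightarrow> _)" by (auto simp: bilinear_def inner_simps intro!: linearI)
    show "linear (dd \<psi> x)" by (rule smooth_on_linear[OF smooth_psi x])
    fix v y z :: "real^'n"
    have D: "dd (\<lambda>u. dd (\<lambda>u. dd \<phi> u z) u w) x v = dd \<psi> x v * (z \<bullet> w)" for w v
    proof -
      have "((\<lambda>u. \<psi> u * (z \<bullet> w)) has_derivative (\<lambda>v. dd \<psi> x v * (z \<bullet> w))) (at x)"
        by (intro has_derivative_mult_left smooth_on_has_derivative[OF smooth_psi x])
      then have "((\<lambda>u. dd (\<lambda>u. dd \<phi> u z) u w) has_derivative (\<lambda>v. dd \<psi> x v * (z \<bullet> w))) (at x)"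
        by (rule has_derivative_transform_within_open[OF _ S(1) x]) (simp add: d2)
      then show ?thesis by (simp add: dd_eq)
    qed
    show "dd \<psi> x v * (y \<bullet> z) = dd \<psi> x y * (v \<bullet> z)"
      using second_derivative_sym[OF S(1) smooth_on_dd[OF smooth_phi] x, of z y v] unfolding D
      by (simp add: inner_commute)
  qed (use dim in \<open>auto simp: inner_commute\<close>)
  have psi_x: "\<psi> x * (x \<bullet> w) = 0" if x: "x \<in> S" for x w
  proof -
    have "((\<lambda>u. dd \<phi> u u) has_derivative (\<lambda>w. \<psi> x * (x \<bullet> w) + dd \<phi> x w)) (at x)"
    proof -
      have "((\<lambda>u. \<Sum>i\<in>UNIV. u $ i * dd \<phi> u (axis i 1)) has_derivative
          (\<lambda>w. \<Sum>i\<in>UNIV. x $ i * dd (\<lambda>u. dd \<phi> u (axis i 1)) x w + w $ i * dd \<phi> x (axis i 1))) (at x)"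
        by (intro has_derivative_sum has_derivative_mult smooth_on_has_derivative[OF smooth_on_dd[OF smooth_phi] x]
            bounded_linear_imp_has_derivative bounded_linear_vec_nth)
      then have "((\<lambda>u. dd \<phi> u u) has_derivative
          (\<lambda>w. \<Sum>i\<in>UNIV. x $ i * dd (\<lambda>u. dd \<phi> u (axis i 1)) x w + w $ i * dd \<phi> x (axis i 1))) (at x)"
        by (rule has_derivative_transform_within_open[OF _ S(1) x])
           (use linear_eq_sum_axis[OF lin] in \<open>simp add: real_scaleR_def\<close>)
      moreover have "(\<Sum>i\<in>UNIV. x $ i * dd (\<lambda>u. dd \<phi> u (axis i 1)) x w + w $ i * dd \<phi> x (axis i 1))
        = \<psi> x * (x \<bullet> w) + dd \<phi> x w" for w
        using linear_eq_sum_axis[OF lin[OF x], of w]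
        by (simp add: d2[OF x] sum.distrib inner_axis' inner_vec_def[of x w] sum_distrib_left mult.left_commute)
      ultimately show ?thesis by simp
    qed
    then have "((\<lambda>x. q x * \<psi> x - 2 * \<mu> * (\<phi> x - dd \<phi> x x)) has_derivative
      (\<lambda>w. 2 * \<mu> * (x \<bullet> w) * \<psi> x + q x * dd \<psi> x w - 2 * \<mu> * (dd \<phi> x w - (\<psi> x * (x \<bullet> w) + dd \<phi> x w)))) (at x)"
      by (auto intro!: derivative_eq_intros deriv_q smooth_on_has_derivative[OF smooth_psi x] Dphi[OF x] simp: algebra_simps)
    from derivative_zero_of_const[OF S(1) x this, of 0 w] have "2 * \<mu> * (x \<bullet> w) * \<psi> x + q x * dd \<psi> x w - 2 * \<mu> * (dd \<phi> x w - (\<psi> x * (x \<bullet> w) + dd \<phi> x w)) = 0"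
      using qp by (force simp: \<psi>_def)
    then have "4 * (\<mu> * (\<psi> x * (x \<bullet> w))) = 0" by (simp add: psi'[OF x] algebra_simps)
    then show ?thesis using \<mu> by simp
  qed
  have psi0: "\<psi> x = 0" if x: "x \<in> S" for x
  proof -
    define h :: "real^'n" where "h = axis undefined 1"
    \<comment> \<open>At the origin \<open>psi_x\<close> gives no information on \<psi>, so it is
      differentiated once more.\<close>
    have "((\<lambda>x. \<psi> x * (x \<bullet> h)) has_derivative (\<lambda>w. \<psi> x * (w \<bullet> h) + dd \<psi> x w * (x \<bullet> h))) (at x)"
      by (intro has_derivative_mult smooth_on_has_derivative[OF smooth_psi x] has_derivative_inner_left has_derivative_ident)
    from derivative_zero_of_const[OF S(1) x this psi_x, of h] have "\<psi> x * (h \<bullet> h) = 0"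
      using psi'[OF x] by simp
    then show ?thesis by (simp add: h_def inner_axis_axis)
  qed
  have phi_x: "\<phi> x = dd \<phi> x x" if "x \<in> S" for x
    using psi0[OF that] qp[OF that] \<mu> by (simp add: \<psi>_def)
  have const: "dd \<phi> x h = dd \<phi> x0 h" if "x \<in> S" for x h
    using smooth_constant[OF S(1,2) smooth_on_dd[OF smooth_phi] _ that x0] d2 psi0 by simp
  define G :: "real^'n" where "G = (\<chi> i. dd \<phi> x0 (axis i 1))"
  have "dd \<phi> x0 x = G \<bullet> x" for x
    using linear_eq_sum_axis[OF lin[OF x0], of x] by (simp add: G_def inner_vec_def mult.commute)
  then show thesis using that phi_x const by metis
qed

lemma form_curved:
  assumes \<mu>: "\<mu> \<noteq> 0"
  shows "\<exists>\<gamma> Q. transpose Q = - Q \<and> \<gamma> \<bullet> e = 0 \<and> Q *v e = (- 2 * lam) *\<^sub>R \<gamma> \<and>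
    (\<forall>x\<in>S. X x = (2 * \<mu> * (\<gamma> \<bullet> x)) *\<^sub>R x + (1 - \<mu> * (norm x)\<^sup>2) *\<^sub>R \<gamma> + Q *v x)"
proof -
  obtain G where G: "\<And>x. x \<in> S \<Longrightarrow> \<phi> x = G \<bullet> x" using phi_linear[OF \<mu>] by blast
  \<comment> \<open>The quadratic field \<open>X0\<close> below has Euclidean factor 2 \<mu>
    (\<gamma> \<bullet> x), so this choice makes X - X0 a Euclidean Killing field. The part (1 -
    \<mu> |x|^2) \<gamma> makes \<open>X0\<close> itself satisfy q \<phi> = 2 \<mu> (x \<bullet>
    X0).\<close>
  define \<gamma> where "\<gamma> = (1 / (2 * \<mu>)) *\<^sub>R G"
  have G2: "G = (2 * \<mu>) *\<^sub>R \<gamma>" using \<mu> by (simp add: \<gamma>_def)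
  define X0 where "X0 x = (2 * \<mu> * (\<gamma> \<bullet> x)) *\<^sub>R x + (1 - \<mu> * (x \<bullet> x)) *\<^sub>R \<gamma>" for x
  have smooth_X0: "smooth_on S X0" unfolding X0_def
    by (intro smooth_on_add smooth_on_diff smooth_on_scaleR smooth_on_mult smooth_on_inner smooth_on_const smooth_on_ident S)
  have conf0: "y \<bullet> dd (\<lambda>x. X x - X0 x) x y = 0 * (y \<bullet> y)" if x: "x \<in> S" for x y
  proof -
    have "(X0 has_derivative (\<lambda>y. (2 * \<mu> * (\<gamma> \<bullet> y)) *\<^sub>R x + (2 * \<mu> * (\<gamma> \<bullet> x)) *\<^sub>R y - (2 * \<mu> * (x \<bullet> y)) *\<^sub>R \<gamma>)) (at x)"
      unfolding X0_def by (auto intro!: derivative_eq_intros simp: fun_eq_iff inner_commute algebra_simps)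
    from has_derivative_diff[OF smooth_on_has_derivative[OF smooth_X x] this]
    have D: "dd (\<lambda>x. X x - X0 x) x y = dd X x y - ((2 * \<mu> * (\<gamma> \<bullet> y)) *\<^sub>R x + (2 * \<mu> * (\<gamma> \<bullet> x)) *\<^sub>R y - (2 * \<mu> * (x \<bullet> y)) *\<^sub>R \<gamma>)"
      by (simp add: dd_eq)
    show ?thesis unfolding D using conf_phi[OF x, of y] G[OF x] by (simp add: G2 inner_simps inner_commute algebra_simps)
  qed
  obtain Q :: "real^'n^'n" and \<gamma>' where Q: "transpose Q = - Q" "\<And>x. x \<in> S \<Longrightarrow> X x - X0 x = 0 *\<^sub>R x + Q *v x + \<gamma>'"
    using homothetic_affine[OF S smooth_on_diff[OF S(1) smooth_X smooth_X0] conf0] by metis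
  have X: "X x = X0 x + Q *v x + \<gamma>'" if "x \<in> S" for x using Q(2)[OF that] by (simp add: algebra_simps)
  have xX0: "x \<bullet> X0 x = q x * (\<gamma> \<bullet> x)" for x
    by (simp add: X0_def q_def inner_simps inner_commute algebra_simps)
  \<comment> \<open>X and \<open>X0\<close> satisfy the same Killing relation with the same \<phi>,
    and Q x is orthogonal to x, so the translation part must be too.\<close>
  have "\<gamma>' \<bullet> x = 0" if x: "x \<in> S" for x
  proof -
    have "q x * (G \<bullet> x) = 2 * \<mu> * (x \<bullet> X x)"
      using phi[OF x] k_zero[OF _ x] \<mu> qp[OF x] G[OF x] by simp
    then have "2 * \<mu> * (\<gamma>' \<bullet> x) = 0"
      using X[OF x] xX0[of x] skew_inner(2)[OF Q(1), of x] by (simp add: G2 inner_simps inner_commute algebra_simps)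
    then show ?thesis using \<mu> by simp
  qed
  then have "\<gamma>' = 0" using quadratic_zero_on_open(1)[OF S(1,3), of 0 0 \<gamma>'] by simp
  then have X: "X x = X0 x + Q *v x" if "x \<in> S" for x using X[OF that] by simp
  have "(\<gamma> \<bullet> e) * (1 - \<mu> * (x \<bullet> x)) - ((2 * lam) *\<^sub>R \<gamma> + Q *v e) \<bullet> x = 0" if x: "x \<in> S" for x
  proof -
    have n: "q x \<noteq> 0" using qp[OF x] by simp
    have "(4 / (q x)\<^sup>2) * (- (2 * (lam + \<mu> * (e \<bullet> x))) * (x \<bullet> X x) + q x * (e \<bullet> X x)) = 0"
      using R_X_zero[OF _ x] \<mu> by (simp add: R q_def inner_simps)
    then have "- (2 * (lam + \<mu> * (e \<bullet> x))) * (x \<bullet> X x) + q x * (e \<bullet> X x) = 0" using n by simp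
    moreover have "x \<bullet> X x = q x * (\<gamma> \<bullet> x)" using X[OF x] xX0[of x] skew_inner(2)[OF Q(1), of x] by (simp add: inner_simps)
    ultimately have "q x * (- (2 * (lam + \<mu> * (e \<bullet> x))) * (\<gamma> \<bullet> x) + e \<bullet> X x) = 0" by (simp add: algebra_simps)
    then have "- (2 * (lam + \<mu> * (e \<bullet> x))) * (\<gamma> \<bullet> x) + e \<bullet> X x = 0" using n by simp
    then show ?thesis using X[OF x] skew_inner(1)[OF Q(1), of e x]
      by (simp add: X0_def inner_simps inner_commute algebra_simps)
  qed
  from quadratic_zero_on_open[OF S(1,3) this]
  have "(2 * lam) *\<^sub>R \<gamma> + Q *v e = 0" "\<gamma> \<bullet> e = 0" by auto
  moreover from this(1) have "Q *v e = (- 2 * lam) *\<^sub>R \<gamma>" by (simp add: add_eq_0_iff)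
  ultimately show ?thesis using X Q(1)
    by (intro exI[of _ \<gamma>] exI[of _ Q]) (simp add: X0_def power2_norm_eq_inner)
qed

end

section \<open>Conformal fields of Randers metrics\<close>

lemma has_derivative_slice:
  assumes "(f has_derivative f') (at (t, z))"
  shows "((\<lambda>z. f (t, z)) has_derivative (\<lambda>h. f' (0, h))) (at z)"
proof -
  have "((\<lambda>z. (t, z)) has_derivative (\<lambda>h. (0, h))) (at z)" by (auto intro!: derivative_eq_intros)
  from has_derivative_compose[OF this, of f f'] assms show ?thesis by simp
qed

context randers_mfd
begin

text \<open>Replacing y by -y preserves \<alpha> and reverses \<beta>, so a linear map that scales F
  must scale both parts by the same factor.\<close>

lemma randers_parts:
  assumes C: "C \<in> A" and x: "x \<in> crange C" and x': "x' \<in> crange C" and lin: "linear M"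
    and F: "\<And>y. F C x' (M y) = r * F C x y" and r: "r > 0"
  shows "b C x' \<bullet> M y = r * (b C x \<bullet> y)" "M y \<bullet> (a C x' *v M y) = r\<^sup>2 * (y \<bullet> (a C x *v y))"
proof -
  have quad: "y \<bullet> (a C z *v y) \<ge> 0" if "z \<in> crange C" for z y
    using pos_a[OF C that, of y] by (cases "y = 0") auto
  have neg: "alpha_norm (a C z) (- y) = alpha_norm (a C z) y" for z y
    by (simp add: alpha_norm_def vec.neg)
  have 1: "alpha_norm (a C x') (M y) + b C x' \<bullet> M y = r * (alpha_norm (a C x) y + b C x \<bullet> y)"
    using F[of y] unfolding randers_F[OF C x] randers_F[OF C x'] .
  have 2: "alpha_norm (a C x') (M y) - b C x' \<bullet> M y = r * (alpha_norm (a C x) y - b C x \<bullet> y)"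
    using F[of "- y"] unfolding randers_F[OF C x] randers_F[OF C x'] linear_neg[OF lin] neg by simp
  show "b C x' \<bullet> M y = r * (b C x \<bullet> y)" using 1 2 by (simp add: algebra_simps)
  have "alpha_norm (a C x') (M y) = r * alpha_norm (a C x) y" using 1 2 by (simp add: algebra_simps)
  then have "(alpha_norm (a C x') (M y))\<^sup>2 = r\<^sup>2 * (alpha_norm (a C x) y)\<^sup>2" by (simp add: power_mult_distrib)
  then show "M y \<bullet> (a C x' *v M y) = r\<^sup>2 * (y \<bullet> (a C x *v y))"
    using quad[OF x] quad[OF x'] by (simp add: alpha_norm_def)
qed

text \<open>
  The flow is transported to the chart \<open>D\<close> and its prolongation is differentiated at \<open>t = 0\<close>;
  \<open>\<Psi>\<close> is the flow in \<open>D\<close>, and the derivative of \<open>d\<Psi>\<close> in \<open>t\<close> is that of \<open>V\<close> in \<open>x\<close> since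
  second derivatives commute.
\<close>

lemma conformal_lie:
  assumes cf: "conformal_field A F V \<kappa>" and D: "D \<in> A" and p: "p \<in> fst D"
  shows "dd (b D) (snd D p) (V D (snd D p)) \<bullet> y + b D (snd D p) \<bullet> dd (V D) (snd D p) y
      = - 2 * \<kappa> p * (b D (snd D p) \<bullet> y)" (is ?thesis1)
    and "y \<bullet> (dd (a D) (snd D p) (V D (snd D p)) *v y) + 2 * (y \<bullet> (a D (snd D p) *v dd (V D) (snd D p) y))
      = - 4 * \<kappa> p * (y \<bullet> (a D (snd D p) *v y))" (is ?thesis2)
proof -
  have VD: "smooth_on (crange D) (V D)"
    and trV: "\<And>C D p. C \<in> A \<Longrightarrow> D \<in> A \<Longrightarrow> p \<in> fst C \<Longrightarrow> p \<in> fst D \<Longrightarrow> V D (snd D p) = dtrans C D p (V C (snd C p))"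
    using cf D unfolding conformal_field_def vector_field_def by blast+
  obtain C U \<epsilon> \<Phi> \<sigma> where C: "C \<in> A" and U: "open U" "p \<in> U" "U \<subseteq> fst C" and \<epsilon>: "\<epsilon> > 0"
    and smPhi: "smooth_on ({-\<epsilon><..<\<epsilon>} \<times> snd C ` U) (\<lambda>(t, x). \<Phi> t x)"
    and Phi0: "\<And>x. x \<in> snd C ` U \<Longrightarrow> \<Phi> 0 x = x"
    and Phi': "\<And>t x. t \<in> {-\<epsilon><..<\<epsilon>} \<Longrightarrow> x \<in> snd C ` U \<Longrightarrow> ((\<lambda>s. \<Phi> s x) has_vector_derivative V C (\<Phi> t x)) (at t)"
    and PhiF: "\<And>t x y. t \<in> {-\<epsilon><..<\<epsilon>} \<Longrightarrow> x \<in> snd C ` U \<Longrightarrow>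
       F C (\<Phi> t x) (dd (\<Phi> t) x y) = exp (- 2 * \<sigma> t x) * F C x y"
    and sig: "\<And>q. q \<in> U \<Longrightarrow> ((\<lambda>t. \<sigma> t (snd C q)) has_real_derivative \<kappa> q) (at 0)"
  proof -
    from cf[unfolded conformal_field_def, THEN conjunct2, rule_format, of p] show thesis
    proof (elim bexE exE conjE, goal_cases)
      case (1 C U \<epsilon> \<Phi> \<sigma>)
      show thesis by (rule that[of C U \<epsilon> \<Phi> \<sigma>]) (use 1 in blast)+
    qed
  qed
  let ?I = "{-\<epsilon><..<\<epsilon>}"
  define U' where "U' = U \<inter> fst D"
  define O' where "O' = snd D ` U'"
  have oU': "open U'" "p \<in> U'" using U p open_dom[OF D] by (auto simp: U'_def)
  have oO': "open O'" unfolding O'_def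
    by (rule chart_open_image[OF is_chart[OF D] oU'(1)]) (auto simp: U'_def)
  have oCU: "open (snd C ` U)" by (rule chart_open_image[OF is_chart[OF C] U(1,3)])
  have oI: "open ?I" "0 \<in> ?I" using \<epsilon> by auto
  let ?T = "transition C D" and ?T' = "transition D C"
  have T': "?T' z \<in> snd C ` U" if "z \<in> O'" for z
    using that transition_apply[OF D, of _ C] by (auto simp: O'_def U'_def)
  define \<Theta> where "\<Theta> = (\<lambda>(t, z). \<Phi> t (?T' z))"
  have smT': "smooth_on O' ?T'"
    by (rule smooth_on_subset[OF smooth_transition[OF D C]]) (use U(3) in \<open>auto simp: O'_def U'_def\<close>)
  have smTheta: "smooth_on (?I \<times> O') \<Theta>"
  proof -
    have o: "open (?I \<times> O')" "open (?I \<times> snd C ` U)" using oI oO' oCU by (auto intro: open_Times)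
    have s: "smooth_on (?I \<times> O') (\<lambda>w. ?T' (snd w))"
      by (rule smooth_on_compose[OF o(1) oO' _ smooth_on_bounded_linear[OF o(1) bounded_linear_snd smooth_on_ident[OF o(1)]] smT']) auto
    have "smooth_on (?I \<times> O') (\<lambda>w. (fst w, ?T' (snd w)))"
      by (intro smooth_on_Pair s o smooth_on_bounded_linear[OF o(1) bounded_linear_fst smooth_on_ident[OF o(1)]])
    moreover have "(\<lambda>w. (fst w, ?T' (snd w))) ` (?I \<times> O') \<subseteq> ?I \<times> snd C ` U" using T' by auto
    ultimately have "smooth_on (?I \<times> O') (\<lambda>w. (\<lambda>(t, x). \<Phi> t x) (fst w, ?T' (snd w)))"
      using smooth_on_compose[OF o _ _ smPhi] by blast
    then show ?thesis unfolding \<Theta>_def by (simp add: case_prod_unfold)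
  qed
  \<comment> \<open>The flow is given in C and may leave the domain of D; this is the open set of
    times and points for which its value can still be read in D.\<close>
  define \<Omega> where "\<Omega> = \<Theta> -` (snd C ` (fst C \<inter> fst D)) \<inter> (?I \<times> O')"
  have o\<Omega>: "open \<Omega>"
    unfolding \<Omega>_def using continuous_on_open_vimage[of "?I \<times> O'" \<Theta>] smooth_on_continuous[OF smTheta]
      open_overlap[OF C D] open_Times[OF oI(1) oO'] by blast
  define \<Psi> where "\<Psi> = (\<lambda>w. ?T (\<Theta> w))"
  have smPsi: "smooth_on \<Omega> \<Psi>" unfolding \<Psi>_def
    by (rule smooth_on_compose[OF o\<Omega> open_overlap[OF C D] _ smooth_on_subset[OF smTheta] smooth_transition[OF C D]])
       (auto simp: \<Omega>_def)
  have zero: "(0, snd D r) \<in> \<Omega>" "\<Psi> (0, snd D r) = snd D r" if r: "r \<in> U'" for r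
  proof -
    have r': "r \<in> U" "r \<in> fst C" "r \<in> fst D" using r U(3) by (auto simp: U'_def)
    then have "\<Theta> (0, snd D r) = snd C r"
      using transition_apply[OF D r'(3), of C] Phi0 by (simp add: \<Theta>_def)
    then show "(0, snd D r) \<in> \<Omega>" "\<Psi> (0, snd D r) = snd D r"
      using r r' oI transition_apply[OF C r'(2), of D] by (auto simp: \<Omega>_def \<Psi>_def O'_def)
  qed
  have dPsi: "(\<Psi> has_derivative dd \<Psi> w) (at w)" if "w \<in> \<Omega>" for w
    by (rule smooth_on_has_derivative[OF smPsi that])
  have velocity: "dd \<Psi> (0, z) (1, 0) = V D z" if z: "z \<in> O'" for z
  proof -
    obtain r where r: "r \<in> U'" "z = snd D r" using z by (auto simp: O'_def)
    have r': "r \<in> U" "r \<in> fst C" "r \<in> fst D" using r U(3) by (auto simp: U'_def)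
    have T'z: "?T' z = snd C r" using transition_apply[OF D r'(3)] r(2) by simp
    have "((\<lambda>s. \<Phi> s (snd C r)) has_derivative (\<lambda>s. s *\<^sub>R V C (snd C r))) (at 0)"
      using Phi'[OF oI(2), of "snd C r"] Phi0[of "snd C r"] r'(1) by (simp add: has_vector_derivative_def)
    from has_derivative_compose[OF this, of ?T "dtrans C D r"]
    have "((\<lambda>s. ?T (\<Phi> s (snd C r))) has_derivative (\<lambda>s. dtrans C D r (s *\<^sub>R V C (snd C r)))) (at 0)"
      using deriv_transition[OF C D r'(2,3)] Phi0[of "snd C r"] r'(1) by simp
    moreover have "((\<lambda>t. \<Psi> ((0, z) + t *\<^sub>R (1, 0))) has_vector_derivative dd \<Psi> (0, z) (1, 0)) (at 0)"
      by (rule has_vector_derivative_line) (use dPsi[OF zero(1)[OF r(1)]] r(2) in simp)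
    ultimately have "(\<lambda>s. dtrans C D r (s *\<^sub>R V C (snd C r))) = (\<lambda>s. s *\<^sub>R dd \<Psi> (0, z) (1, 0))"
      by (intro has_derivative_unique) (simp_all add: \<Psi>_def \<Theta>_def T'z has_vector_derivative_def)
    from fun_cong[OF this, of 1] show ?thesis using trV[OF C D r'(2,3)] r(2) by simp
  qed
  define x where "x = snd D p"
  have xO: "x \<in> O'" using oU'(2) by (simp add: x_def O'_def)
  have xC: "x \<in> crange D" using p by (auto simp: x_def)
  have T'x: "?T' x = snd C p" using transition_apply[OF D p] by (simp add: x_def)
  define M where "M t y = dd \<Psi> (t, x) (0, y)" for t y
  define P where "P t = \<Psi> (t, x)" for t
  define J where "J = (\<lambda>t. (t, x)) -` \<Omega>"
  have oJ: "open J" "0 \<in> J"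
    unfolding J_def using zero(1)[OF oU'(2)] o\<Omega> by (auto intro!: open_vimage continuous_intros simp: x_def)
  have linM: "linear (M t)" if "t \<in> J" for t
  proof -
    have l: "linear (dd \<Psi> (t, x))" by (rule smooth_on_linear[OF smPsi]) (use that in \<open>simp add: J_def\<close>)
    show ?thesis
      unfolding M_def using linear_add[OF l, of "(0, _)" "(0, _)"] linear_scale[OF l, of _ "(0, _)"]
      by (intro linearI) simp_all
  qed
  define s where "s t = exp (- 2 * \<sigma> t (snd C p))" for t
  have FM: "P t \<in> crange D" "F D (P t) (M t y) = s t * F D x y" if t: "t \<in> J" for t y
  proof -
    have tO: "(t, x) \<in> \<Omega>" using t by (simp add: J_def)
    then have tI: "t \<in> ?I" by (simp add: \<Omega>_def)
    have pC: "p \<in> fst C" "snd C p \<in> snd C ` U" using U by auto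
    obtain q where q: "q \<in> fst C" "q \<in> fst D" "\<Phi> t (snd C p) = snd C q"
      using tO T'x by (auto simp: \<Omega>_def \<Theta>_def)
    have Pt: "P t = snd D q" using transition_apply[OF C q(1)] q(3) by (simp add: P_def \<Psi>_def \<Theta>_def T'x)
    then show "P t \<in> crange D" using q(2) by auto
    have dPhi: "(\<Phi> t has_derivative dd (\<Phi> t) (snd C p)) (at (snd C p))"
    proof -
      have "(t, snd C p) \<in> ?I \<times> snd C ` U" using tI pC(2) by simp
      from has_derivative_slice[OF smooth_on_has_derivative[OF smPhi this]]
      have "\<Phi> t differentiable (at (snd C p))" by (auto simp: differentiable_def)
      then show ?thesis by (simp add: frechet_derivative_works)
    qed
    have "((\<lambda>z. \<Psi> (t, z)) has_derivative (\<lambda>h. dd \<Psi> (t, x) (0, h))) (at x)"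
      by (rule has_derivative_slice[OF dPsi[OF tO]])
    moreover have "((\<lambda>z. \<Psi> (t, z)) has_derivative (\<lambda>h. dtrans C D q (dd (\<Phi> t) (snd C p) (dtrans D C p h)))) (at x)"
    proof -
      have 1: "(?T' has_derivative dtrans D C p) (at x)" using deriv_transition[OF D C p pC(1)] by (simp add: x_def)
      have 2: "((\<lambda>z. \<Phi> t (?T' z)) has_derivative (\<lambda>h. dd (\<Phi> t) (snd C p) (dtrans D C p h))) (at x)"
        by (rule has_derivative_compose[OF 1]) (use dPhi T'x in simp)
      have "((\<lambda>z. ?T (\<Phi> t (?T' z))) has_derivative (\<lambda>h. dtrans C D q (dd (\<Phi> t) (snd C p) (dtrans D C p h)))) (at x)"
        by (rule has_derivative_compose[OF 2]) (use deriv_transition[OF C D q(1,2)] T'x q(3) in simp)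
      then show ?thesis by (simp add: \<Psi>_def \<Theta>_def)
    qed
    ultimately have "M t y = dtrans C D q (dd (\<Phi> t) (snd C p) (dtrans D C p y))"
      unfolding M_def by (rule has_derivative_unique[THEN fun_cong])
    then have "F D (P t) (M t y) = F C (\<Phi> t (snd C p)) (dd (\<Phi> t) (snd C p) (dtrans D C p y))"
      using trans_F[OF C D q(1,2)] by (simp add: Pt q(3))
    also have "\<dots> = s t * F C (snd C p) (dtrans D C p y)" unfolding s_def by (rule PhiF[OF tI pC(2)])
    also have "F C (snd C p) (dtrans D C p y) = F D x y" using trans_F[OF D C p pC(1)] by (simp add: x_def)
    finally show "F D (P t) (M t y) = s t * F D x y" .
  qed
  have parts: "b D (P t) \<bullet> M t y = s t * (b D x \<bullet> y)" "M t y \<bullet> (a D (P t) *v M t y) = (s t)\<^sup>2 * (y \<bullet> (a D x *v y))"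
    if "t \<in> J" for t y
    using randers_parts[OF D xC FM(1)[OF that] linM[OF that] FM(2)[OF that]] by (simp_all add: s_def)
  have P0: "P 0 = x" using zero(2)[OF oU'(2)] by (simp add: P_def x_def)
  have M0: "M 0 y = y" for y
  proof -
    have "((\<lambda>z. \<Psi> (0, z)) has_derivative M 0) (at x)"
      unfolding M_def by (rule has_derivative_slice[OF dPsi]) (use oJ(2) in \<open>simp add: J_def\<close>)
    moreover have "((\<lambda>z. \<Psi> (0, z)) has_derivative (\<lambda>h. h)) (at x)"
      by (rule has_derivative_transform_within_open[OF has_derivative_ident oO' xO]) (use zero(2) in \<open>auto simp: O'_def\<close>)
    ultimately show ?thesis using has_derivative_unique fun_cong by metis
  qed
  \<comment> \<open>The definition does not prescribe \<sigma> at time 0. The prolonged flow is the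
    identity there, so comparing the norm of one nonzero vector with itself gives the scale factor
    1.\<close>
  have s0: "s 0 = 1"
  proof -
    define v :: "real^'n" where "v = axis undefined 1"
    have "v \<bullet> (a D x *v v) > 0" by (rule pos_a[OF D xC]) (simp add: v_def axis_eq_0_iff)
    moreover have "(s 0)\<^sup>2 * (v \<bullet> (a D x *v v)) = v \<bullet> (a D x *v v)"
      using parts(2)[OF oJ(2), of v] by (simp add: P0 M0)
    ultimately have "(s 0)\<^sup>2 = 1" by simp
    moreover have "s 0 > 0" by (simp add: s_def)
    ultimately show ?thesis by (simp add: power2_eq_1_iff)
  qed
  have s': "(s has_derivative (\<lambda>t. t * (- 2 * \<kappa> p))) (at 0)"
  proof -
    have "(s has_real_derivative exp (- 2 * \<sigma> 0 (snd C p)) * (- 2 * \<kappa> p)) (at 0)"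
      unfolding s_def by (auto intro!: derivative_eq_intros sig[OF U(2)])
    then have "(s has_derivative (*) (s 0 * (- 2 * \<kappa> p))) (at 0)"
      unfolding has_field_derivative_def s_def .
    then show ?thesis by (rule has_derivative_eq_rhs) (simp add: s0 fun_eq_iff)
  qed
  have P': "(P has_derivative (\<lambda>t. t *\<^sub>R V D x)) (at 0)"
  proof -
    have "((\<lambda>t. \<Psi> ((0, x) + t *\<^sub>R (1, 0))) has_vector_derivative dd \<Psi> (0, x) (1, 0)) (at 0)"
      by (rule has_vector_derivative_line) (use dPsi oJ(2) in \<open>simp add: J_def\<close>)
    then show ?thesis by (simp add: has_vector_derivative_def velocity[OF xO] P_def[abs_def])
  qed
  have M': "((\<lambda>t. M t y) has_derivative (\<lambda>t. t *\<^sub>R dd (V D) x y)) (at 0)" for y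
  proof -
    have w: "(0, x) \<in> \<Omega>" using oJ(2) by (simp add: J_def)
    have "((\<lambda>t. dd \<Psi> ((0, x) + t *\<^sub>R (1, 0)) (0, y)) has_vector_derivative dd (\<lambda>w. dd \<Psi> w (0, y)) (0, x) (1, 0)) (at 0)"
      by (rule has_vector_derivative_line) (use smooth_on_has_derivative[OF smooth_on_dd[OF smPsi] w] in simp)
    moreover have "dd (\<lambda>w. dd \<Psi> w (0, y)) (0, x) (1, 0) = dd (V D) x y"
    proof -
      have "((\<lambda>z. dd \<Psi> (0, z) (1, 0)) has_derivative (\<lambda>h. dd (\<lambda>w. dd \<Psi> w (1, 0)) (0, x) (0, h))) (at x)"
        by (rule has_derivative_slice[OF smooth_on_has_derivative[OF smooth_on_dd[OF smPsi] w]])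
      then have "(V D has_derivative (\<lambda>h. dd (\<lambda>w. dd \<Psi> w (1, 0)) (0, x) (0, h))) (at x)"
        by (rule has_derivative_transform_within_open[OF _ oO' xO]) (rule velocity)
      then have "dd (V D) x y = dd (\<lambda>w. dd \<Psi> w (1, 0)) (0, x) (0, y)" by (simp add: dd_eq)
      then show ?thesis using second_derivative_sym[OF o\<Omega> smPsi w] by simp
    qed
    ultimately show ?thesis by (simp add: has_vector_derivative_def M_def)
  qed
  have b': "((\<lambda>t. b D (P t)) has_derivative (\<lambda>t. dd (b D) x (t *\<^sub>R V D x))) (at 0)"
    by (rule has_derivative_compose[OF P']) (use smooth_on_has_derivative[OF smooth_b[OF D] xC] P0 in simp)
  have a': "((\<lambda>t. a D (P t)) has_derivative (\<lambda>t. dd (a D) x (t *\<^sub>R V D x))) (at 0)"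
    by (rule has_derivative_compose[OF P']) (use smooth_on_has_derivative[OF smooth_a[OF D] xC] P0 in simp)
  have 1: "((\<lambda>t. b D (P t) \<bullet> M t y) has_derivative
      (\<lambda>t. b D x \<bullet> (t *\<^sub>R dd (V D) x y) + dd (b D) x (t *\<^sub>R V D x) \<bullet> y)) (at 0)"
    using has_derivative_inner[OF b' M'[of y]] by (simp add: P0 M0)
  have "((\<lambda>t. b D (P t) \<bullet> M t y) has_derivative (\<lambda>t. t * (- 2 * \<kappa> p) * (b D x \<bullet> y))) (at 0)"
    by (rule has_derivative_transform_within_open[OF has_derivative_mult_left[OF s'] oJ]) (simp add: parts)
  from fun_cong[OF has_derivative_unique[OF 1 this], of 1] show ?thesis1 by (simp add: x_def)
  have 2: "((\<lambda>t. M t y \<bullet> (a D (P t) *v M t y)) has_derivative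
      (\<lambda>t. y \<bullet> (a D x *v (t *\<^sub>R dd (V D) x y) + dd (a D) x (t *\<^sub>R V D x) *v y) + (t *\<^sub>R dd (V D) x y) \<bullet> (a D x *v y))) (at 0)"
    using has_derivative_inner[OF M'[of y] bounded_bilinear.FDERIV[OF bounded_bilinear_matrix_vector a' M'[of y]]] by (simp add: P0 M0)
  have s2: "((\<lambda>t. (s t)\<^sup>2 * (y \<bullet> (a D x *v y))) has_derivative (\<lambda>t. t * (- 4 * \<kappa> p) * (y \<bullet> (a D x *v y)))) (at 0)"
    by (auto intro!: derivative_eq_intros s' simp: s0)
  have "((\<lambda>t. M t y \<bullet> (a D (P t) *v M t y)) has_derivative (\<lambda>t. t * (- 4 * \<kappa> p) * (y \<bullet> (a D x *v y)))) (at 0)"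
    by (rule has_derivative_transform_within_open[OF s2 oJ]) (simp add: parts)
  from fun_cong[OF has_derivative_unique[OF 2 this], of 1]
  have "y \<bullet> (a D x *v dd (V D) x y + dd (a D) x (V D x) *v y) + dd (V D) x y \<bullet> (a D x *v y) = - 4 * \<kappa> p * (y \<bullet> (a D x *v y))"
    by simp
  moreover have "dd (V D) x y \<bullet> (a D x *v y) = y \<bullet> (a D x *v dd (V D) x y)"
    using sym_a[OF D xC] by (metis dot_lmul_matrix inner_commute vector_transpose_matrix)
  ultimately show ?thesis2 by (simp add: inner_add_right x_def)
qed

text \<open>\<open>conformal_lie\<close> concerns \<beta>, the locale concerns \<rho>. They are
  related by \<beta> = \<rho> / sqrt (1 + |\<rho>|^2), and the Lie derivative equation carries over
  once |\<rho>|^2 is known to be constant along V.\<close>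

lemma normal_field:
  assumes cf: "conformal_field A F V \<kappa>" and n: "CARD('n) \<ge> 2" and D: "D \<in> A" and conn: "connected (fst D)"
    and ne: "fst D \<noteq> {}" and nf: "pair_normal_form a b D lam \<mu> e"
  shows "normal_field (crange D) (V D) (\<lambda>x. \<kappa> (inv_into (fst D) (snd D) x)) lam \<mu> e
    (\<lambda>x. (4 / (1 + \<mu> * (x \<bullet> x))\<^sup>2) *\<^sub>R (- (2 * (lam + \<mu> * (e \<bullet> x))) *\<^sub>R x + (1 + \<mu> * (x \<bullet> x)) *\<^sub>R e))"
    (is "normal_field _ _ ?k _ _ _ ?R")
proof -
  let ?S = "crange D"
  define q where "q x = 1 + \<mu> * (x \<bullet> x)" for x :: "real^'n"
  define R where "R = ?R"
  have oS: "open ?S" by (rule open_crange[OF D])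
  have R_inner: "R x \<bullet> y = 4 / (q x)\<^sup>2 * (- 2 * (lam + \<mu> * (e \<bullet> x)) * (x \<bullet> y) + q x * (e \<bullet> y))" for x y
    by (simp add: R_def q_def inner_simps)
  have alpha: "alpha_norm (a D x) y = 2 / q x * norm y"
    and rhoR: "(b D x \<bullet> y) / sqrt (1 - conorm2 (a D x) (b D x)) = R x \<bullet> y" if "x \<in> ?S" for x y
    using nf that unfolding pair_normal_form_def R_inner q_def power2_norm_eq_inner by blast+
  have qp: "q x > 0" if x: "x \<in> ?S" for x
  proof -
    define v :: "real^'n" where "v = axis undefined 1"
    have "alpha_norm (a D x) v > 0"
      using pos_a[OF D x, of v] by (simp add: alpha_norm_def v_def axis_eq_0_iff)
    then show ?thesis unfolding alpha[OF x] by (simp add: v_def zero_less_divide_iff)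
  qed
  have aq: "y \<bullet> (a D x *v y) = 4 / (q x)\<^sup>2 * (y \<bullet> y)" if x: "x \<in> ?S" for x y
  proof -
    have "y \<bullet> (a D x *v y) \<ge> 0" using pos_a[OF D x, of y] by (cases "y = 0") auto
    then have "y \<bullet> (a D x *v y) = (alpha_norm (a D x) y)\<^sup>2" by (simp add: alpha_norm_def)
    then show ?thesis unfolding alpha[OF x] by (simp add: power_mult_distrib power_divide power2_norm_eq_inner)
  qed
  have aI: "a D x *v z = (4 / (q x)\<^sup>2) *\<^sub>R z" if x: "x \<in> ?S" for x z
  proof -
    have sym: "y \<bullet> (a D x *v z) = z \<bullet> (a D x *v y)" for y z
      using sym_a[OF D x] by (metis dot_lmul_matrix inner_commute vector_transpose_matrix)
    have "y \<bullet> (a D x *v z) = y \<bullet> ((4 / (q x)\<^sup>2) *\<^sub>R z)" for y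
      using aq[OF x, of "y + z"] aq[OF x, of y] aq[OF x, of z] sym[of z y]
      by (simp add: matrix_vector_right_distrib inner_simps inner_commute[of z y] add_divide_distrib)
    then show ?thesis using vector_eq_ldot by blast
  qed
  \<comment> \<open>\<open>N\<close> is the squared h-norm of \<rho>. From \<beta> = sqrt (1 - b^2)
    \<rho> follows b^2 = N / (1 + N), hence the factor \<open>f\<close> between \<rho> and
    \<beta>.\<close>
  define N where "N x = (R x \<bullet> R x) * (q x)\<^sup>2 / 4" for x
  define f where "f x = 1 / sqrt (1 + N x)" for x
  have Np: "1 + N x > 0" for x
    unfolding N_def by (smt (verit) inner_ge_zero mult_nonneg_nonneg zero_le_divide_iff zero_le_power2)
  have bR: "b D x = f x *\<^sub>R R x" if x: "x \<in> ?S" for x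
  proof -
    define m where "m = conorm2 (a D x) (b D x)"
    have m: "m < 1" unfolding m_def by (rule conorm_less[OF D x])
    have "b D x \<bullet> y = (sqrt (1 - m) *\<^sub>R R x) \<bullet> y" for y
      using rhoR[OF x, of y] m by (simp add: m_def field_simps)
    then have bs: "b D x = sqrt (1 - m) *\<^sub>R R x" using vector_eq_rdot by blast
    have "m = (q x)\<^sup>2 / 4 * (b D x \<bullet> b D x)"
    proof -
      have inv: "invertible (a D x)" by (rule invertible_pos_def[OF pos_a[OF D x]])
      have "a D x *v (((q x)\<^sup>2 / 4) *\<^sub>R b D x) = b D x"
        unfolding aI[OF x] using qp[OF x] by simp
      then have "matrix_inv (a D x) *v b D x = ((q x)\<^sup>2 / 4) *\<^sub>R b D x"
        using matrix_inv_left[OF inv] by (metis matrix_vector_mul_assoc matrix_vector_mul_lid)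
      then show ?thesis by (simp add: m_def conorm2_def)
    qed
    then have "m = (1 - m) * N x" unfolding bs using m by (simp add: N_def)
    then have "1 - m = 1 / (1 + N x)" using Np[of x] by (simp add: field_simps)
    then have "sqrt (1 - m) = f x" by (simp add: f_def real_sqrt_divide)
    then show ?thesis using bs by simp
  qed
  have q': "(q has_derivative (\<lambda>h. 2 * \<mu> * (x \<bullet> h))) (at x)" for x
    unfolding q_def by (auto intro!: derivative_eq_intros simp: inner_commute algebra_simps)
  have R': "(R has_derivative dd R x) (at x)" if x: "x \<in> ?S" for x
  proof -
    have "smooth_on ?S (\<lambda>x. (4 / (q x * q x)) *\<^sub>R (- (2 * (lam + \<mu> * (e \<bullet> x))) *\<^sub>R x + q x *\<^sub>R e))"
      unfolding q_def using qp
      by (intro smooth_on_add smooth_on_scaleR smooth_on_divide smooth_on_minus smooth_on_mult smooth_on_inner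
          smooth_on_const smooth_on_ident oS) (force simp: q_def)
    moreover have "R = (\<lambda>x. (4 / (q x * q x)) *\<^sub>R (- (2 * (lam + \<mu> * (e \<bullet> x))) *\<^sub>R x + q x *\<^sub>R e))"
      by (simp add: R_def q_def fun_eq_iff power2_eq_square)
    ultimately have "smooth_on ?S R" by simp
    then show ?thesis by (rule smooth_on_has_derivative[OF _ x])
  qed
  have L: "inv_into (fst D) (snd D) x \<in> fst D" "snd D (inv_into (fst D) (snd D) x) = x" if "x \<in> ?S" for x
    using chart_inv_mem[OF that] by blast+
  have conf: "y \<bullet> dd (V D) x y = (- 2 * ?k x + 2 * \<mu> * (x \<bullet> V D x) / q x) * (y \<bullet> y)" if x: "x \<in> ?S" for x y
  proof -
    have n: "q x \<noteq> 0" using qp[OF x] by simp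
    have "((\<lambda>u. y \<bullet> (a D u *v y)) has_derivative (\<lambda>h. y \<bullet> (dd (a D) x h *v y))) (at x)"
      by (rule bounded_linear.has_derivative[OF bounded_linear_matrix_form smooth_on_has_derivative[OF smooth_a[OF D] x]])
    moreover have "((\<lambda>u. y \<bullet> (a D u *v y)) has_derivative (\<lambda>h. - 16 * \<mu> * (x \<bullet> h) / (q x) ^ 3 * (y \<bullet> y))) (at x)"
    proof (rule has_derivative_transform_within_open[OF _ oS x])
      show "((\<lambda>u. 4 / (q u)\<^sup>2 * (y \<bullet> y)) has_derivative (\<lambda>h. - 16 * \<mu> * (x \<bullet> h) / (q x) ^ 3 * (y \<bullet> y))) (at x)"
        by (rule has_derivative_mult_left[OF deriv_conformal_factor[OF q' n]])
    qed (simp add: aq)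
    ultimately have "y \<bullet> (dd (a D) x (V D x) *v y) = - 16 * \<mu> * (x \<bullet> V D x) / (q x) ^ 3 * (y \<bullet> y)"
      by (rule has_derivative_unique[THEN fun_cong])
    then have "- 16 * \<mu> * (x \<bullet> V D x) / (q x) ^ 3 * (y \<bullet> y) + 2 * (4 / (q x)\<^sup>2 * (y \<bullet> dd (V D) x y)) = - 4 * ?k x * (4 / (q x)\<^sup>2 * (y \<bullet> y))"
      using conformal_lie(2)[OF cf D L(1)[OF x], of y] unfolding L(2)[OF x] aI[OF x] by simp
    then have "8 / (q x)\<^sup>2 * (y \<bullet> dd (V D) x y) = 16 * \<mu> * (x \<bullet> V D x) / (q x) ^ 3 * (y \<bullet> y) - 4 * ?k x * (4 / (q x)\<^sup>2 * (y \<bullet> y))"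
      by simp
    also have "\<dots> = 8 / (q x)\<^sup>2 * ((- 2 * ?k x + 2 * \<mu> * (x \<bullet> V D x) / q x) * (y \<bullet> y))"
      using n by (simp add: field_simps eval_nat_numeral)
    finally show ?thesis using n by simp
  qed
  have lie: "dd R x (V D x) \<bullet> y + R x \<bullet> dd (V D) x y = - 2 * ?k x * (R x \<bullet> y)" if x: "x \<in> ?S" for x y
  proof -
    define N' where "N' h = (2 * (R x \<bullet> dd R x h) * (q x)\<^sup>2 + (R x \<bullet> R x) * (4 * q x * \<mu> * (x \<bullet> h))) / 4" for h
    define r where "r = sqrt (1 + N x)"
    have r: "r > 0" "r * r = 1 + N x" using Np[of x] by (simp_all add: r_def)
    have N': "(N has_derivative N') (at x)"
      unfolding N_def N'_def
      by (auto intro!: derivative_eq_intros R'[OF x] q' simp: fun_eq_iff inner_commute algebra_simps power2_eq_square)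
    have "((\<lambda>y::real. 1 / sqrt (1 + y)) has_real_derivative - 1 / (2 * r * (1 + N x))) (at (N x))"
      using Np[of x] r by (auto intro!: derivative_eq_intros simp: r_def[symmetric] field_simps)
    from has_derivative_compose[OF N' this[unfolded has_field_derivative_def]]
    have f': "(f has_derivative (\<lambda>h. - N' h / (2 * r * (1 + N x)))) (at x)"
      unfolding f_def by (rule has_derivative_eq_rhs) (simp add: fun_eq_iff)
    have "(b D has_derivative (\<lambda>h. f x *\<^sub>R dd R x h + (- N' h / (2 * r * (1 + N x))) *\<^sub>R R x)) (at x)"
      by (rule has_derivative_transform_within_open[OF has_derivative_scaleR[OF f' R'[OF x]] oS x]) (simp add: bR)
    then have Db: "dd (b D) x h = f x *\<^sub>R dd R x h + (- N' h / (2 * r * (1 + N x))) *\<^sub>R R x" for h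
      by (simp add: dd_eq)
    have e: "f x * (dd R x (V D x) \<bullet> y + R x \<bullet> dd (V D) x y) - N' (V D x) / (2 * r * (1 + N x)) * (R x \<bullet> y) = f x * (- 2 * ?k x * (R x \<bullet> y))" for y
      using conformal_lie(1)[OF cf D L(1)[OF x], of y] unfolding L(2)[OF x] bR[OF x] Db
      by (simp add: inner_simps algebra_simps)
    have fr: "f x = 1 / r" by (simp add: f_def r_def)
    \<comment> \<open>Evaluating \<open>e\<close> on the vector R x and inserting
      \<open>conf\<close> shows that this derivative equals itself times N / (1 + N), a number
      different from 1.\<close>
    have "N' (V D x) = 0"
    proof -
      have n: "q x \<noteq> 0" using qp[OF x] by simp
      have "N' (V D x) = (q x)\<^sup>2 / 2 * (R x \<bullet> dd R x (V D x) + 2 * \<mu> * (x \<bullet> V D x) / q x * (R x \<bullet> R x))"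
        unfolding N'_def using n by (simp add: field_simps power2_eq_square)
      moreover have "dd R x (V D x) \<bullet> R x + 2 * \<mu> * (x \<bullet> V D x) / q x * (R x \<bullet> R x) = r * (N' (V D x) / (2 * r * (1 + N x)) * (R x \<bullet> R x))"
      proof -
        have "f x * (dd R x (V D x) \<bullet> R x + 2 * \<mu> * (x \<bullet> V D x) / q x * (R x \<bullet> R x)) = N' (V D x) / (2 * r * (1 + N x)) * (R x \<bullet> R x)"
          using e[of "R x"] unfolding conf[OF x] by (simp add: algebra_simps)
        then show ?thesis using r(1) unfolding fr by (simp add: field_simps)
      qed
      ultimately have "N' (V D x) = (q x)\<^sup>2 / 2 * (r * (N' (V D x) / (2 * r * (1 + N x)) * (R x \<bullet> R x)))"
        by (simp add: inner_commute)
      also have "\<dots> = N' (V D x) * (N x / (1 + N x))" using r(1) by (simp add: N_def)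
      finally have "N' (V D x) * (1 + N x) = N' (V D x) * N x" using Np[of x] by (simp add: field_simps)
      then show ?thesis by (simp add: algebra_simps)
    qed
    then have "1 / r * (dd R x (V D x) \<bullet> y + R x \<bullet> dd (V D) x y) = 1 / r * (- 2 * ?k x * (R x \<bullet> y))"
      using e[of y] by (simp add: fr)
    then show ?thesis by (rule mult_left_cancel[THEN iffD1, rotated]) (use r(1) in simp)
  qed
  have dense: "\<exists>x\<in>U. R x \<noteq> 0" if U: "open U" "U \<noteq> {}" "U \<subseteq> ?S" for U
  proof -
    define U' where "U' = snd D -` U \<inter> fst D"
    have "continuous_on (fst D) (snd D)" using is_chart[OF D] by (simp add: is_chart_def homeomorphism_def)
    then have "open U'" unfolding U'_def
      using continuous_on_open_vimage[OF open_dom[OF D]] U(1) by blast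
    moreover have "U' \<noteq> {}" using U(2,3) by (auto simp: U'_def)
    ultimately obtain p where p: "p \<in> U'" "b D (snd D p) \<noteq> 0"
      using b_nonzero_dense[of U' D] D by (auto simp: U'_def)
    then have "snd D p \<in> U" "R (snd D p) \<noteq> 0" using bR[of "snd D p"] by (auto simp: U'_def)
    then show ?thesis by blast
  qed
  show ?thesis
    unfolding R_def[symmetric]
  proof (rule normal_field.intro)
    have "continuous_on (fst D) (snd D)" using is_chart[OF D] by (simp add: is_chart_def homeomorphism_def)
    then show "connected ?S" using connected_continuous_image conn by blast
    show "smooth_on ?S (V D)" using cf D unfolding conformal_field_def vector_field_def by blast
    show "1 + \<mu> * (x \<bullet> x) > 0" if "x \<in> ?S" for x using qp[OF that] by (simp add: q_def)
    show "R x = (4 / (1 + \<mu> * (x \<bullet> x))\<^sup>2) *\<^sub>R (- (2 * (lam + \<mu> * (e \<bullet> x))) *\<^sub>R x + (1 + \<mu> * (x \<bullet> x)) *\<^sub>R e)" for x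
      by (simp add: R_def)
    show "y \<bullet> dd (V D) x y = (- 2 * ?k x + 2 * \<mu> * (x \<bullet> V D x) / (1 + \<mu> * (x \<bullet> x))) * (y \<bullet> y)" if "x \<in> ?S" for x y
      using conf[OF that] by (simp add: q_def)
  qed (use oS ne n lie dense in auto)
qed

text \<open>\<open>normal_field\<close> asks for a nonempty coordinate domain, so an empty chart is
  treated apart; there the zero vector and the zero matrix meet the algebraic conditions of each
  case.\<close>

lemma local_forms:
  assumes cf: "conformal_field A F V \<kappa>" and n: "CARD('n) \<ge> 2" and D: "D \<in> A" and conn: "connected (fst D)"
    and nf: "pair_normal_form a b D lam \<mu> e"
  shows "\<exists>\<tau> \<gamma> Q. transpose Q = - Q \<and>
          (\<mu> = 0 \<and> lam = 0 \<and> Q *v e = 0 \<and>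
             (\<forall>x\<in>crange D. V D x = (- 2 * \<tau>) *\<^sub>R x + Q *v x + \<gamma>) \<or>
           \<mu> = 0 \<and> lam \<noteq> 0 \<and> Q *v e = (- 2 * lam) *\<^sub>R \<gamma> \<and>
             (\<forall>x\<in>crange D. V D x = Q *v x + \<gamma>) \<or>
           \<mu> \<noteq> 0 \<and> \<gamma> \<bullet> e = 0 \<and> Q *v e = (- 2 * lam) *\<^sub>R \<gamma> \<and>
             (\<forall>x\<in>crange D. V D x =
                (2 * \<mu> * (\<gamma> \<bullet> x)) *\<^sub>R x + (1 - \<mu> * (norm x)\<^sup>2) *\<^sub>R \<gamma> + Q *v x))" (is ?forms)
    and "\<exists>k. \<forall>p\<in>fst D. \<kappa> p = k"
proof -
  have zero: "transpose (0 :: real^'n^'n) = - 0" by (simp add: transpose_def vec_eq_iff)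
  show ?forms
  proof (cases "fst D = {}")
    case True
    then show ?thesis using zero
      by (intro exI[of _ 0] exI[of _ "0 :: real^'n"] exI[of _ "0 :: real^'n^'n"]) auto
  next
    case False
    interpret N: normal_field "crange D" "V D" "\<lambda>x. \<kappa> (inv_into (fst D) (snd D) x)" lam \<mu> e
      "\<lambda>x. (4 / (1 + \<mu> * (x \<bullet> x))\<^sup>2) *\<^sub>R (- (2 * (lam + \<mu> * (e \<bullet> x))) *\<^sub>R x + (1 + \<mu> * (x \<bullet> x)) *\<^sub>R e)"
      by (rule normal_field[OF cf n D conn False nf])
    have "\<mu> = 0 \<and> lam = 0 \<or> \<mu> = 0 \<and> lam \<noteq> 0 \<or> \<mu> \<noteq> 0" by blast
    then show ?thesis
    proof (elim disjE conjE)
      assume 1: "\<mu> = 0" "lam = 0"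
      obtain \<tau> \<gamma> Q where "transpose Q = - Q" "Q *v e = 0"
        "\<forall>x\<in>crange D. V D x = (- 2 * \<tau>) *\<^sub>R x + Q *v x + \<gamma>"
        using N.form_flat_parallel[OF 1] by (elim exE conjE) (rule that)
      with 1 show ?thesis by (intro exI[of _ \<tau>] exI[of _ \<gamma>] exI[of _ Q]) simp
    next
      assume 2: "\<mu> = 0" "lam \<noteq> 0"
      obtain \<gamma> Q where "transpose Q = - Q" "Q *v e = (- 2 * lam) *\<^sub>R \<gamma>" "\<forall>x\<in>crange D. V D x = Q *v x + \<gamma>"
        using N.form_flat[OF 2] by (elim exE conjE) (rule that)
      with 2 show ?thesis by (intro exI[of _ 0] exI[of _ \<gamma>] exI[of _ Q]) simp
    next
      assume 3: "\<mu> \<noteq> 0"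
      obtain \<gamma> Q where "transpose Q = - Q" "\<gamma> \<bullet> e = 0" "Q *v e = (- 2 * lam) *\<^sub>R \<gamma>"
        "\<forall>x\<in>crange D. V D x = (2 * \<mu> * (\<gamma> \<bullet> x)) *\<^sub>R x + (1 - \<mu> * (norm x)\<^sup>2) *\<^sub>R \<gamma> + Q *v x"
        using N.form_curved[OF 3] by (elim exE conjE) (rule that)
      with 3 show ?thesis by (intro exI[of _ 0] exI[of _ \<gamma>] exI[of _ Q]) simp
    qed
  qed
  show "\<exists>k. \<forall>p\<in>fst D. \<kappa> p = k"
  proof (cases "fst D = {}")
    case False
    interpret N: normal_field "crange D" "V D" "\<lambda>x. \<kappa> (inv_into (fst D) (snd D) x)" lam \<mu> e
      "\<lambda>x. (4 / (1 + \<mu> * (x \<bullet> x))\<^sup>2) *\<^sub>R (- (2 * (lam + \<mu> * (e \<bullet> x))) *\<^sub>R x + (1 + \<mu> * (x \<bullet> x)) *\<^sub>R e)"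
      by (rule normal_field[OF cf n D conn False nf])
    have "\<exists>k. \<forall>x\<in>crange D. \<kappa> (inv_into (fst D) (snd D) x) = k"
    proof (cases "\<mu> = 0 \<and> lam = 0")
      case True
      then obtain \<tau> where "\<forall>x\<in>crange D. \<kappa> (inv_into (fst D) (snd D) x) = \<tau>"
        using N.form_flat_parallel by (elim conjE) (drule (1) N.form_flat_parallel, elim exE conjE, rule that)
      then show ?thesis by (rule exI)
    next
      case False
      then have "\<kappa> (inv_into (fst D) (snd D) x) = 0" if "x \<in> crange D" for x
        using N.k_zero[OF _ that] by blast
      then show ?thesis by blast
    qed
    then obtain k where k: "\<And>x. x \<in> crange D \<Longrightarrow> \<kappa> (inv_into (fst D) (snd D) x) = k" by blast
    have "\<kappa> p = k" if "p \<in> fst D" for p using k[of "snd D p"] inv_chart[OF D that] that by simp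
    then show ?thesis by blast
  qed simp
qed

end

theorem corollary4p1:
  fixes A :: "('m::{t2_space, second_countable_topology}, 'n::finite) chart set"
    and F :: "('m, 'n) chart \<Rightarrow> real^'n \<Rightarrow> real^'n \<Rightarrow> real"
    and a :: "('m, 'n) chart \<Rightarrow> real^'n \<Rightarrow> real^'n^'n"
    and b :: "('m, 'n) chart \<Rightarrow> real^'n \<Rightarrow> real^'n"
    and V :: "('m, 'n) chart \<Rightarrow> real^'n \<Rightarrow> real^'n"
    and \<kappa> :: "'m \<Rightarrow> real"
  assumes "CARD('n) \<ge> 2"
    and "connected (UNIV :: 'm set)"
    and "smooth_structure A"
    and "randers_metric A F a b"
    and "nowhere_locally_zero A b"
    and "locally_projectively_flat A F"
    and "isotropic_S_curvature A F"
    and "conformal_field A F V \<kappa>"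
  shows "(\<exists>k. \<forall>p. \<kappa> p = k) \<and>
    (\<exists>\<mu>. \<forall>p. \<exists>C\<in>A. p \<in> fst C \<and> connected (fst C) \<and>
       (\<exists>lam e. pair_normal_form a b C lam \<mu> e)) \<and>
    (\<forall>C\<in>A. \<forall>lam \<mu> e. connected (fst C) \<and> pair_normal_form a b C lam \<mu> e \<longrightarrow>
       (\<exists>(\<tau>::real) (\<gamma>::real^'n) (Q::real^'n^'n). transpose Q = - Q \<and>
          (\<mu> = 0 \<and> lam = 0 \<and> Q *v e = 0 \<and>
             (\<forall>x\<in>crange C. V C x = (- 2 * \<tau>) *\<^sub>R x + Q *v x + \<gamma>) \<or>
           \<mu> = 0 \<and> lam \<noteq> 0 \<and> Q *v e = (- 2 * lam) *\<^sub>R \<gamma> \<and>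
             (\<forall>x\<in>crange C. V C x = Q *v x + \<gamma>) \<or>
           \<mu> \<noteq> 0 \<and> \<gamma> \<bullet> e = 0 \<and> Q *v e = (- 2 * lam) *\<^sub>R \<gamma> \<and>
             (\<forall>x\<in>crange C. V C x =
                (2 * \<mu> * (\<gamma> \<bullet> x)) *\<^sub>R x + (1 - \<mu> * (norm x)\<^sup>2) *\<^sub>R \<gamma> + Q *v x))))"
proof -
  interpret randers_mfd A F a b
    by unfold_locales (use assms in auto)
  have ex: "\<exists>\<mu>. \<forall>p. \<exists>C\<in>A. p \<in> fst C \<and> connected (fst C) \<and> (\<exists>lam e. pair_normal_form a b C lam \<mu> e)"
    by (rule normal_form_exists[OF assms(2,1,6,7)])
  have "\<exists>U. open U \<and> p \<in> U \<and> (\<forall>q\<in>U. \<kappa> q = \<kappa> p)" for p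
  proof -
    obtain C lam \<mu> e where C: "C \<in> A" "p \<in> fst C" "connected (fst C)" "pair_normal_form a b C lam \<mu> e"
      using ex by blast
    obtain k where "\<forall>q\<in>fst C. \<kappa> q = k" using local_forms(2)[OF assms(8,1) C(1,3,4)] by blast
    then show ?thesis using C(2) open_dom[OF C(1)] by (intro exI[of _ "fst C"]) simp
  qed
  then have "\<kappa> p = \<kappa> q" for p q by (rule locally_constant[OF assms(2)])
  then have "\<exists>k. \<forall>p. \<kappa> p = k" by blast
  then show ?thesis
    using ex local_forms(1)[OF assms(8,1)] by (intro conjI ballI allI impI; (elim conjE)?) assumption+
qed

end
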